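(* As formal power series in $x$, $$\sum_{n\ge1}x^n\sum_{\lambda\vdash n}\Bigl(\sum_{v\in\lambda}\frac1{h_v^2}\Bigr)^2=\prod_{m\ge1}\frac1{1-x^m}\left(\sum_{k\ge1}\frac{x^kk^{-3}}{1-x^k}+\Bigl(\sum_{k\ge1}\frac{x^kk^{-1}}{1-x^k}\Bigr)^2\right).$$
   Context: $\lambda\vdash n$ means $\lambda$ is a partition of $n$ (weakly decreasing positive integers $\lambda_1\ge\cdots\ge\lambda_\ell$ summing to $n$). The boxes of $\lambda$ are the pairs $(i,j)$ with $1\le j\le \lambda_i$; the hook length of $v=(i,j)$ is $h_v=\lambda_i-j+\lambda'_j-i+1$ with $\lambda'_j=\#\{k:\lambda_k\ge j\}$. *)

theory Defs
  imports "HOL-Analysis.Analysis" "HOL-Computational_Algebra.Formal_Power_Series"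
begin

definition partitions :: "nat \<Rightarrow> nat list set" where
  "partitions n = {\<mu>. sorted_wrt (\<ge>) \<mu> \<and> (\<forall>p\<in>set \<mu>. 1 \<le> p) \<and> sum_list \<mu> = n}"

text \<open>Parts, rows and columns are numbered from 1, whereas list positions start at 0.\<close>

definition part :: "nat list \<Rightarrow> nat \<Rightarrow> nat" where
  "part \<mu> i = \<mu> ! (i - 1)"

definition conjugate_part :: "nat list \<Rightarrow> nat \<Rightarrow> nat" where
  "conjugate_part \<mu> j = card {k\<in>{1..length \<mu>}. part \<mu> k \<ge> j}"

definition boxes :: "nat list \<Rightarrow> (nat \<times> nat) set" where
  "boxes \<mu> = (SIGMA i:{1..length \<mu>}. {1..part \<mu> i})"

text \<open>On the boxes of a partition neither subtraction is truncated.\<close>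

definition hook_length :: "nat list \<Rightarrow> nat \<times> nat \<Rightarrow> nat" where
  "hook_length \<mu> = (\<lambda>(i, j). (part \<mu> i - j) + (conjugate_part \<mu> j - i) + 1)"

text \<open>
  The remaining facts show that the finite sums below really range over finite sets, that
  the subtractions above are genuine, and that the infinite sums and products of interest
  converge in the \<open>x\<close>-adic metric of \<^typ>\<open>rat fps\<close>.
\<close>

lemma finite_partitions: "finite (partitions n)"
proof (rule finite_subset)
  show "partitions n \<subseteq> {xs. set xs \<subseteq> {..n} \<and> length xs \<le> n}"
  proof
    fix xs assume "xs \<in> partitions n"
    then have pos: "\<forall>p\<in>set xs. 1 \<le> p" and s: "sum_list xs = n"
      by (auto simp: partitions_def)
    have "length xs \<le> sum_list xs"
      using pos by (induction xs) auto
    then show "xs \<in> {xs. set xs \<subseteq> {..n} \<and> length xs \<le> n}"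
      using s member_le_sum_list by fastforce
  qed
qed (simp add: finite_lists_length_le)

lemma finite_boxes: "finite (boxes \<mu>)"
  by (auto simp: boxes_def)

lemma box_within_hook:
  assumes "\<mu> \<in> partitions n" "(i, j) \<in> boxes \<mu>"
  shows "j \<le> part \<mu> i" "i \<le> conjugate_part \<mu> j"
proof -
  show "j \<le> part \<mu> i" using assms(2) by (auto simp: boxes_def)
  have "{1..i} \<subseteq> {k\<in>{1..length \<mu>}. part \<mu> k \<ge> j}"
  proof
    fix k assume k: "k \<in> {1..i}"
    have i: "i \<le> length \<mu>" "j \<le> \<mu> ! (i - 1)"
      using assms(2) by (auto simp: boxes_def part_def)
    have "\<mu> ! (i - 1) \<le> \<mu> ! (k - 1)"
    proof (cases "k = i")
      case False
      with k i have "k - 1 < i - 1" "i - 1 < length \<mu>" by auto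
      then show ?thesis
        using assms(1) by (auto simp: partitions_def sorted_wrt_iff_nth_less)
    qed simp
    then show "k \<in> {k\<in>{1..length \<mu>}. part \<mu> k \<ge> j}"
      using k i by (auto simp: part_def)
  qed
  then have "card {1..i} \<le> conjugate_part \<mu> j"
    unfolding conjugate_part_def by (intro card_mono) auto
  then show "i \<le> conjugate_part \<mu> j" by simp
qed

lemma fps_sums_finite_coeffs:
  fixes f :: "nat \<Rightarrow> 'a :: ab_group_add fps"
  assumes "\<And>k n. n \<le> k \<Longrightarrow> fps_nth (f k) n = 0"
  shows "f sums Abs_fps (\<lambda>n. \<Sum>k<n. fps_nth (f k) n)"
  unfolding sums_def
proof (rule tendsto_fpsI)
  fix n
  have "fps_nth (\<Sum>k<N. f k) n = (\<Sum>k<n. fps_nth (f k) n)" if "n \<le> N" for N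
    unfolding fps_sum_nth
    by (rule sum.mono_neutral_right) (use that assms in auto)
  then show "eventually (\<lambda>N. fps_nth (\<Sum>k<N. f k) n =
      fps_nth (Abs_fps (\<lambda>n. \<Sum>k<n. fps_nth (f k) n)) n) sequentially"
    by (auto simp: eventually_sequentially)
qed

lemma summable_fps_X_power_mult:
  fixes g :: "nat \<Rightarrow> 'a :: comm_ring_1 fps"
  shows "summable (\<lambda>k. fps_X ^ Suc k * g k)"
  by (rule sums_summable[OF fps_sums_finite_coeffs]) (subst fps_X_power_mult_nth, simp)

lemma summable_lambert:
  "summable (\<lambda>k. fps_X ^ Suc k * fps_const (c k) / (1 - fps_X ^ Suc k :: 'a :: field fps))"
proof -
  have "fps_X ^ Suc k * fps_const (c k) / (1 - fps_X ^ Suc k :: 'a fps)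
      = fps_X ^ Suc k * (fps_const (c k) * inverse (1 - fps_X ^ Suc k))" for k
    by (simp add: fps_divide_unit mult.assoc)
  then show ?thesis
    by (simp only: summable_fps_X_power_mult)
qed

lemma convergent_prod_geometric:
  "convergent_prod (\<lambda>m. 1 / (1 - fps_X ^ Suc m :: 'a :: field fps))"
proof -
  let ?f = "\<lambda>m. 1 / (1 - fps_X ^ Suc m :: 'a fps)"
  define P where "P n = (\<Prod>m<n. ?f m)" for n
  have one: "?f m - 1 = fps_X ^ Suc m * inverse (1 - fps_X ^ Suc m)" for m
  proof -
    have "inverse (1 - fps_X ^ Suc m :: 'a fps) * (1 - fps_X ^ Suc m) = 1"
      by (rule inverse_mult_eq_1) simp
    then show ?thesis
      by (simp add: fps_divide_unit algebra_simps)
  qed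
  have "P (Suc n) - P n = fps_X ^ Suc n * (P n * inverse (1 - fps_X ^ Suc n))" for n
    using one[of n] by (simp add: P_def algebra_simps)
  then have "summable (\<lambda>n. P (Suc n) - P n)"
    by (simp only: summable_fps_X_power_mult)
  then obtain S where S: "(\<lambda>N. \<Sum>n<N. P (Suc n) - P n) \<longlonglongrightarrow> S"
    by (auto simp: summable_def sums_def)
  have P0: "P 0 = 1" by (simp add: P_def)
  from S have lim: "(\<lambda>N. P N - 1) \<longlonglongrightarrow> S"
    by (simp add: sum_lessThan_telescope P0)
  have lim1: "P \<longlonglongrightarrow> S + 1"
  proof (rule tendsto_fpsI)
    fix n
    show "eventually (\<lambda>N. fps_nth (P N) n = fps_nth (S + 1) n) sequentially"
      using lim[unfolded tendsto_fps_iff, rule_format, of n]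
      by eventually_elim (simp add: algebra_simps)
  qed
  have "fps_nth (P N) 0 = 1" for N
    by (induction N) (auto simp: P_def fps_divide_unit)
  moreover have "eventually (\<lambda>N. fps_nth (P N) 0 = fps_nth (S + 1) 0) sequentially"
    using lim1[unfolded tendsto_fps_iff] by blast
  ultimately have "fps_nth (S + 1) 0 = 1"
    by simp
  then have "S + 1 \<noteq> 0"
    by (metis fps_zero_nth zero_neq_one)
  moreover have "(\<lambda>n. \<Prod>i\<le>n. ?f (i + 0)) \<longlonglongrightarrow> S + 1"
    using LIMSEQ_Suc[OF lim1] by (simp add: P_def lessThan_Suc_atMost)
  ultimately show ?thesis
    unfolding convergent_prod_def raw_has_prod_def by blast
qed

end

theory Submission
  imports Defs
    "HOL-Computational_Algebra.Formal_Laurent_Series"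
    "Jordan_Normal_Form.Determinant"
begin

text \<open>
  Since \<open>(\<Sum> 1/h\<^sup>2)\<^sup>2 = \<Sum> 1/h\<^sup>4 + 2 e\<^sub>2(1/h\<^sup>2)\<close>, two facts suffice. Counting the hooks of each
  length among all partitions of \<open>n\<close> gives the part with \<open>\<Sum> 1/h\<^sup>4\<close>; the part with \<open>e\<^sub>2\<close> is the
  coefficient of \<open>z\<^sup>2\<close> in the Nekrasov--Okounkov formula
  \<open>\<Sum>\<^sub>\<lambda> x\<^bsup>|\<lambda>|\<^esup> \<Prod>\<^sub>h (1 - z/h\<^sup>2) = \<Prod>\<^sub>m (1 - x\<^sup>m)\<^bsup>z-1\<^esup>\<close>.

  For the latter, let \<open>\<Phi>\<close> be the 0/1 matrix on partitions that records horizontal strips. The trace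
  of \<open>x\<^sup>L \<Phi>\<^sup>a (\<Phi>\<^sup>T)\<^sup>b\<close>, where \<open>L\<close> is the size, equals \<open>\<Prod>\<^sub>m (1 - x\<^sup>m)\<^bsup>-1-ab\<^esup>\<close>: by the skew Cauchy identity the
  last factor can be moved around the trace. On the other hand, in terms of beta numbers
  \<open>\<Phi>\<close> consists of the minors of the matrix with entries \<open>[i \<ge> j]\<close>, so by Cauchy--Binet the diagonal entries
  of \<open>\<Phi>\<^sup>a (\<Phi>\<^sup>T)\<^sup>b\<close> are minors of an explicit matrix that is polynomial in \<open>a\<close> and \<open>b\<close>. At \<open>b = -a\<close>
  these are Cauchy determinants, with value \<open>\<Prod>\<^sub>h (1 - a\<^sup>2/h\<^sup>2)\<close>.
\<close>

section \<open>Horizontal strips\<close>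

text \<open>The trace counts chains, so it is evaluated only for natural a and b, while the Cauchy
  determinants live on the line b = -a. Interpolation bridges this: in each degree both sides are
  polynomials in a and b, and agreement at all pairs of naturals gives agreement everywhere. At b =
  -a the recurrence for the matrix entries along diagonals has a closed form, thanks to (i+1)(j+1) -
  a(a+i-j) = (i+1+a)(j+1-a). That form has poles at a+i-j = 0, hence a runs over half-integers,
  whose squares still determine a polynomial in z = a^2. The second Lambert series enters as a
  logarithm: s = sum_k x^k/(k(1-x^k)) is the logarithm of P = prod_m 1/(1-x^m), so the right side of
  the Nekrasov--Okounkov formula is P exp(-z s). Its coefficient of z^2 is P s^2/2, and 2 e_2
  contributes P s^2. The hooks of length k have generating function k P x^k/(1-x^k), so the weight
  1/k^4 leaves k^(-3).\<close>

text \<open>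
  Partitions are weakly decreasing sequences indexed from 0 and padded with zeros;
  \<open>f \<succ> g\<close> says that \<open>f / g\<close> is a horizontal strip.
\<close>

definition shapes :: "(nat \<Rightarrow> nat) set" where
  "shapes = {f. antimono f \<and> finite {i. f i \<noteq> 0}}"

definition wt :: "(nat \<Rightarrow> nat) \<Rightarrow> nat" where
  "wt f = (\<Sum>i | f i \<noteq> 0. f i)"

definition shapes_of :: "nat \<Rightarrow> (nat \<Rightarrow> nat) set" where
  "shapes_of n = {f \<in> shapes. wt f = n}"

definition interlaces :: "(nat \<Rightarrow> nat) \<Rightarrow> (nat \<Rightarrow> nat) \<Rightarrow> bool" (infix \<open>\<succ>\<close> 50) where
  "f \<succ> g \<longleftrightarrow> (\<forall>i. g i \<le> f i \<and> f (Suc i) \<le> g i)"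

lemma wt_window:
  assumes "\<And>i. i \<ge> N \<Longrightarrow> f i = 0"
  shows "wt f = (\<Sum>i<N. f i)"
proof -
  have "i < N" if "f i \<noteq> 0" for i
    using assms[of i] that by (cases "i < N") auto
  then have "{i. f i \<noteq> 0} \<subseteq> {..<N}" by auto
  then show ?thesis unfolding wt_def by (intro sum.mono_neutral_left) auto
qed

text \<open>If row i were nonempty, the i + 1 rows up to it would all be, and the weight would
  exceed i. Hence n rows suffice for every shape of weight n.\<close>

lemma shapes_window:
  assumes "f \<in> shapes" "wt f \<le> i"
  shows "f i = 0"
proof (rule ccontr)
  assume "f i \<noteq> 0"
  have nz: "f j \<noteq> 0" if "j \<le> i" for j
  proof -
    have "f i \<le> f j" using assms(1) that by (simp add: shapes_def antimonoD)
    with \<open>f i \<noteq> 0\<close> show ?thesis by simp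
  qed
  have "Suc i = (\<Sum>j\<le>i. 1)" by simp
  also have "\<dots> \<le> (\<Sum>j\<le>i. f j)"
    by (rule sum_mono) (use nz in \<open>auto simp: Suc_le_eq\<close>)
  also have "\<dots> \<le> wt f"
    unfolding wt_def by (rule sum_mono2) (use assms nz in \<open>auto simp: shapes_def\<close>)
  finally show False using assms(2) by simp
qed

lemma shapes_common_window:
  assumes "f \<in> shapes" "g \<in> shapes"
  obtains N where "\<And>i. i \<ge> N \<Longrightarrow> f i = 0" "\<And>i. i \<ge> N \<Longrightarrow> g i = 0"
proof
  show "f i = 0" "g i = 0" if "i \<ge> max (wt f) (wt g)" for i
    using that assms shapes_window by auto
qed

lemma shapes_le_wt:
  assumes "f \<in> shapes"
  shows "f i \<le> wt f"
proof (cases "f i = 0")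
  case False
  then show ?thesis
    unfolding wt_def using assms by (intro member_le_sum) (auto simp: shapes_def)
qed simp

lemma finite_shapes_of: "finite (shapes_of n)"
proof (rule finite_subset)
  show "shapes_of n \<subseteq> {f. \<forall>i. (i \<in> {..<n} \<longrightarrow> f i \<in> {..n}) \<and> (i \<notin> {..<n} \<longrightarrow> f i = 0)}"
    using shapes_window shapes_le_wt by (auto simp: shapes_of_def)
qed (rule finite_set_of_finite_funs, auto)

lemma wt_mono:
  assumes "f \<in> shapes" "g \<in> shapes" "\<And>i. g i \<le> f i"
  shows "wt g \<le> wt f"
proof -
  obtain N where "\<And>i. i \<ge> N \<Longrightarrow> f i = 0" "\<And>i. i \<ge> N \<Longrightarrow> g i = 0"
    using shapes_common_window assms by metis
  then show ?thesis using wt_window[of N f] wt_window[of N g] assms(3) by (simp add: sum_mono)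
qed

lemma wt_mono_eq:
  assumes "f \<in> shapes" "g \<in> shapes" "\<And>i. g i \<le> f i" "wt g = wt f"
  shows "g = f"
proof
  fix i
  obtain N where N: "\<And>i. i \<ge> N \<Longrightarrow> f i = 0" "\<And>i. i \<ge> N \<Longrightarrow> g i = 0"
    using shapes_common_window assms by metis
  show "g i = f i"
  proof (cases "i < N")
    case True
    have "(\<Sum>i<N. g i) = (\<Sum>i<N. f i)"
      using assms(4) wt_window[of N f] wt_window[of N g] N by simp
    then show ?thesis using sum_mono_inv[of g "{..<N}" f i] assms(3) True by auto
  qed (use N in auto)
qed

lemma interlaces_shape:
  assumes "f \<in> shapes" "f \<succ> g"
  shows "g \<in> shapes"
proof -
  have "g (Suc i) \<le> g i" for i
    using assms(2) by (meson interlaces_def le_trans)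
  then have "antimono g" by (simp add: decseq_Suc_iff)
  moreover have "{i. g i \<noteq> 0} \<subseteq> {i. f i \<noteq> 0}"
  proof
    fix i assume "i \<in> {i. g i \<noteq> 0}"
    moreover have "g i \<le> f i" using assms(2) by (simp add: interlaces_def)
    ultimately show "i \<in> {i. f i \<noteq> 0}" by auto
  qed
  then have "finite {i. g i \<noteq> 0}"
    using assms(1) finite_subset by (auto simp: shapes_def)
  ultimately show ?thesis by (simp add: shapes_def)
qed

lemma interlaces_shape':
  assumes "f \<succ> g" "g \<in> shapes"
  shows "f \<in> shapes"
proof -
  have "f (Suc i) \<le> f i" for i
    using assms(1) le_trans[of "f (Suc i)" "g i" "f i"] by (simp add: interlaces_def)
  then have "antimono f" by (simp add: decseq_Suc_iff)
  moreover have "f i = 0" if "i \<ge> Suc (wt g)" for i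
  proof -
    obtain j where j: "i = Suc j" "j \<ge> wt g" using \<open>i \<ge> Suc (wt g)\<close> by (auto dest: Suc_le_D)
    have "f i \<le> g j" using assms(1) j(1) by (simp add: interlaces_def)
    then show ?thesis using shapes_window[OF assms(2) j(2)] by simp
  qed
  then have "{i. f i \<noteq> 0} \<subseteq> {..<Suc (wt g)}" by (metis (mono_tags, lifting) lessThan_iff mem_Collect_eq not_le subsetI)
  ultimately show ?thesis using finite_subset by (auto simp: shapes_def)
qed

lemma interlaces_wt:
  assumes "f \<in> shapes" "f \<succ> g"
  shows "wt g \<le> wt f"
  by (rule wt_mono[OF assms(1) interlaces_shape[OF assms]]) (use assms(2) in \<open>simp add: interlaces_def\<close>)

lemma finite_interlaced:
  assumes "f \<in> shapes"
  shows "finite {g. f \<succ> g}"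
proof (rule finite_subset)
  show "{g. f \<succ> g} \<subseteq> (\<Union>n\<le>wt f. shapes_of n)"
    using interlaces_shape[OF assms] interlaces_wt[OF assms] by (auto simp: shapes_of_def)
qed (use finite_shapes_of in auto)

text \<open>Sum the local relation over all rows. The maxima appear shifted by one row, and max +
  min restores \<open>\<mu>\<close> + \<open>\<nu>\<close>; only the terms of row 0 fail to match
  up.\<close>

lemma toggle_wt:
  assumes sh: "\<mu> \<in> shapes" "\<nu> \<in> shapes" "\<kappa> \<in> shapes" "\<rho> \<in> shapes"
    and tog: "\<And>i. \<kappa> i + \<rho> (Suc i) = max (\<mu> (Suc i)) (\<nu> (Suc i)) + min (\<mu> i) (\<nu> i)"
  shows "wt \<kappa> + wt \<rho> + max (\<mu> 0) (\<nu> 0) = \<rho> 0 + wt \<mu> + wt \<nu>"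
proof -
  obtain N1 where N1: "\<And>i. i \<ge> N1 \<Longrightarrow> \<mu> i = 0" "\<And>i. i \<ge> N1 \<Longrightarrow> \<nu> i = 0"
    using shapes_common_window sh by metis
  obtain N2 where N2: "\<And>i. i \<ge> N2 \<Longrightarrow> \<kappa> i = 0" "\<And>i. i \<ge> N2 \<Longrightarrow> \<rho> i = 0"
    using shapes_common_window sh by metis
  define N where "N = max N1 N2"
  have w: "wt \<mu> = (\<Sum>i<N. \<mu> i)" "wt \<nu> = (\<Sum>i<N. \<nu> i)" "wt \<kappa> = (\<Sum>i<N. \<kappa> i)"
      "wt \<rho> = (\<Sum>i<Suc N. \<rho> i)"
    by (rule wt_window; simp add: N_def N1 N2)+
  have "(\<Sum>i<N. \<kappa> i) + (\<Sum>i<N. \<rho> (Suc i)) + max (\<mu> 0) (\<nu> 0)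
      = (\<Sum>i<Suc N. max (\<mu> i) (\<nu> i)) + (\<Sum>i<N. min (\<mu> i) (\<nu> i))"
    by (simp only: sum.distrib[symmetric] tog sum.lessThan_Suc_shift) (simp add: sum.distrib)
  also have "(\<Sum>i<Suc N. max (\<mu> i) (\<nu> i)) = (\<Sum>i<N. max (\<mu> i) (\<nu> i))"
    using N1 by (simp add: N_def)
  also have "\<dots> + (\<Sum>i<N. min (\<mu> i) (\<nu> i)) = (\<Sum>i<N. \<mu> i) + (\<Sum>i<N. \<nu> i)"
    by (simp only: sum.distrib[symmetric]) (rule sum.cong, auto simp: max_def min_def)
  finally show ?thesis
    unfolding w sum.lessThan_Suc_shift[of \<rho>] by simp
qed

text \<open>
  The skew Cauchy identity for one variable on each side. Both \<open>\<rho> (i + 1)\<close> and \<open>\<kappa> i\<close> range over the same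
  interval, from \<open>max (\<mu> (i + 1)) (\<nu> (i + 1))\<close> to \<open>min (\<mu> i) (\<nu> i)\<close>; reflecting this interval
  turns \<open>\<rho>\<close> into \<open>\<kappa>\<close>, and only \<open>\<rho> 0\<close> remains free.
\<close>

lemma card_interlacing_both:
  assumes sh: "\<mu> \<in> shapes" "\<nu> \<in> shapes"
  shows "card {\<rho> \<in> shapes_of m. \<rho> \<succ> \<mu> \<and> \<rho> \<succ> \<nu>}
       = card {\<kappa>. \<mu> \<succ> \<kappa> \<and> \<nu> \<succ> \<kappa> \<and> wt \<mu> + wt \<nu> \<le> wt \<kappa> + m}"
    (is "card ?U = card ?D")
proof -
  define u where "u i = max (\<mu> (Suc i)) (\<nu> (Suc i)) + min (\<mu> i) (\<nu> i)" for i
  define down where "down \<rho> = (\<lambda>i. u i - \<rho> (Suc i))" for \<rho> :: "nat \<Rightarrow> nat"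
  \<comment> \<open>The entry in row 0 is the one that \<open>toggle_wt\<close> forces when the
    result is to have weight m; on \<open>?D\<close> the subtraction is not truncated.\<close>
  define up where "up \<kappa> = case_nat (max (\<mu> 0) (\<nu> 0) + (wt \<kappa> + m - (wt \<mu> + wt \<nu>))) (\<lambda>i. u i - \<kappa> i)"
    for \<kappa>
  have D: "\<mu> \<succ> down \<rho>" "\<nu> \<succ> down \<rho>" "\<And>i. down \<rho> i + \<rho> (Suc i) = u i"
      "wt (down \<rho>) + wt \<rho> + max (\<mu> 0) (\<nu> 0) = \<rho> 0 + wt \<mu> + wt \<nu>"
      "max (\<mu> 0) (\<nu> 0) \<le> \<rho> 0"
    if "\<rho> \<in> shapes" "\<rho> \<succ> \<mu>" "\<rho> \<succ> \<nu>" for \<rho>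
  proof -
    have b: "\<rho> (Suc i) \<le> min (\<mu> i) (\<nu> i)" "max (\<mu> i) (\<nu> i) \<le> \<rho> i" for i
      using that by (auto simp: interlaces_def)
    have d: "max (\<mu> (Suc i)) (\<nu> (Suc i)) \<le> down \<rho> i" "down \<rho> i \<le> min (\<mu> i) (\<nu> i)" for i
      using b[of i] b(2)[of "Suc i"] by (auto simp: down_def u_def)
    then show m: "\<mu> \<succ> down \<rho>" "\<nu> \<succ> down \<rho>" by (auto simp: interlaces_def)
    show t: "down \<rho> i + \<rho> (Suc i) = u i" for i
      using b[of i] by (auto simp: down_def u_def)
    show "wt (down \<rho>) + wt \<rho> + max (\<mu> 0) (\<nu> 0) = \<rho> 0 + wt \<mu> + wt \<nu>"
      using toggle_wt[OF sh interlaces_shape[OF sh(1) m(1)] that(1)] t by (simp add: u_def)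
    show "max (\<mu> 0) (\<nu> 0) \<le> \<rho> 0" using b by auto
  qed
  have U: "up \<kappa> \<in> shapes" "up \<kappa> \<succ> \<mu>" "up \<kappa> \<succ> \<nu>" "\<And>i. \<kappa> i + up \<kappa> (Suc i) = u i"
      "wt \<kappa> + wt (up \<kappa>) + max (\<mu> 0) (\<nu> 0) = up \<kappa> 0 + wt \<mu> + wt \<nu>"
    if "\<mu> \<succ> \<kappa>" "\<nu> \<succ> \<kappa>" for \<kappa>
  proof -
    have b: "\<kappa> i \<le> min (\<mu> i) (\<nu> i)" "max (\<mu> (Suc i)) (\<nu> (Suc i)) \<le> \<kappa> i" for i
      using that by (auto simp: interlaces_def)
    have d: "up \<kappa> (Suc i) \<le> min (\<mu> i) (\<nu> i)" "max (\<mu> i) (\<nu> i) \<le> up \<kappa> i" for i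
    proof -
      show "up \<kappa> (Suc i) \<le> min (\<mu> i) (\<nu> i)"
        using b(2)[of i] by (auto simp: up_def u_def)
      show "max (\<mu> i) (\<nu> i) \<le> up \<kappa> i"
        using b(1)[of "i - 1"] by (cases i) (auto simp: up_def u_def)
    qed
    then show m: "up \<kappa> \<succ> \<mu>" "up \<kappa> \<succ> \<nu>" by (auto simp: interlaces_def)
    then show s: "up \<kappa> \<in> shapes" using interlaces_shape' sh by blast
    show t: "\<kappa> i + up \<kappa> (Suc i) = u i" for i
      using b(1)[of i] by (auto simp: up_def u_def)
    show "wt \<kappa> + wt (up \<kappa>) + max (\<mu> 0) (\<nu> 0) = up \<kappa> 0 + wt \<mu> + wt \<nu>"
      using toggle_wt[OF sh interlaces_shape[OF sh(1) that(1)] s] t by (simp add: u_def)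
  qed
  have "bij_betw down ?U ?D"
  proof (rule bij_betw_byWitness[where f' = up])
    show "\<forall>\<rho>\<in>?U. up (down \<rho>) = \<rho>"
    proof
      fix \<rho> assume l: "\<rho> \<in> ?U"
      then have s: "\<rho> \<in> shapes" "\<rho> \<succ> \<mu>" "\<rho> \<succ> \<nu>" "wt \<rho> = m" by (auto simp: shapes_of_def)
      show "up (down \<rho>) = \<rho>"
      proof
        fix i
        show "up (down \<rho>) i = \<rho> i"
        proof (cases i)
          case 0
          have "up (down \<rho>) 0 = max (\<mu> 0) (\<nu> 0) + (wt (down \<rho>) + m - (wt \<mu> + wt \<nu>))"
            by (simp add: up_def)
          then have "up (down \<rho>) 0 = \<rho> 0" using D(4,5)[OF s(1-3)] s(4) by linarith
          then show ?thesis by (simp only: 0)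
        next
          case (Suc j)
          then show ?thesis using D(3)[OF s(1-3), of j] by (simp add: up_def)
        qed
      qed
    qed
    show "\<forall>\<kappa>\<in>?D. down (up \<kappa>) = \<kappa>"
    proof
      fix \<kappa> assume "\<kappa> \<in> ?D"
      then have s: "\<mu> \<succ> \<kappa>" "\<nu> \<succ> \<kappa>" by auto
      show "down (up \<kappa>) = \<kappa>"
      proof
        fix i
        show "down (up \<kappa>) i = \<kappa> i"
          using U(4)[OF s, of i] by (simp add: down_def)
      qed
    qed
    show "down ` ?U \<subseteq> ?D"
    proof (rule image_subsetI)
      fix \<rho> assume l: "\<rho> \<in> ?U"
      then have s: "\<rho> \<in> shapes" "\<rho> \<succ> \<mu>" "\<rho> \<succ> \<nu>" "wt \<rho> = m" by (auto simp: shapes_of_def)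
      show "down \<rho> \<in> ?D" using D(1,2,4,5)[OF s(1-3)] s(4) by (simp del: max.bounded_iff)
    qed
    show "up ` ?D \<subseteq> ?U"
    proof (rule image_subsetI)
      fix \<kappa> assume k: "\<kappa> \<in> ?D"
      then have s: "\<mu> \<succ> \<kappa>" "\<nu> \<succ> \<kappa>" by auto
      have "up \<kappa> 0 = max (\<mu> 0) (\<nu> 0) + (wt \<kappa> + m - (wt \<mu> + wt \<nu>))"
        by (simp add: up_def)
      then have "wt (up \<kappa>) = m" using U(5)[OF s] k by simp
      then show "up \<kappa> \<in> ?U" using U(1-3)[OF s] by (simp add: shapes_of_def)
    qed
  qed
  then show ?thesis by (rule bij_betw_same_card)
qed

section \<open>The skew Cauchy identity\<close>

text \<open>The skew Schur function of f/g at a ones, that is, the number of semistandard tableaux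
  of shape f/g with entries in 1..a. The values are rational because they will be compared with
  determinants that are polynomial in a.\<close>

primrec chain_count :: "nat \<Rightarrow> (nat \<Rightarrow> nat) \<Rightarrow> (nat \<Rightarrow> nat) \<Rightarrow> rat" where
  "chain_count 0 f g = of_bool (f = g)"
| "chain_count (Suc a) f g = (\<Sum>r | f \<succ> r. chain_count a r g)"

lemma chain_count_1: "f \<in> shapes \<Longrightarrow> chain_count (Suc 0) f g = of_bool (f \<succ> g)"
  using finite_interlaced[of f] by (simp add: of_bool_def)

lemma chain_count_nonzero:
  assumes "f \<in> shapes" "chain_count a f g \<noteq> 0"
  shows "g \<in> shapes \<and> (\<forall>i. g i \<le> f i)"
  using assms
proof (induction a arbitrary: f)
  case (Suc a)
  then obtain r where r: "f \<succ> r" "chain_count a r g \<noteq> 0"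
    by (auto elim: sum.not_neutral_contains_not_neutral)
  with Suc have "g \<in> shapes \<and> (\<forall>i. g i \<le> r i)" using interlaces_shape by blast
  with r(1) show ?case unfolding interlaces_def by (meson le_trans)
qed (auto simp: of_bool_def split: if_splits)

lemma chain_count_wt:
  assumes "f \<in> shapes" "chain_count a f g \<noteq> 0"
  shows "wt g \<le> wt f"
  using chain_count_nonzero[OF assms] wt_mono[OF assms(1)] by blast

lemma interlaces_refl: "f \<in> shapes \<Longrightarrow> f \<succ> f"
  by (auto simp: interlaces_def shapes_def antimono_def)

lemma chain_count_self:
  assumes "f \<in> shapes"
  shows "chain_count a f f = 1"
proof (induction a)
  case (Suc a)
  have "chain_count (Suc a) f f = (\<Sum>r\<in>{f}. chain_count a r f)"
    unfolding chain_count.simps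
  proof (rule sum.mono_neutral_right)
    show "\<forall>r\<in>{r. f \<succ> r} - {f}. chain_count a r f = 0"
    proof (rule ballI, rule ccontr)
      fix r assume r: "r \<in> {r. f \<succ> r} - {f}" "chain_count a r f \<noteq> 0"
      then have "f \<succ> r" by simp
      then have "\<forall>i. f i \<le> r i" "\<forall>i. r i \<le> f i"
        using chain_count_nonzero[OF interlaces_shape[OF assms] r(2)] by (auto simp: interlaces_def)
      then have "r = f" by (simp add: fun_eq_iff le_antisym)
      with r show False by simp
    qed
  qed (use assms finite_interlaced interlaces_refl in auto)
  with Suc show ?case by simp
qed simp

text \<open>A chain can only shrink a shape, so equal weights leave the constant chain alone. This
  is the identity part that survives at the end of the trace computation.\<close>

lemma chain_count_same_wt:
  assumes "f \<in> shapes" "wt f = wt g"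
  shows "chain_count a f g = of_bool (f = g)"
proof (cases "chain_count a f g = 0")
  case False
  then have "g = f"
    using chain_count_nonzero[OF assms(1) False] wt_mono_eq[OF assms(1)] assms(2) by metis
  then show ?thesis using chain_count_self assms by simp
qed (use chain_count_self[OF assms(1)] in auto)

text \<open>
  Indexing by \<open>j = wt \<mu> + wt \<nu> - wt \<kappa>\<close> makes both series symmetric under exchange of \<open>(a, \<mu>)\<close>
  and \<open>(b, \<nu>)\<close>, so that the skew Cauchy identity needs an induction on \<open>a\<close> only.
\<close>

definition up_fps :: "nat \<Rightarrow> nat \<Rightarrow> (nat \<Rightarrow> nat) \<Rightarrow> (nat \<Rightarrow> nat) \<Rightarrow> rat fps" where
  "up_fps a b \<mu> \<nu> = Abs_fps (\<lambda>m. \<Sum>r\<in>shapes_of m. chain_count b r \<mu> * chain_count a r \<nu>)"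

definition down_fps :: "nat \<Rightarrow> nat \<Rightarrow> (nat \<Rightarrow> nat) \<Rightarrow> (nat \<Rightarrow> nat) \<Rightarrow> rat fps" where
  "down_fps a b \<mu> \<nu> = Abs_fps (\<lambda>j. \<Sum>k<Suc (wt \<mu> + wt \<nu>).
      if k + j = wt \<mu> + wt \<nu> then \<Sum>\<kappa>\<in>shapes_of k. chain_count a \<mu> \<kappa> * chain_count b \<nu> \<kappa> else 0)"

lemma up_fps_commute: "up_fps a b \<mu> \<nu> = up_fps b a \<nu> \<mu>"
  by (simp add: up_fps_def mult.commute)

lemma down_fps_nth:
  "fps_nth (down_fps a b \<mu> \<nu>) j = (if j \<le> wt \<mu> + wt \<nu> then
     \<Sum>\<kappa>\<in>shapes_of (wt \<mu> + wt \<nu> - j). chain_count a \<mu> \<kappa> * chain_count b \<nu> \<kappa> else 0)"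
proof (cases "j \<le> wt \<mu> + wt \<nu>")
  case True
  then have "(k + j = wt \<mu> + wt \<nu>) = (k = wt \<mu> + wt \<nu> - j)" for k by auto
  then show ?thesis using True by (simp add: down_fps_def)
next
  case False
  then have "k + j \<noteq> wt \<mu> + wt \<nu>" for k by auto
  with False show ?thesis by (simp add: down_fps_def)
qed

lemma down_fps_commute: "down_fps a b \<mu> \<nu> = down_fps b a \<nu> \<mu>"
  by (simp add: fps_eq_iff down_fps_nth mult.commute add.commute)

lemma up_fps_0: "\<nu> \<in> shapes \<Longrightarrow> up_fps 0 b \<mu> \<nu> = fps_X ^ wt \<nu> * fps_const (chain_count b \<nu> \<mu>)"
proof (rule fps_ext)
  fix m
  assume \<nu>: "\<nu> \<in> shapes"
  have "fps_nth (up_fps 0 b \<mu> \<nu>) m = (\<Sum>r\<in>shapes_of m. if \<nu> = r then chain_count b r \<mu> else 0)"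
    unfolding up_fps_def by (auto intro!: sum.cong)
  also have "\<dots> = (if wt \<nu> = m then chain_count b \<nu> \<mu> else 0)"
    using \<nu> finite_shapes_of[of m] by (simp add: shapes_of_def)
  also have "\<dots> = fps_nth (fps_X ^ wt \<nu> * fps_const (chain_count b \<nu> \<mu>)) m"
    by (simp add: fps_X_power_mult_nth)
  finally show "fps_nth (up_fps 0 b \<mu> \<nu>) m = fps_nth (fps_X ^ wt \<nu> * fps_const (chain_count b \<nu> \<mu>)) m" .
qed

lemma down_fps_0: "\<mu> \<in> shapes \<Longrightarrow> down_fps 0 b \<mu> \<nu> = fps_X ^ wt \<nu> * fps_const (chain_count b \<nu> \<mu>)"
proof (rule fps_ext)
  fix j
  assume \<mu>: "\<mu> \<in> shapes"
  have inner: "(\<Sum>\<kappa>\<in>shapes_of k. chain_count 0 \<mu> \<kappa> * chain_count b \<nu> \<kappa>) = (if wt \<mu> = k then chain_count b \<nu> \<mu> else 0)" for k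
  proof -
    have "(\<Sum>\<kappa>\<in>shapes_of k. chain_count 0 \<mu> \<kappa> * chain_count b \<nu> \<kappa>)
        = (\<Sum>\<kappa>\<in>shapes_of k. if \<mu> = \<kappa> then chain_count b \<nu> \<kappa> else 0)"
      by (auto intro!: sum.cong)
    also have "\<dots> = (if wt \<mu> = k then chain_count b \<nu> \<mu> else 0)"
      using \<mu> finite_shapes_of[of k] by (simp add: shapes_of_def)
    finally show ?thesis .
  qed
  show "fps_nth (down_fps 0 b \<mu> \<nu>) j = fps_nth (fps_X ^ wt \<nu> * fps_const (chain_count b \<nu> \<mu>)) j"
    by (auto simp: fps_X_power_mult_nth down_fps_nth inner simp del: chain_count.simps)
qed

lemma inverse_1_minus_X_nth: "fps_nth (inverse (1 - fps_X :: 'a :: field fps)) n = 1"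
  by (simp add: fps_inverse_one_minus_fps_X)

lemma sum_shapes_of_interlaced:
  assumes "\<mu> \<in> shapes"
  shows "(\<Sum>\<kappa>\<in>shapes_of k. chain_count (Suc 0) \<mu> \<kappa> * F \<kappa>) = (\<Sum>\<kappa> | \<mu> \<succ> \<kappa>. if wt \<kappa> = k then F \<kappa> else 0)"
proof -
  have "(\<Sum>\<kappa>\<in>shapes_of k. chain_count (Suc 0) \<mu> \<kappa> * F \<kappa>) = (\<Sum>\<kappa>\<in>shapes_of k. if \<mu> \<succ> \<kappa> then F \<kappa> else 0)"
    by (rule sum.cong) (simp_all only: chain_count_1[OF assms], simp)
  also have "\<dots> = sum F {\<kappa> \<in> shapes_of k. \<mu> \<succ> \<kappa>}"
    by (rule sum.inter_filter[OF finite_shapes_of, symmetric])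
  also have "{\<kappa> \<in> shapes_of k. \<mu> \<succ> \<kappa>} = {\<kappa> \<in> {\<kappa>. \<mu> \<succ> \<kappa>}. wt \<kappa> = k}"
    using interlaces_shape[OF assms] by (auto simp: shapes_of_def)
  also have "sum F \<dots> = (\<Sum>\<kappa> | \<mu> \<succ> \<kappa>. if wt \<kappa> = k then F \<kappa> else 0)"
    by (rule sum.inter_filter[OF finite_interlaced[OF assms]])
  finally show ?thesis .
qed

lemma down_fps_1_nth:
  assumes "\<mu> \<in> shapes"
  shows "fps_nth (down_fps (Suc 0) b \<mu> \<nu>) j
       = (\<Sum>\<kappa> | \<mu> \<succ> \<kappa>. if wt \<kappa> + j = wt \<mu> + wt \<nu> then chain_count b \<nu> \<kappa> else 0)"
  unfolding down_fps_nth sum_shapes_of_interlaced[OF assms]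
  by (cases "j \<le> wt \<mu> + wt \<nu>") (auto intro!: sum.cong sum.neutral[symmetric])

text \<open>\<open>card_interlacing_both\<close> bounds the weight of the lower shape only on one
  side. Coefficient m of the upper series is therefore the partial sum up to m of the lower one,
  which is multiplication by the geometric series.\<close>

lemma skew_cauchy_1_1:
  assumes sh: "\<mu> \<in> shapes" "\<nu> \<in> shapes"
  shows "up_fps (Suc 0) (Suc 0) \<mu> \<nu> = inverse (1 - fps_X) * down_fps (Suc 0) (Suc 0) \<mu> \<nu>"
proof (rule fps_ext)
  fix m
  let ?D = "{\<kappa>. \<mu> \<succ> \<kappa>}"
  have fin: "finite ?D" using finite_interlaced sh by blast
  have "fps_nth (up_fps (Suc 0) (Suc 0) \<mu> \<nu>) m
      = (\<Sum>r\<in>shapes_of m. of_bool (r \<succ> \<mu> \<and> r \<succ> \<nu>))"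
    unfolding up_fps_def fps_nth_Abs_fps
  proof (rule sum.cong)
    fix r assume "r \<in> shapes_of m"
    then have "r \<in> shapes" by (simp add: shapes_of_def)
    then show "chain_count (Suc 0) r \<mu> * chain_count (Suc 0) r \<nu> = of_bool (r \<succ> \<mu> \<and> r \<succ> \<nu>)"
      by (simp only: chain_count_1) simp
  qed simp
  also have "\<dots> = of_nat (card {r \<in> shapes_of m. r \<succ> \<mu> \<and> r \<succ> \<nu>})"
    by (simp add: of_bool_def sum.inter_filter[OF finite_shapes_of, symmetric])
  also have "\<dots> = of_nat (card {\<kappa> \<in> ?D. \<nu> \<succ> \<kappa> \<and> wt \<mu> + wt \<nu> \<le> wt \<kappa> + m})"
    using card_interlacing_both[OF sh, of m] by simp
  also have "\<dots> = (\<Sum>\<kappa>\<in>?D. of_bool (\<nu> \<succ> \<kappa> \<and> wt \<mu> + wt \<nu> \<le> wt \<kappa> + m))"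
    using fin by (simp add: of_bool_def sum.inter_filter[symmetric])
  also have "\<dots> = (\<Sum>\<kappa>\<in>?D. \<Sum>j\<le>m. if wt \<kappa> + j = wt \<mu> + wt \<nu> then chain_count (Suc 0) \<nu> \<kappa> else 0)"
  proof (rule sum.cong)
    fix \<kappa> assume "\<kappa> \<in> ?D"
    then have le: "wt \<kappa> \<le> wt \<mu>" using interlaces_wt sh by auto
    then have "(wt \<kappa> + j = wt \<mu> + wt \<nu>) = (j = wt \<mu> + wt \<nu> - wt \<kappa>)" for j by auto
    then have "(\<Sum>j\<le>m. if wt \<kappa> + j = wt \<mu> + wt \<nu> then chain_count (Suc 0) \<nu> \<kappa> else 0)
        = (if wt \<mu> + wt \<nu> - wt \<kappa> \<le> m then chain_count (Suc 0) \<nu> \<kappa> else 0)"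
      by (simp add: sum.delta del: chain_count.simps)
    also have "\<dots> = of_bool (\<nu> \<succ> \<kappa> \<and> wt \<mu> + wt \<nu> \<le> wt \<kappa> + m)"
      unfolding chain_count_1[OF sh(2)] using le by (auto simp: of_bool_def)
    finally show "of_bool (\<nu> \<succ> \<kappa> \<and> wt \<mu> + wt \<nu> \<le> wt \<kappa> + m)
      = (\<Sum>j\<le>m. if wt \<kappa> + j = wt \<mu> + wt \<nu> then chain_count (Suc 0) \<nu> \<kappa> else 0)" ..
  qed simp
  also have "\<dots> = (\<Sum>j\<le>m. fps_nth (down_fps (Suc 0) (Suc 0) \<mu> \<nu>) j)"
    unfolding down_fps_1_nth[OF sh(1)] by (rule sum.swap)
  also have "\<dots> = fps_nth (down_fps (Suc 0) (Suc 0) \<mu> \<nu> * inverse (1 - fps_X)) m"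
    by (simp add: fps_mult_nth inverse_1_minus_X_nth atLeast0AtMost)
  finally show "fps_nth (up_fps (Suc 0) (Suc 0) \<mu> \<nu>) m
      = fps_nth (inverse (1 - fps_X) * down_fps (Suc 0) (Suc 0) \<mu> \<nu>) m"
    by (simp add: mult.commute)
qed

text \<open>Replacing \<open>\<mu>\<close> by \<open>\<kappa>\<close> changes the reference weight
  from which the exponent is measured; the power of x corrects this. Below that power the
  coefficients vanish because a shape heavier than \<open>\<kappa>\<close> cannot be reached from
  it.\<close>

lemma down_fps_Suc:
  assumes sh: "\<mu> \<in> shapes"
  shows "down_fps (Suc a) b \<mu> \<nu> = (\<Sum>\<kappa> | \<mu> \<succ> \<kappa>. fps_X ^ (wt \<mu> - wt \<kappa>) * down_fps a b \<kappa> \<nu>)"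
proof (rule fps_ext)
  fix j
  let ?S = "shapes_of (wt \<mu> + wt \<nu> - j)"
  have step: "fps_nth (fps_X ^ (wt \<mu> - wt \<kappa>) * down_fps a b \<kappa> \<nu>) j
      = (if j \<le> wt \<mu> + wt \<nu> then \<Sum>\<sigma>\<in>?S. chain_count a \<kappa> \<sigma> * chain_count b \<nu> \<sigma> else 0)"
    if "\<mu> \<succ> \<kappa>" for \<kappa>
  proof (cases "j < wt \<mu> - wt \<kappa>")
    case True
    have "chain_count a \<kappa> \<sigma> = 0" if "\<sigma> \<in> ?S" for \<sigma>
      using that True chain_count_wt[OF interlaces_shape[OF sh \<open>\<mu> \<succ> \<kappa>\<close>], of a \<sigma>]
      by (force simp: shapes_of_def)
    then show ?thesis using True by (simp add: fps_X_power_mult_nth)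
  next
    case False
    have le: "wt \<kappa> \<le> wt \<mu>" using interlaces_wt sh that by blast
    with False have "wt \<kappa> + wt \<nu> - (j - (wt \<mu> - wt \<kappa>)) = wt \<mu> + wt \<nu> - j"
        "j - (wt \<mu> - wt \<kappa>) \<le> wt \<kappa> + wt \<nu> \<longleftrightarrow> j \<le> wt \<mu> + wt \<nu>"
      by linarith+
    then show ?thesis
      using False by (simp add: fps_X_power_mult_nth down_fps_nth del: diff_diff_right)
  qed
  have "fps_nth (down_fps (Suc a) b \<mu> \<nu>) j
      = (if j \<le> wt \<mu> + wt \<nu> then \<Sum>\<kappa> | \<mu> \<succ> \<kappa>. \<Sum>\<sigma>\<in>?S. chain_count a \<kappa> \<sigma> * chain_count b \<nu> \<sigma> else 0)"
    unfolding down_fps_nth chain_count.simps sum_distrib_right by (subst sum.swap) simp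
  also have "\<dots> = (\<Sum>\<kappa> | \<mu> \<succ> \<kappa>. fps_nth (fps_X ^ (wt \<mu> - wt \<kappa>) * down_fps a b \<kappa> \<nu>) j)"
    by (simp add: step)
  finally show "fps_nth (down_fps (Suc a) b \<mu> \<nu>) j
      = fps_nth (\<Sum>\<kappa> | \<mu> \<succ> \<kappa>. fps_X ^ (wt \<mu> - wt \<kappa>) * down_fps a b \<kappa> \<nu>) j"
    by (simp add: fps_sum_nth)
qed

text \<open>Peel the first strip off the chain of length \<open>Suc a\<close>, move it past the b
  strips on the other side by \<open>G\<close>, and reassemble the remaining chains. The result has
  the same recursive shape as \<open>down_fps_Suc\<close>, up to the factor
  \<open>G\<close>.\<close>

lemma up_fps_Suc:
  assumes sh: "\<mu> \<in> shapes"
    and G: "\<And>\<nu>. \<nu> \<in> shapes \<Longrightarrow> up_fps (Suc 0) b \<mu> \<nu> = G * down_fps (Suc 0) b \<mu> \<nu>"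
  shows "up_fps (Suc a) b \<mu> \<nu> = G * (\<Sum>\<kappa> | \<mu> \<succ> \<kappa>. fps_X ^ (wt \<mu> - wt \<kappa>) * up_fps a b \<kappa> \<nu>)"
    (is "_ = G * ?H")
proof (rule fps_ext)
  fix m
  \<comment> \<open>Weight at most m is a large enough window: the shapes below an r of weight m lie
    in it, and so do all shapes contributing to a coefficient of index at most m.\<close>
  define R where "R = {\<rho> \<in> shapes. wt \<rho> \<le> m}"
  have "R = (\<Union>k\<le>m. shapes_of k)" by (auto simp: R_def shapes_of_def)
  then have finR: "finite R" by (simp add: finite_shapes_of)
  have H: "(\<Sum>\<rho>\<in>R. fps_nth (down_fps (Suc 0) b \<mu> \<rho>) j * chain_count a \<rho> \<nu>) = fps_nth ?H j"
    if "j \<le> m" for j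
  proof -
    have inner: "(\<Sum>\<rho>\<in>R. if wt \<kappa> + j = wt \<mu> + wt \<rho> then chain_count b \<rho> \<kappa> * chain_count a \<rho> \<nu> else 0)
        = fps_nth (fps_X ^ (wt \<mu> - wt \<kappa>) * up_fps a b \<kappa> \<nu>) j" if k: "\<mu> \<succ> \<kappa>" for \<kappa>
    proof -
      have le: "wt \<kappa> \<le> wt \<mu>" using interlaces_wt sh k by blast
      have "(\<Sum>\<rho>\<in>R. if wt \<kappa> + j = wt \<mu> + wt \<rho> then chain_count b \<rho> \<kappa> * chain_count a \<rho> \<nu> else 0)
          = (\<Sum>\<rho> | \<rho> \<in> R \<and> wt \<kappa> + j = wt \<mu> + wt \<rho>. chain_count b \<rho> \<kappa> * chain_count a \<rho> \<nu>)"
        by (rule sum.inter_filter[OF finR, symmetric])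
      also have "{\<rho>. \<rho> \<in> R \<and> wt \<kappa> + j = wt \<mu> + wt \<rho>}
          = (if j < wt \<mu> - wt \<kappa> then {} else shapes_of (j - (wt \<mu> - wt \<kappa>)))"
        using le \<open>j \<le> m\<close> by (auto simp: R_def shapes_of_def)
      finally show ?thesis by (simp add: fps_X_power_mult_nth up_fps_def)
    qed
    have "(\<Sum>\<rho>\<in>R. fps_nth (down_fps (Suc 0) b \<mu> \<rho>) j * chain_count a \<rho> \<nu>)
        = (\<Sum>\<rho>\<in>R. \<Sum>\<kappa> | \<mu> \<succ> \<kappa>. if wt \<kappa> + j = wt \<mu> + wt \<rho> then chain_count b \<rho> \<kappa> * chain_count a \<rho> \<nu> else 0)"
      unfolding down_fps_1_nth[OF sh] sum_distrib_right by (intro sum.cong) auto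
    also have "\<dots> = fps_nth ?H j"
      by (subst sum.swap) (simp add: inner fps_sum_nth)
    finally show ?thesis .
  qed
  have "fps_nth (up_fps (Suc a) b \<mu> \<nu>) m
      = (\<Sum>r\<in>shapes_of m. \<Sum>\<rho>\<in>R. chain_count (Suc 0) r \<rho> * chain_count b r \<mu> * chain_count a \<rho> \<nu>)"
    unfolding up_fps_def fps_nth_Abs_fps
  proof (rule sum.cong)
    fix r assume "r \<in> shapes_of m"
    then have r: "r \<in> shapes" "wt r = m" by (auto simp: shapes_of_def)
    have "(\<Sum>\<rho>\<in>R. chain_count (Suc 0) r \<rho> * chain_count b r \<mu> * chain_count a \<rho> \<nu>)
        = (\<Sum>\<rho>\<in>R. if r \<succ> \<rho> then chain_count b r \<mu> * chain_count a \<rho> \<nu> else 0)"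
      by (simp only: chain_count_1[OF r(1)]) (auto intro!: sum.cong)
    also have "\<dots> = (\<Sum>\<rho> | \<rho> \<in> R \<and> r \<succ> \<rho>. chain_count b r \<mu> * chain_count a \<rho> \<nu>)"
      by (rule sum.inter_filter[OF finR, symmetric])
    also have "{\<rho>. \<rho> \<in> R \<and> r \<succ> \<rho>} = {\<rho>. r \<succ> \<rho>}"
      using interlaces_shape[OF r(1)] interlaces_wt[OF r(1)] r(2) by (auto simp: R_def)
    finally show "chain_count b r \<mu> * chain_count (Suc a) r \<nu>
        = (\<Sum>\<rho>\<in>R. chain_count (Suc 0) r \<rho> * chain_count b r \<mu> * chain_count a \<rho> \<nu>)"
      by (simp add: sum_distrib_left)
  qed simp
  also have "\<dots> = (\<Sum>\<rho>\<in>R. fps_nth (up_fps (Suc 0) b \<mu> \<rho>) m * chain_count a \<rho> \<nu>)"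
    by (subst sum.swap) (simp add: up_fps_def sum_distrib_left sum_distrib_right mult_ac del: chain_count.simps)
  also have "\<dots> = (\<Sum>\<rho>\<in>R. (\<Sum>i\<le>m. fps_nth G i * fps_nth (down_fps (Suc 0) b \<mu> \<rho>) (m - i)) * chain_count a \<rho> \<nu>)"
    by (rule sum.cong) (simp_all add: G R_def fps_mult_nth atLeast0AtMost del: chain_count.simps)
  also have "\<dots> = (\<Sum>i\<le>m. fps_nth G i * (\<Sum>\<rho>\<in>R. fps_nth (down_fps (Suc 0) b \<mu> \<rho>) (m - i) * chain_count a \<rho> \<nu>))"
    unfolding sum_distrib_left sum_distrib_right by (subst sum.swap) (simp add: mult_ac)
  also have "\<dots> = (\<Sum>i\<le>m. fps_nth G i * fps_nth ?H (m - i))"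
    by (simp add: H)
  finally show "fps_nth (up_fps (Suc a) b \<mu> \<nu>) m = fps_nth (G * ?H) m"
    by (simp add: fps_mult_nth atLeast0AtMost)
qed

lemma skew_cauchy_power:
  assumes G: "\<And>\<mu> \<nu>. \<mu> \<in> shapes \<Longrightarrow> \<nu> \<in> shapes \<Longrightarrow> up_fps (Suc 0) b \<mu> \<nu> = G * down_fps (Suc 0) b \<mu> \<nu>"
    and sh: "\<mu> \<in> shapes" "\<nu> \<in> shapes"
  shows "up_fps a b \<mu> \<nu> = G ^ a * down_fps a b \<mu> \<nu>"
  using sh(1)
proof (induction a arbitrary: \<mu>)
  case 0
  then show ?case using sh(2) by (simp add: up_fps_0 down_fps_0)
next
  case (Suc a)
  have "up_fps (Suc a) b \<mu> \<nu> = G * (\<Sum>\<kappa> | \<mu> \<succ> \<kappa>. fps_X ^ (wt \<mu> - wt \<kappa>) * up_fps a b \<kappa> \<nu>)"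
    using Suc.prems G[OF Suc.prems] by (rule up_fps_Suc)
  also have "(\<Sum>\<kappa> | \<mu> \<succ> \<kappa>. fps_X ^ (wt \<mu> - wt \<kappa>) * up_fps a b \<kappa> \<nu>)
      = (\<Sum>\<kappa> | \<mu> \<succ> \<kappa>. G ^ a * (fps_X ^ (wt \<mu> - wt \<kappa>) * down_fps a b \<kappa> \<nu>))"
    using Suc.IH interlaces_shape[OF Suc.prems] by (intro sum.cong) (simp_all add: mult_ac)
  finally show ?case
    by (simp add: down_fps_Suc[OF Suc.prems] sum_distrib_left mult_ac)
qed

text \<open>\<open>skew_cauchy_power\<close> is applied twice: with one strip on the other side, and
  then, after exchanging the sides, with b strips and the factor of the first application.\<close>

lemma skew_cauchy:
  assumes "\<mu> \<in> shapes" "\<nu> \<in> shapes"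
  shows "up_fps a b \<mu> \<nu> = inverse (1 - fps_X) ^ (a * b) * down_fps a b \<mu> \<nu>"
proof -
  have "up_fps (Suc 0) b \<mu> \<nu> = inverse (1 - fps_X) ^ b * down_fps (Suc 0) b \<mu> \<nu>"
    if "\<mu> \<in> shapes" "\<nu> \<in> shapes" for \<mu> \<nu>
    using skew_cauchy_power[OF skew_cauchy_1_1 that(2,1), of b]
    by (simp only: up_fps_commute[of "Suc 0" b] down_fps_commute[of "Suc 0" b])
  from skew_cauchy_power[OF this assms, of a] show ?thesis
    by (simp add: power_mult[symmetric] mult.commute)
qed

section \<open>Traces\<close>

text \<open>The part of the trace of the matrix product in which the shape has size l on the outside
  and size m between the two groups of factors.\<close>

definition pair_count :: "nat \<Rightarrow> nat \<Rightarrow> nat \<Rightarrow> nat \<Rightarrow> rat" where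
  "pair_count a b l m = (\<Sum>r\<in>shapes_of l. \<Sum>\<mu>\<in>shapes_of m. chain_count a r \<mu> * chain_count b r \<mu>)"

lemma pair_count_0:
  assumes "l < m"
  shows "pair_count a b l m = 0"
  unfolding pair_count_def
proof (intro sum.neutral ballI)
  fix r \<mu> assume "r \<in> shapes_of l" "\<mu> \<in> shapes_of m"
  then have "chain_count a r \<mu> = 0"
    using chain_count_wt[of r a \<mu>] assms by (force simp: shapes_of_def)
  then show "chain_count a r \<mu> * chain_count b r \<mu> = 0" by simp
qed

lemma pair_count_same: "pair_count a b n n = of_nat (card (shapes_of n))"
proof -
  have "pair_count a b n n = (\<Sum>r\<in>shapes_of n. \<Sum>\<mu>\<in>shapes_of n. if r = \<mu> then 1 else 0)"
    unfolding pair_count_def by (intro sum.cong refl) (auto simp: shapes_of_def chain_count_same_wt)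
  then show ?thesis by (simp add: finite_shapes_of)
qed

definition above :: "nat \<Rightarrow> nat \<Rightarrow> nat \<Rightarrow> rat fps" where
  "above a b m = Abs_fps (\<lambda>d. pair_count a b (m + d) m)"

definition below :: "nat \<Rightarrow> nat \<Rightarrow> nat \<Rightarrow> rat fps" where
  "below a b m = Abs_fps (\<lambda>d. if d \<le> m then pair_count a b m (m - d) else 0)"

text \<open>The skew Cauchy identity on the diagonal \<open>\<nu>\<close> = \<open>\<mu>\<close>,
  summed over all \<open>\<mu>\<close> of size m. Both diagonal series start at degree m, so after
  cancelling x^m the degree is the size difference d.\<close>

lemma above_below: "above a b m = inverse (1 - fps_X) ^ (a * b) * below a b m"
proof -
  have "fps_X ^ m * above a b m = (\<Sum>\<mu>\<in>shapes_of m. up_fps a b \<mu> \<mu>)"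
  proof (rule fps_ext)
    fix j
    have "fps_nth (\<Sum>\<mu>\<in>shapes_of m. up_fps a b \<mu> \<mu>) j = pair_count a b j m"
      unfolding fps_sum_nth up_fps_def fps_nth_Abs_fps pair_count_def
      by (subst sum.swap) (simp add: mult.commute)
    then show "fps_nth (fps_X ^ m * above a b m) j = fps_nth (\<Sum>\<mu>\<in>shapes_of m. up_fps a b \<mu> \<mu>) j"
      using pair_count_0[of j m] by (simp add: fps_X_power_mult_nth above_def)
  qed
  also have "\<dots> = inverse (1 - fps_X) ^ (a * b) * (\<Sum>\<mu>\<in>shapes_of m. down_fps a b \<mu> \<mu>)"
    unfolding sum_distrib_left by (intro sum.cong) (auto simp: shapes_of_def intro: skew_cauchy)
  also have "(\<Sum>\<mu>\<in>shapes_of m. down_fps a b \<mu> \<mu>) = fps_X ^ m * below a b m"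
  proof (rule fps_ext)
    fix j
    have "fps_nth (\<Sum>\<mu>\<in>shapes_of m. down_fps a b \<mu> \<mu>) j
        = (\<Sum>\<mu>\<in>shapes_of m. if j \<le> m + m then
             \<Sum>\<kappa>\<in>shapes_of (m + m - j). chain_count a \<mu> \<kappa> * chain_count b \<mu> \<kappa> else 0)"
      unfolding fps_sum_nth by (intro sum.cong refl) (auto simp: shapes_of_def down_fps_nth)
    also have "\<dots> = (if j \<le> m + m then pair_count a b m (m + m - j) else 0)"
      by (simp add: pair_count_def)
    finally show "fps_nth (\<Sum>\<mu>\<in>shapes_of m. down_fps a b \<mu> \<mu>) j = fps_nth (fps_X ^ m * below a b m) j"
      using pair_count_0[of m "m + m - j"] by (auto simp: fps_X_power_mult_nth below_def)
  qed
  finally have "fps_X ^ m * above a b m = fps_X ^ m * (inverse (1 - fps_X) ^ (a * b) * below a b m)"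
    by (simp add: mult_ac)
  then show ?thesis by simp
qed

text \<open>
  This is the trace of \<open>x\<^sup>L \<Gamma>\<^sub>-(1)\<^sup>a \<Gamma>\<^sub>+(x\<^sup>k)\<^sup>b\<close>. Moving the last factor around the trace
  replaces \<open>k\<close> by \<open>k + 1\<close>, at the cost of the scalar from the skew Cauchy identity; for
  large \<open>k\<close> only the identity part of \<open>\<Gamma>\<^sub>+\<close> survives.
\<close>

definition twisted_trace :: "nat \<Rightarrow> nat \<Rightarrow> nat \<Rightarrow> rat fps" where
  "twisted_trace a b k = Abs_fps (\<lambda>n. \<Sum>l\<le>n. \<Sum>m\<le>l. if l + k * (l - m) = n then pair_count a b l m else 0)"

lemma fps_nth_compose_X_power_sum:
  assumes "q > 0"
  shows "fps_nth (f oo fps_X ^ q :: 'a :: field fps) n = (\<Sum>d\<le>n. if q * d = n then fps_nth f d else 0)"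
proof (cases "q dvd n")
  case True
  then obtain c where c: "n = q * c" by auto
  then have eq: "(q * d = n) = (d = c)" for d using assms by auto
  have "c \<le> n" using assms c by simp
  then have "(\<Sum>d\<le>n. if q * d = n then fps_nth f d else 0) = fps_nth f c"
    unfolding eq by simp
  then show ?thesis using assms c by (simp add: fps_nth_compose_X_power)
next
  case False
  then have "q * d \<noteq> n" for d by auto
  with False show ?thesis by (simp add: fps_nth_compose_X_power)
qed

text \<open>Since l + k(l - m) = m + (k+1)(l - m), grouping by the inner size m turns the twist k
  into the substitution of x^(k+1).\<close>

lemma twisted_trace_above:
  "fps_nth (twisted_trace a b k) n = (\<Sum>m\<le>n. fps_nth (above a b m oo fps_X ^ Suc k) (n - m))"
proof -
  have "fps_nth (twisted_trace a b k) n
      = (\<Sum>(l, m)\<in>(SIGMA l:{..n}. {..l}). if l + k * (l - m) = n then pair_count a b l m else 0)"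
    unfolding twisted_trace_def fps_nth_Abs_fps by (rule sum.Sigma) auto
  also have "\<dots> = (\<Sum>(m, d)\<in>(SIGMA m:{..n}. {..n - m}). if Suc k * d = n - m then pair_count a b (m + d) m else 0)"
    by (rule sum.reindex_bij_witness[where i = "\<lambda>(m, d). (m + d, m)" and j = "\<lambda>(l, m). (m, l - m)"])
       (auto simp: le_diff_conv2)
  also have "\<dots> = (\<Sum>m\<le>n. \<Sum>d\<le>n - m. if Suc k * d = n - m then pair_count a b (m + d) m else 0)"
    by (rule sum.Sigma[symmetric]) auto
  finally show ?thesis
    by (simp only: fps_nth_compose_X_power_sum[OF zero_less_Suc] above_def fps_nth_Abs_fps)
qed

text \<open>Grouping by the outer size l instead, the twist k + 1 leads to the same substitution of
  x^(k+1). \<open>above_below\<close> can then convert one trace into the other.\<close>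

lemma twisted_trace_below:
  "fps_nth (twisted_trace a b (Suc k)) n = (\<Sum>l\<le>n. fps_nth (below a b l oo fps_X ^ Suc k) (n - l))"
  unfolding twisted_trace_def fps_nth_Abs_fps
proof (rule sum.cong)
  fix l assume "l \<in> {..n}"
  then have l: "l \<le> n" by simp
  have "(\<Sum>m\<le>l. if l + Suc k * (l - m) = n then pair_count a b l m else 0)
      = (\<Sum>d\<le>l. if l + Suc k * d = n then pair_count a b l (l - d) else 0)"
    by (rule sum.reindex_bij_witness[where i = "\<lambda>d. l - d" and j = "\<lambda>m. l - m"]) auto
  also have "\<dots> = (\<Sum>d\<le>n. if Suc k * d = n - l then if d \<le> l then pair_count a b l (l - d) else 0 else 0)"
    using l by (intro sum.mono_neutral_cong_left) auto
  also have "\<dots> = (\<Sum>d\<le>n - l. if Suc k * d = n - l then if d \<le> l then pair_count a b l (l - d) else 0 else 0)"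
    by (intro sum.mono_neutral_right) auto
  finally show "(\<Sum>m\<le>l. if l + Suc k * (l - m) = n then pair_count a b l m else 0)
      = fps_nth (below a b l oo fps_X ^ Suc k) (n - l)"
    by (simp only: fps_nth_compose_X_power_sum[OF zero_less_Suc] below_def fps_nth_Abs_fps)
qed simp

lemma sum_triangle_swap:
  "(\<Sum>m\<le>n. \<Sum>i\<le>n - m. F m i) = (\<Sum>i\<le>n. \<Sum>m\<le>n - i. F m i)" for n :: nat
proof -
  have "(\<Sum>m\<le>n. \<Sum>i\<le>n - m. F m i) = (\<Sum>(m, i)\<in>(SIGMA m:{..n}. {..n - m}). F m i)"
    by (rule sum.Sigma) auto
  also have "\<dots> = (\<Sum>(i, m)\<in>(SIGMA i:{..n}. {..n - i}). F m i)"
    by (rule sum.reindex_bij_witness[where i = "\<lambda>(m, d). (d, m)" and j = "\<lambda>(m, d). (d, m)"]) auto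
  also have "\<dots> = (\<Sum>i\<le>n. \<Sum>m\<le>n - i. F m i)"
    by (rule sum.Sigma[symmetric]) auto
  finally show ?thesis .
qed

lemma twisted_trace_Suc:
  "twisted_trace a b k = (inverse (1 - fps_X) oo fps_X ^ Suc k) ^ (a * b) * twisted_trace a b (Suc k)"
proof (rule fps_ext)
  fix n
  let ?G = "(inverse (1 - fps_X) oo fps_X ^ Suc k) ^ (a * b) :: rat fps"
  let ?H = "\<lambda>m. below a b m oo fps_X ^ Suc k"
  have z: "fps_nth (fps_X ^ Suc k :: rat fps) 0 = 0" by simp
  have "above a b m oo fps_X ^ Suc k = ?G * ?H m" for m
    by (simp only: above_below fps_compose_mult_distrib[OF z] fps_compose_power[OF z])
  then have "fps_nth (twisted_trace a b k) n
      = (\<Sum>m\<le>n. \<Sum>i\<le>n - m. fps_nth ?G i * fps_nth (?H m) (n - m - i))"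
    by (simp only: twisted_trace_above fps_mult_nth atLeast0AtMost)
  also have "\<dots> = (\<Sum>i\<le>n. \<Sum>m\<le>n - i. fps_nth ?G i * fps_nth (?H m) (n - m - i))"
    by (rule sum_triangle_swap)
  also have "\<dots> = fps_nth (?G * twisted_trace a b (Suc k)) n"
    by (simp only: fps_mult_nth twisted_trace_below sum_distrib_left atLeast0AtMost diff_right_commute)
       (simp only: diff_diff_left add.commute)
  finally show "fps_nth (twisted_trace a b k) n = fps_nth (?G * twisted_trace a b (Suc k)) n" .
qed

lemma twisted_trace_prod:
  "twisted_trace a b 0 = (\<Prod>k<M. inverse (1 - fps_X) oo fps_X ^ Suc k) ^ (a * b) * twisted_trace a b M"
proof (induction M)
  case (Suc M)
  then show ?case
    by (simp only: twisted_trace_Suc[of a b M] prod.lessThan_Suc power_mult_distrib mult.assoc)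
qed simp

lemma twisted_trace_0_nth: "fps_nth (twisted_trace a b 0) n = (\<Sum>m\<le>n. pair_count a b n m)"
proof -
  have "fps_nth (twisted_trace a b 0) n = (\<Sum>l\<le>n. if l = n then \<Sum>m\<le>l. pair_count a b l m else 0)"
    unfolding twisted_trace_def fps_nth_Abs_fps by (intro sum.cong) auto
  then show ?thesis by simp
qed

text \<open>Any size difference costs at least k > n in degree, so only l = m = n remains. This
  replaces a limit of infinitely many cyclic moves by finitely many for each coefficient.\<close>

lemma twisted_trace_large_nth:
  assumes "n < k"
  shows "fps_nth (twisted_trace a b k) n = of_nat (card (shapes_of n))"
proof -
  have eq: "l + k * (l - m) = n \<longleftrightarrow> m = l \<and> l = n" if "m \<le> l" for l m
  proof (cases "m = l")
    case False
    then have "k * 1 \<le> k * (l - m)" using that by (intro mult_le_mono2) simp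
    then have "n < l + k * (l - m)" using assms by linarith
    with False show ?thesis by simp
  qed simp
  have "fps_nth (twisted_trace a b k) n = (\<Sum>l\<le>n. \<Sum>m\<le>l. if m = l then if l = n then pair_count a b n n else 0 else 0)"
    unfolding twisted_trace_def fps_nth_Abs_fps by (intro sum.cong refl) (auto simp: eq)
  then show ?thesis by (simp add: pair_count_same)
qed

section \<open>The trace in exponential form\<close>

text \<open>Every solution of the linear differential equation, multiplied by exp(-f), has
  derivative zero and hence is the constant 1.\<close>

lemma fps_exp_compose_unique:
  fixes y f :: "'a :: field_char_0 fps"
  assumes "fps_deriv y = fps_deriv f * y" "fps_nth y 0 = 1" "fps_nth f 0 = 0"
  shows "y = fps_exp 1 oo f"
proof -
  define z where "z = fps_exp (- 1) oo f"
  have dz: "fps_deriv z = - (fps_deriv f * z)"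
    using assms(3) by (simp add: z_def fps_compose_deriv fps_compose_uminus flip: fps_const_neg)
  have one: "w * z = 1" if "fps_deriv w = fps_deriv f * w" "fps_nth w 0 = 1" for w
  proof -
    have "fps_deriv (w * z) = w * fps_deriv z + fps_deriv w * z" by (rule fps_deriv_mult)
    also have "\<dots> = 0" unfolding dz that(1) by (simp add: algebra_simps)
    finally have "fps_deriv (w * z) = 0" .
    then have "w * z = fps_const (fps_nth (w * z) 0)" by (rule fps_deriv_eq_0_iff[THEN iffD1])
    also have "fps_nth (w * z) 0 = 1" using that by (simp add: z_def)
    finally show ?thesis by simp
  qed
  have "fps_deriv (fps_exp 1 oo f) = fps_deriv f * (fps_exp 1 oo f)"
    using assms(3) by (simp add: fps_compose_deriv mult.commute)
  then have "(fps_exp 1 oo f) * z = 1" by (rule one) simp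
  moreover have "y * z = 1" using assms(1,2) by (rule one)
  moreover from this have "z \<noteq> 0" by auto
  ultimately show ?thesis using mult_right_cancel[of z y "fps_exp 1 oo f"] by simp
qed

lemma fps_exp_compose_add:
  fixes f g :: "'a :: field_char_0 fps"
  assumes "fps_nth f 0 = 0" "fps_nth g 0 = 0"
  shows "fps_exp 1 oo (f + g) = (fps_exp 1 oo f) * (fps_exp 1 oo g)"
  by (rule fps_exp_compose_unique[symmetric])
     (use assms in \<open>simp_all add: fps_compose_deriv algebra_simps\<close>)

text \<open>The series of -log(1 - x); its constant coefficient comes out right because 1/0 =
  0.\<close>

definition neg_log :: "rat fps" where
  "neg_log = Abs_fps (\<lambda>n. 1 / of_nat n)"

lemma exp_neg_log: "fps_exp 1 oo neg_log = inverse (1 - fps_X)"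
proof (rule fps_exp_compose_unique[symmetric])
  have "fps_deriv neg_log = inverse (1 - fps_X)"
    by (rule fps_ext) (simp add: neg_log_def inverse_1_minus_X_nth fps_deriv_nth del: of_nat_Suc)
  then show "fps_deriv (inverse (1 - fps_X)) = fps_deriv neg_log * inverse (1 - fps_X)"
    by (simp add: fps_inverse_deriv power2_eq_square)
qed (simp_all add: neg_log_def)

text \<open>The Lambert series sum over k >= 1 of c(k) x^k / (1 - x^k), expanded into divisor
  sums.\<close>

definition divisor_fps :: "(nat \<Rightarrow> rat) \<Rightarrow> rat fps" where
  "divisor_fps c = Abs_fps (\<lambda>n. \<Sum>k<n. if Suc k dvd n then c (Suc k) else 0)"

text \<open>Expanding the logarithms weights a divisor k of n by 1/(n/k). Exchanging complementary
  divisors turns this into 1/k, the Lambert form of the theorem.\<close>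

lemma neg_log_sum_nth:
  assumes "n \<le> M"
  shows "fps_nth (\<Sum>k<M. neg_log oo fps_X ^ Suc k) n = fps_nth (divisor_fps (\<lambda>k. 1 / of_nat k)) n"
proof (cases "n = 0")
  case True
  then show ?thesis by (simp add: fps_sum_nth divisor_fps_def neg_log_def)
next
  case False
  have "fps_nth (\<Sum>k<M. neg_log oo fps_X ^ Suc k) n
      = (\<Sum>k<M. if Suc k dvd n then 1 / of_nat (n div Suc k) else 0)"
    by (simp only: fps_sum_nth fps_nth_compose_X_power neg_log_def fps_nth_Abs_fps)
  also have "\<dots> = (\<Sum>k<n. if Suc k dvd n then 1 / of_nat (n div Suc k) else 0)"
    using assms False by (intro sum.mono_neutral_right) (auto dest: dvd_imp_le)
  also have "\<dots> = (\<Sum>k | k < n \<and> Suc k dvd n. 1 / of_nat (n div Suc k))"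
    using sum.inter_filter[of "{..<n}" "\<lambda>k. 1 / of_nat (n div Suc k) :: rat" "\<lambda>k. Suc k dvd n"] by simp
  also have "\<dots> = (\<Sum>k | k < n \<and> Suc k dvd n. 1 / of_nat (Suc k))"
  proof -
    \<comment> \<open>The index k stands for the divisor k + 1, so the complementary divisor sits at
      index n/(k+1) - 1.\<close>
    let ?g = "\<lambda>k. n div Suc k - 1" and ?K = "{k. k < n \<and> Suc k dvd n}"
    have inv: "?g (?g k) = k \<and> ?g k \<in> ?K \<and> Suc (?g k) = n div Suc k" if "k \<in> ?K" for k
    proof -
      have "Suc k dvd n" using that by simp
      then obtain c where c: "n = Suc k * c" by (rule dvdE)
      then obtain d where d: "c = Suc d" using False by (cases c) auto
      have div: "n div Suc k = Suc d" using c d by (metis nonzero_mult_div_cancel_left nat.distinct(1))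
      have div': "n div Suc d = Suc k" using c d by (metis nonzero_mult_div_cancel_right nat.distinct(1))
      have "d < n" using c d by simp
      moreover have "Suc d dvd n" using c d dvd_triv_right by metis
      ultimately show ?thesis by (simp add: div div')
    qed
    show "(\<Sum>k | k < n \<and> Suc k dvd n. 1 / rat_of_nat (n div Suc k)) = (\<Sum>k | k < n \<and> Suc k dvd n. 1 / rat_of_nat (Suc k))"
    proof (rule sum.reindex_bij_witness[where i = ?g and j = ?g])
      fix k assume k: "k \<in> ?K"
      show "?g (?g k) = k" "?g k \<in> ?K" "?g (?g k) = k" "?g k \<in> ?K" using inv[OF k] by blast+
      show "1 / rat_of_nat (Suc (?g k)) = 1 / rat_of_nat (n div Suc k)" using inv[OF k] by metis
    qed
  qed
  also have "\<dots> = fps_nth (divisor_fps (\<lambda>k. 1 / of_nat k)) n"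
    unfolding divisor_fps_def
    using sum.inter_filter[of "{..<n}" "\<lambda>k. 1 / of_nat (Suc k) :: rat" "\<lambda>k. Suc k dvd n"] by simp
  finally show ?thesis .
qed

text \<open>Allows finite partial sums of logarithms to be replaced by the full Lambert series, one
  coefficient at a time.\<close>

lemma fps_compose_cong_upto:
  assumes "\<And>i. i \<le> n \<Longrightarrow> fps_nth f i = fps_nth g i"
  shows "fps_nth (h oo f) n = fps_nth (h oo g) n"
proof -
  have "fps_nth (f ^ k) i = fps_nth (g ^ k) i" if "i \<le> n" for i k
    using that
  proof (induction k arbitrary: i)
    case (Suc k)
    then show ?case using assms by (simp add: fps_mult_nth)
  qed simp
  then show ?thesis by (simp add: fps_compose_nth)
qed

definition shape_fps :: "rat fps" where
  "shape_fps = Abs_fps (\<lambda>n. of_nat (card (shapes_of n)))"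

lemma prod_geometric_exp:
  "(\<Prod>k<M. inverse (1 - fps_X) oo fps_X ^ Suc k) = fps_exp 1 oo (\<Sum>k<M. neg_log oo fps_X ^ Suc k)"
proof (induction M)
  case (Suc M)
  have z: "fps_nth (neg_log oo fps_X ^ Suc k) 0 = 0" for k by (simp add: neg_log_def)
  have "inverse (1 - fps_X) oo fps_X ^ Suc M = fps_exp 1 oo (neg_log oo fps_X ^ Suc M)"
    unfolding exp_neg_log[symmetric] by (rule fps_compose_assoc[symmetric]) (simp_all add: neg_log_def)
  then show ?case
    using Suc z by (simp add: fps_exp_compose_add fps_sum_nth del: power_Suc)
qed simp

text \<open>n + 1 cyclic moves leave a trace that agrees with \<open>shape_fps\<close> up to degree
  n and collect a product equal to the exponential of ab times a logarithm. Written this way, each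
  coefficient on the right is polynomial in ab.\<close>

theorem pair_count_sum:
  "(\<Sum>m\<le>n. pair_count a b n m)
   = fps_nth (shape_fps * (fps_exp (of_nat (a * b)) oo divisor_fps (\<lambda>k. 1 / of_nat k))) n"
proof -
  let ?M = "Suc n"
  let ?l = "\<Sum>k<?M. neg_log oo fps_X ^ Suc k"
  have z: "fps_nth (neg_log oo fps_X ^ Suc k) 0 = 0" for k by (simp add: neg_log_def)
  have "(\<Prod>k<?M. inverse (1 - fps_X) oo fps_X ^ Suc k) ^ (a * b) = fps_exp (of_nat (a * b)) oo ?l"
    unfolding prod_geometric_exp by (subst fps_compose_power) (use z in \<open>simp_all add: fps_sum_nth fps_exp_power_mult del: power_Suc\<close>)
  then have "(\<Sum>m\<le>n. pair_count a b n m) = fps_nth ((fps_exp (of_nat (a * b)) oo ?l) * twisted_trace a b ?M) n"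
    by (simp only: twisted_trace_0_nth[symmetric] twisted_trace_prod[of a b ?M])
  also have "\<dots> = fps_nth ((fps_exp (of_nat (a * b)) oo divisor_fps (\<lambda>k. 1 / of_nat k)) * shape_fps) n"
    unfolding fps_mult_nth
  proof (rule sum.cong)
    fix i assume "i \<in> {0..n}"
    then have "fps_nth (fps_exp (of_nat (a * b)) oo ?l) i
        = fps_nth (fps_exp (of_nat (a * b)) oo divisor_fps (\<lambda>k. 1 / of_nat k)) i"
      by (intro fps_compose_cong_upto neg_log_sum_nth) auto
    moreover have "fps_nth (twisted_trace a b ?M) (n - i) = fps_nth shape_fps (n - i)"
      by (simp add: twisted_trace_large_nth shape_fps_def)
    ultimately show "fps_nth (fps_exp (of_nat (a * b)) oo ?l) i * fps_nth (twisted_trace a b ?M) (n - i)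
        = fps_nth (fps_exp (of_nat (a * b)) oo divisor_fps (\<lambda>k. 1 / of_nat k)) i * fps_nth shape_fps (n - i)"
      by (simp only:)
  qed simp
  finally show ?thesis by (simp add: mult.commute)
qed

section \<open>The Cauchy--Binet formula\<close>

lemma permutes_less: "p permutes {0..<n} \<Longrightarrow> i < n \<Longrightarrow> p i < n" for n :: nat
  using permutes_in_image[of p "{0..<n}" i] by simp

abbreviation fdet :: "nat \<Rightarrow> (nat \<Rightarrow> nat \<Rightarrow> 'a :: comm_ring_1) \<Rightarrow> 'a" where
  "fdet n f \<equiv> det (mat n n (\<lambda>(i, j). f i j))"

lemma fdet_expand: "fdet n f = (\<Sum>p | p permutes {0..<n}. signof p * (\<Prod>i = 0..<n. f i (p i)))"
proof -
  have "fdet n f = (\<Sum>p | p permutes {0..<n}. signof p * (\<Prod>i = 0..<n. mat n n (\<lambda>(i, j). f i j) $$ (i, p i)))"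
    by (rule det_def') simp
  also have "\<dots> = (\<Sum>p | p permutes {0..<n}. signof p * (\<Prod>i = 0..<n. f i (p i)))"
    by (intro sum.cong refl arg_cong2[where f = "(*)"] prod.cong) (auto simp: permutes_less)
  finally show ?thesis .
qed

lemma fdet_cong:
  assumes "\<And>i j. i < n \<Longrightarrow> j < n \<Longrightarrow> f i j = g i j"
  shows "fdet n f = fdet n g"
  by (rule arg_cong[where f = det]) (use assms in \<open>auto intro!: eq_matI\<close>)

lemma fdet_transpose: "fdet n (\<lambda>i j. f j i) = fdet n f"
proof -
  have "mat n n (\<lambda>(i, j). f j i) = transpose_mat (mat n n (\<lambda>(i, j). f i j))" by auto
  then show ?thesis using det_transpose[of "mat n n (\<lambda>(i, j). f i j)" n] by simp
qed

lemma fdet_permute_rows: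
  assumes "p permutes {0..<n}"
  shows "fdet n (\<lambda>i. f (p i)) = signof p * fdet n f"
proof -
  have "fdet n (\<lambda>i. f (p i)) = det (mat n n (\<lambda>(i, j). mat n n (\<lambda>(i, j). f i j) $$ (p i, j)))"
    by (rule fdet_cong) (use permutes_less[OF assms] in auto)
  then show ?thesis using det_permute_rows[OF _ assms, of "mat n n (\<lambda>(i, j). f i j)"] by simp
qed

lemma fdet_equal_rows:
  assumes "i \<noteq> j" "i < n" "j < n" "\<And>k. k < n \<Longrightarrow> f i k = f j k"
  shows "fdet n f = 0"
  by (rule det_identical_rows[OF _ assms(1-3)]) (use assms in \<open>auto simp: row_def\<close>)

lemma fdet_zero_row:
  assumes "i < n" "\<And>k. k < n \<Longrightarrow> f i k = 0"
  shows "fdet n f = 0"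
  unfolding fdet_expand
proof (rule sum.neutral, rule ballI)
  fix p assume "p \<in> {p. p permutes {0..<n}}"
  then have "f i (p i) = 0" using assms by (auto simp: permutes_less)
  then have "(\<Prod>i = 0..<n. f i (p i)) = 0" using assms(1) by (intro prod_zero) auto
  then show "signof p * (\<Prod>i = 0..<n. f i (p i)) = 0" by simp
qed

lemma fdet_upper_triangular:
  assumes "\<And>i j. j < i \<Longrightarrow> i < n \<Longrightarrow> f i j = 0"
  shows "fdet n f = (\<Prod>i<n. f i i)"
proof -
  have "upper_triangular (mat n n (\<lambda>(i, j). f i j))"
    using assms by (auto simp: upper_triangular_def)
  then have "fdet n f = prod_list (diag_mat (mat n n (\<lambda>(i, j). f i j)))"
    by (rule det_upper_triangular[OF _ mat_carrier])
  also have "diag_mat (mat n n (\<lambda>(i, j). f i j)) = map (\<lambda>i. f i i) [0..<n]"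
    by (auto simp: diag_mat_def)
  also have "prod_list \<dots> = (\<Prod>i\<in>{0..<n}. f i i)"
    using prod.distinct_set_conv_list[of "[0..<n]" "\<lambda>i. f i i"] by simp
  finally show ?thesis by (simp add: atLeast0LessThan)
qed

text \<open>Column sets are listed from the largest element down, in the order in which beta numbers
  are indexed.\<close>

definition desc :: "nat set \<Rightarrow> nat \<Rightarrow> nat" where
  "desc T i = rev (sorted_list_of_set T) ! i"

lemma desc_less:
  assumes "card T = N" "i < j" "j < N"
  shows "desc T j < desc T i"
proof -
  have "sorted_wrt (<) (sorted_list_of_set T)" by (rule strict_sorted_list_of_set)
  then show ?thesis
    using assms by (simp add: desc_def rev_nth sorted_wrt_iff_nth_less)
qed

lemma bij_betw_desc:
  assumes "finite T" "card T = N"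
  shows "bij_betw (desc T) {0..<N} T"
proof -
  have "bij_betw ((!) (rev (sorted_list_of_set T))) {..<N} (set (rev (sorted_list_of_set T)))"
    by (rule bij_betw_nth) (use assms in auto)
  then show ?thesis using assms by (simp add: desc_def[abs_def] atLeast0LessThan)
qed

lemma desc_image:
  assumes dec: "\<And>i j. i < j \<Longrightarrow> j < N \<Longrightarrow> s j < s i" and "i < N"
  shows "desc (s ` {0..<N}) i = s i"
proof -
  have "sorted_wrt (<) (rev (map s [0..<N]))"
    using dec by (auto simp: sorted_wrt_iff_nth_less rev_nth)
  moreover have "set (rev (map s [0..<N])) = s ` {0..<N}" by simp
  ultimately have "sorted_list_of_set (s ` {0..<N}) = rev (map s [0..<N])"
    by (metis sorted_list_of_set.idem_if_sorted_distinct strict_sorted_iff)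
  then show ?thesis using assms(2) by (simp add: desc_def)
qed

text \<open>Expanding the product picks a column f(i) for each row. Repeated columns give equal rows
  in the second determinant and vanish; an injective f is the listing of its image T after a
  permutation q, and the sign of q passes from the determinant of \<open>B\<close> into the
  expansion of the one of \<open>A\<close>.\<close>

theorem cauchy_binet:
  fixes A B :: "nat \<Rightarrow> nat \<Rightarrow> 'a :: comm_ring_1"
  shows "fdet N (\<lambda>i j. \<Sum>k<M. A i k * B k j)
       = (\<Sum>T | T \<subseteq> {..<M} \<and> card T = N. fdet N (\<lambda>i j. A i (desc T j)) * fdet N (\<lambda>i j. B (desc T i) j))"
proof -
  let ?P = "{p. p permutes {0..<N}}"
  let ?F = "{0..<N} \<rightarrow>\<^sub>E {..<M}"
  let ?T = "{T. T \<subseteq> {..<M} \<and> card T = N}"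
  let ?h = "\<lambda>f. (\<Prod>i = 0..<N. A i (f i)) * fdet N (\<lambda>i. B (f i))"
  have finT: "finite T" if "T \<in> ?T" for T using that finite_subset by blast
  have "fdet N (\<lambda>i j. \<Sum>k<M. A i k * B k j)
      = (\<Sum>p\<in>?P. signof p * (\<Sum>f\<in>?F. \<Prod>i = 0..<N. A i (f i) * B (f i) (p i)))"
    unfolding fdet_expand by (subst prod_sum_PiE) auto
  also have "\<dots> = (\<Sum>f\<in>?F. ?h f)"
    unfolding fdet_expand sum_distrib_left
    by (subst sum.swap) (simp add: prod.distrib mult_ac)
  also have "\<dots> = (\<Sum>f | f \<in> ?F \<and> inj_on f {0..<N}. ?h f)"
  proof (rule sum.mono_neutral_right)
    show "\<forall>f\<in>?F - {f \<in> ?F. inj_on f {0..<N}}. ?h f = 0"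
    proof
      fix f assume "f \<in> ?F - {f \<in> ?F. inj_on f {0..<N}}"
      then obtain i j where "i < N" "j < N" "i \<noteq> j" "f i = f j" by (auto simp: inj_on_def)
      then have "fdet N (\<lambda>i. B (f i)) = 0" by (intro fdet_equal_rows[of i j]) auto
      then show "?h f = 0" by simp
    qed
  qed (auto intro: finite_PiE)
  \<comment> \<open>The permutation is recovered as the inverse listing of the image applied to f,
    continued by the identity outside \<open>{0..<N}\<close> as \<open>permutes\<close>
    demands.\<close>
  also have "\<dots> = (\<Sum>(T, q)\<in>?T \<times> ?P. ?h (restrict (desc T \<circ> q) {0..<N}))"
  proof (rule sym, rule sum.reindex_bij_witness[where
        i = "\<lambda>f. (f ` {0..<N}, \<lambda>i. if i \<in> {0..<N} then inv_into {0..<N} (desc (f ` {0..<N})) (f i) else i)" and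
        j = "\<lambda>(T, q). restrict (desc T \<circ> q) {0..<N}"])
    fix x assume x: "x \<in> ?T \<times> ?P"
    obtain T q where Tq: "x = (T, q)" "T \<in> ?T" "q permutes {0..<N}" using x by auto
    have bij: "bij_betw (desc T) {0..<N} T" using bij_betw_desc finT Tq by blast
    have bq: "bij_betw q {0..<N} {0..<N}" using Tq(3) by (rule permutes_imp_bij)
    have bT: "bij_betw (desc T \<circ> q) {0..<N} T" using bij_betw_trans[OF bq bij] .
    have im: "restrict (desc T \<circ> q) {0..<N} ` {0..<N} = T"
    proof -
      have "restrict (desc T \<circ> q) {0..<N} ` {0..<N} = (desc T \<circ> q) ` {0..<N}"
        by (rule image_cong) auto
      then show ?thesis using bij_betw_imp_surj_on[OF bT] by (simp only:)
    qed
    have "(if i \<in> {0..<N} then inv_into {0..<N} (desc T) (restrict (desc T \<circ> q) {0..<N} i) else i) = q i" for i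
    proof (cases "i \<in> {0..<N}")
      case True
      then have "q i \<in> {0..<N}" by (simp only: permutes_in_image[OF Tq(3)])
      then have "inv_into {0..<N} (desc T) (desc T (q i)) = q i"
        by (rule inv_into_f_f[OF bij_betw_imp_inj_on[OF bij]])
      then show ?thesis using True by (simp only: restrict_apply comp_apply if_True)
    next
      case False
      then show ?thesis using permutes_not_in[OF Tq(3) False] by (simp only: if_False)
    qed
    then have "(\<lambda>i. if i \<in> {0..<N} then inv_into {0..<N} (desc T) (restrict (desc T \<circ> q) {0..<N} i) else i) = q"
      by (rule ext)
    then show "(\<lambda>f. (f ` {0..<N}, \<lambda>i. if i \<in> {0..<N} then inv_into {0..<N} (desc (f ` {0..<N})) (f i) else i))
          ((\<lambda>(T, q). restrict (desc T \<circ> q) {0..<N}) x) = x"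
      by (simp only: Tq(1) prod.case im)
    show "(\<lambda>(T, q). restrict (desc T \<circ> q) {0..<N}) x \<in> {f \<in> ?F. inj_on f {0..<N}}"
    proof -
      have "restrict (desc T \<circ> q) {0..<N} \<in> ?F" using im Tq(2) by (auto simp: PiE_def)
      moreover have "inj_on (restrict (desc T \<circ> q) {0..<N}) {0..<N}"
        using bij_betw_imp_inj_on[OF bT] by (simp only: inj_on_restrict_eq)
      ultimately show ?thesis by (simp only: Tq(1) prod.case mem_Collect_eq)
    qed
  next
    fix f assume f: "f \<in> {f \<in> ?F. inj_on f {0..<N}}"
    let ?T' = "f ` {0..<N}"
    have T: "?T' \<in> ?T" using f by (auto simp: card_image)
    have bij: "bij_betw (desc ?T') {0..<N} ?T'" using bij_betw_desc finT T by blast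
    have bf: "bij_betw f {0..<N} ?T'" using f by (simp add: bij_betw_def)
    let ?q = "\<lambda>i. if i \<in> {0..<N} then inv_into {0..<N} (desc ?T') (f i) else i"
    have "bij_betw (inv_into {0..<N} (desc ?T') \<circ> f) {0..<N} {0..<N}"
      using bij_betw_trans[OF bf bij_betw_inv_into[OF bij]] .
    then have "bij_betw ?q {0..<N} {0..<N}" by (rule bij_betw_cong[THEN iffD1, rotated]) auto
    then have q: "?q permutes {0..<N}" by (rule bij_imp_permutes) auto
    have "restrict (desc ?T' \<circ> ?q) {0..<N} = f"
    proof
      fix i
      show "restrict (desc ?T' \<circ> ?q) {0..<N} i = f i"
      proof (cases "i \<in> {0..<N}")
        case True
        then have "f i \<in> desc ?T' ` {0..<N}"
          unfolding bij_betw_imp_surj_on[OF bij] by (rule imageI)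
        then have "desc ?T' (inv_into {0..<N} (desc ?T') (f i)) = f i" by (rule f_inv_into_f)
        then show ?thesis using True by (simp only: restrict_apply comp_apply if_True)
      qed (use f in \<open>auto simp: PiE_def extensional_def\<close>)
    qed
    then show "(\<lambda>(T, q). restrict (desc T \<circ> q) {0..<N}) (?T', ?q) = f" by (simp only: prod.case)
    show "(?T', ?q) \<in> ?T \<times> ?P" using T q by blast
  qed auto
  also have "\<dots> = (\<Sum>T\<in>?T. \<Sum>q\<in>?P. ?h (restrict (desc T \<circ> q) {0..<N}))"
    by (rule sum.cartesian_product[symmetric])
  also have "\<dots> = (\<Sum>T\<in>?T. fdet N (\<lambda>i j. A i (desc T j)) * fdet N (\<lambda>i j. B (desc T i) j))"
  proof (rule sum.cong)
    fix T
    have "?h (restrict (desc T \<circ> q) {0..<N})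
        = (signof q * (\<Prod>i = 0..<N. A i (desc T (q i)))) * fdet N (\<lambda>i j. B (desc T i) j)" if "q \<in> ?P" for q
    proof -
      have "fdet N (\<lambda>i. B (restrict (desc T \<circ> q) {0..<N} i)) = fdet N (\<lambda>i. (\<lambda>i. B (desc T i)) (q i))"
        by (rule fdet_cong) simp
      also have "\<dots> = signof q * fdet N (\<lambda>i j. B (desc T i) j)"
        by (rule fdet_permute_rows) (use that in simp)
      finally show ?thesis by (simp add: mult_ac)
    qed
    then show "(\<Sum>q\<in>?P. ?h (restrict (desc T \<circ> q) {0..<N}))
        = fdet N (\<lambda>i j. A i (desc T j)) * fdet N (\<lambda>i j. B (desc T i) j)"
      by (simp add: fdet_expand[of N "\<lambda>i j. A i (desc T j)"] sum_distrib_right)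
  qed simp
  finally show ?thesis .
qed

section \<open>Chains of horizontal strips as minors\<close>

definition shapes_within :: "nat \<Rightarrow> (nat \<Rightarrow> nat) set" where
  "shapes_within N = {f \<in> shapes. \<forall>i\<ge>N. f i = 0}"

text \<open>Adding the staircase N-1, ..., 0 makes the rows strictly decreasing, so that a shape
  becomes a set of N numbers. If N is the number of parts, these are the hook lengths of the first
  column.\<close>

definition beta :: "nat \<Rightarrow> (nat \<Rightarrow> nat) \<Rightarrow> nat \<Rightarrow> nat" where
  "beta N f i = f i + (N - Suc i)"

definition beta_set :: "nat \<Rightarrow> (nat \<Rightarrow> nat) \<Rightarrow> nat set" where
  "beta_set N f = beta N f ` {0..<N}"

lemma shapes_antimono: "f \<in> shapes \<Longrightarrow> i \<le> j \<Longrightarrow> f j \<le> f i"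
  by (simp add: shapes_def antimonoD)

lemma beta_less:
  assumes "f \<in> shapes" "i < j" "j < N"
  shows "beta N f j < beta N f i"
  using shapes_antimono[OF assms(1), of i j] assms by (simp add: beta_def)

lemma beta_le:
  assumes "f \<in> shapes" "i \<le> j" "j < N"
  shows "beta N f j \<le> beta N f i"
  using beta_less[OF assms(1), of i j N] assms by (cases "i = j") auto

lemma inj_on_beta: "f \<in> shapes \<Longrightarrow> inj_on (beta N f) {0..<N}"
  using beta_less[of f _ _ N] by (intro inj_onI) (metis atLeastLessThan_iff less_irrefl linorder_neqE_nat)

lemma card_beta_set: "f \<in> shapes \<Longrightarrow> card (beta_set N f) = N"
  by (simp add: beta_set_def card_image inj_on_beta)

lemma finite_beta_set [simp]: "finite (beta_set N f)"
  by (simp add: beta_set_def)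

lemma desc_beta_set:
  assumes "f \<in> shapes" "i < N"
  shows "desc (beta_set N f) i = beta N f i"
  unfolding beta_set_def by (rule desc_image) (use assms beta_less in auto)

lemma desc_ge:
  assumes "card S = N" "i < N"
  shows "N - Suc i \<le> desc S i"
  using assms(2)
proof (induction "N - Suc i" arbitrary: i)
  case (Suc m)
  then have "Suc i < N" "m = N - Suc (Suc i)" by auto
  then have "N - Suc (Suc i) \<le> desc S (Suc i)" using Suc.hyps(1) by blast
  moreover have "desc S (Suc i) < desc S i" using desc_less[OF assms(1)] \<open>Suc i < N\<close> by blast
  ultimately show ?case by linarith
qed simp

text \<open>The inverse lists a set decreasingly and subtracts the staircase; by
  \<open>desc_ge\<close> this subtraction is genuine.\<close>

lemma bij_betw_beta_set: "bij_betw (beta_set N) (shapes_within N) {S. finite S \<and> card S = N}"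
proof (rule bij_betw_byWitness)
  let ?u = "\<lambda>S i. if i < N then desc S i - (N - Suc i) else 0"
  show "\<forall>f\<in>shapes_within N. ?u (beta_set N f) = f"
    by (auto simp: shapes_within_def desc_beta_set beta_def)
  have u: "beta N (?u S) i = desc S i" if "card S = N" "i < N" for S i
    using desc_ge[OF that] that by (simp add: beta_def)
  have "beta_set N (?u S) = S" if "finite S" "card S = N" for S
  proof -
    have "beta_set N (?u S) = desc S ` {0..<N}"
      unfolding beta_set_def by (rule image_cong) (use u that in auto)
    then show ?thesis using bij_betw_imp_surj_on[OF bij_betw_desc[OF that]] by simp
  qed
  then show "\<forall>S\<in>{S. finite S \<and> card S = N}. beta_set N (?u S) = S" by blast
  show "beta_set N ` shapes_within N \<subseteq> {S. finite S \<and> card S = N}"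
    by (auto simp: shapes_within_def card_beta_set)
  have "?u S \<in> shapes_within N" if S: "card S = N" for S
  proof -
    have "?u S (Suc i) \<le> ?u S i" for i
    proof (cases "Suc i < N")
      case True
      then have "desc S (Suc i) < desc S i" using desc_less[OF S] by blast
      then show ?thesis using True by simp
    qed simp
    then have "antimono (?u S)" by (intro decseq_Suc_iff[THEN iffD2] allI)
    moreover have "finite {i. ?u S i \<noteq> 0}"
      by (rule finite_subset[of _ "{..<N}"]) (auto split: if_splits)
    ultimately show ?thesis by (simp add: shapes_within_def shapes_def)
  qed
  then show "?u ` {S. finite S \<and> card S = N} \<subseteq> shapes_within N" by blast
qed

text \<open>
  The matrix has 0/1 entries whose rows are final segments \<open>{J k..<N}\<close> with \<open>J\<close> increasing; unless
  \<open>J\<close> is the identity, the pigeonhole principle gives a zero row or two equal rows.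
\<close>

lemma fdet_interlaces:
  assumes f: "f \<in> shapes_within N" and g: "g \<in> shapes_within N"
  shows "fdet N (\<lambda>i j. of_bool (beta N g j \<le> beta N f i)) = (of_bool (f \<succ> g) :: 'a :: comm_ring_1)"
    (is "fdet N ?e = _")
proof (cases "f \<succ> g")
  case True
  have "?e i j = 0" if "j < i" "i < N" for i j
  proof -
    have "f i \<le> f (Suc j)" using shapes_antimono f that by (simp add: shapes_within_def)
    also have "\<dots> \<le> g j" using True by (simp add: interlaces_def)
    finally show ?thesis using that by (simp add: beta_def)
  qed
  then have "fdet N ?e = (\<Prod>i<N. ?e i i)" by (rule fdet_upper_triangular)
  also have "\<dots> = 1"
  proof (rule prod.neutral, rule ballI)
    fix i
    have "g i \<le> f i" using True by (simp add: interlaces_def)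
    then have "beta N g i \<le> beta N f i" unfolding beta_def by (rule add_right_mono)
    then show "?e i i = 1" by simp
  qed
  finally show ?thesis using True by simp
next
  case False
  have sh: "f \<in> shapes" "g \<in> shapes" using f g by (auto simp: shapes_within_def)
  \<comment> \<open>The first column with entry 1 in row k; the alternative \<open>j \<ge> N\<close>
    gives a zero row the value N.\<close>
  define J where "J k = (LEAST j. j \<ge> N \<or> beta N g j \<le> beta N f k)" for k
  have JN: "J k \<le> N" for k unfolding J_def by (rule Least_le) simp
  have J: "beta N g j \<le> beta N f k \<longleftrightarrow> J k \<le> j" if "j < N" for j k
  proof
    show "J k \<le> j" if "beta N g j \<le> beta N f k"
      unfolding J_def by (rule Least_le) (use that in simp)
    assume le: "J k \<le> j"
    have "J k \<ge> N \<or> beta N g (J k) \<le> beta N f k"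
      unfolding J_def by (rule LeastI[of _ N]) simp
    then show "beta N g j \<le> beta N f k"
      using le that beta_le[OF sh(2) le that] by linarith
  qed
  have eq0: "fdet N ?e = 0" if "i \<noteq> j" "i < N" "j < N" "J i = J j" for i j
    by (rule fdet_equal_rows[OF that(1-3)]) (simp add: J that(4))
  have "fdet N ?e = 0"
  proof (cases "\<exists>i. f i < g i")
    case True
    then obtain i where i: "f i < g i" by blast
    have iN: "i < N" using i g by (cases "i < N") (auto simp: shapes_within_def)
    \<comment> \<open>The N - i rows from i on have their first 1 beyond column i, leaving N - i
      values including N. Either two agree or all are taken, and then N marks a zero row.\<close>
    have sub: "J ` {i..<N} \<subseteq> {Suc i..N}"
    proof (rule image_subsetI)
      fix k assume k: "k \<in> {i..<N}"
      have "beta N f i < beta N g i" using i by (simp add: beta_def)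
      then have "\<not> beta N g i \<le> beta N f k" using beta_le[OF sh(1), of i k N] k by auto
      then show "J k \<in> {Suc i..N}" using J[OF iN] JN by auto
    qed
    show ?thesis
    proof (cases "inj_on J {i..<N}")
      case True
      then have "J ` {i..<N} = {Suc i..N}"
        by (intro card_subset_eq sub) (auto simp: card_image)
      moreover have "N \<in> {Suc i..N}" using iN by simp
      ultimately have "N \<in> J ` {i..<N}" by (simp only:)
      then obtain k where "k < N" "J k = N" by auto
      then show ?thesis by (intro fdet_zero_row[of k]) (auto simp: J)
    next
      case False
      then show ?thesis using eq0 by (auto simp: inj_on_def)
    qed
  next
    case nle: False
    obtain i where "\<not> (g i \<le> f i \<and> f (Suc i) \<le> g i)"
      using False by (auto simp: interlaces_def)
    moreover have "\<not> f i < g i" using nle by blast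
    ultimately have i: "g i < f (Suc i)" by linarith
    have iN: "Suc i < N" using i f by (cases "Suc i < N") (auto simp: shapes_within_def)
    \<comment> \<open>Here the i + 2 rows up to \<open>Suc i\<close> have their first 1 among the i
      + 1 columns up to i, so two rows coincide.\<close>
    have "J ` {0..Suc i} \<subseteq> {0..i}"
    proof (rule image_subsetI)
      fix k assume k: "k \<in> {0..Suc i}"
      have "beta N g i \<le> beta N f (Suc i)" using i iN by (simp add: beta_def)
      also have "\<dots> \<le> beta N f k" using beta_le[OF sh(1)] k iN by auto
      finally show "J k \<in> {0..i}" using J[of i k] iN by auto
    qed
    then have "card (J ` {0..Suc i}) \<le> card {0..i}" by (rule card_mono[rotated]) simp
    then have "\<not> inj_on J {0..Suc i}" by (intro pigeonhole) simp
    then show ?thesis using eq0 iN by (auto simp: inj_on_def)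
  qed
  then show ?thesis using False by simp
qed

text \<open>
  The complete homogeneous symmetric function of degree \<open>i - j\<close> in \<open>a\<close> variables equal to 1; it is
  a polynomial in \<open>a\<close>, hence makes sense for negative and fractional \<open>a\<close>.
\<close>

definition hsym :: "rat \<Rightarrow> nat \<Rightarrow> nat \<Rightarrow> rat" where
  "hsym a i j = (if j \<le> i then pochhammer a (i - j) / fact (i - j) else 0)"

lemma hsym_0: "hsym 0 i j = of_bool (i = j)"
  by (auto simp: hsym_def pochhammer_0_left)

text \<open>The coefficient of x^r in (1 - x)^(-a) * 1/(1 - x) = (1 - x)^(-(a+1)).\<close>

lemma sum_pochhammer_fact: "(\<Sum>m\<le>r. pochhammer a m / fact m) = pochhammer (a + 1) r / fact r" for a :: rat
proof (induction r)
  case (Suc r)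
  have e: "pochhammer a (Suc r) = a * pochhammer (a + 1) r"
    "pochhammer (a + 1) (Suc r) = pochhammer (a + 1) r * (a + 1 + of_nat r)"
    by (rule pochhammer_rec, rule pochhammer_Suc)
  have "(\<Sum>m\<le>Suc r. pochhammer a m / fact m) = pochhammer (a + 1) r / fact r + a * pochhammer (a + 1) r / fact (Suc r)"
    by (simp only: sum.atMost_Suc Suc.IH e)
  also have "\<dots> = pochhammer (a + 1) r * (a + 1 + of_nat r) / fact (Suc r)"
    by (simp add: divide_simps) (simp add: algebra_simps)
  finally show ?case by (simp only: e)
qed simp

text \<open>Thus \<open>hsym\<close> at a natural number a is the a-th power of the matrix with
  entries \<open>[k \<le> i]\<close>; rows below M are not affected by cutting the matrix off at
  M.\<close>

lemma hsym_Suc: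
  assumes "i < M"
  shows "(\<Sum>k<M. of_bool (k \<le> i) * hsym a k j) = hsym (a + 1) i j"
proof -
  have "(\<Sum>k<M. of_bool (k \<le> i) * hsym a k j) = (\<Sum>k\<in>{j..i}. pochhammer a (k - j) / fact (k - j))"
    by (rule sum.mono_neutral_cong_right) (use assms in \<open>auto simp: hsym_def\<close>)
  also have "\<dots> = hsym (a + 1) i j"
  proof (cases "j \<le> i")
    case True
    have "(\<Sum>k\<in>{j..i}. pochhammer a (k - j) / fact (k - j)) = (\<Sum>m\<le>i - j. pochhammer a m / fact m)"
      by (rule sum.reindex_bij_witness[where i = "\<lambda>m. m + j" and j = "\<lambda>k. k - j"]) (use True in auto)
    then show ?thesis using True by (simp add: sum_pochhammer_fact hsym_def)
  qed (simp add: hsym_def)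
  finally show ?thesis .
qed

lemma sum_beta_sets:
  "(\<Sum>T | T \<subseteq> {..<M} \<and> card T = N. F T)
     = (\<Sum>r\<in>{r \<in> shapes_within N. beta_set N r \<subseteq> {..<M}}. F (beta_set N r))"
  and finite_bounded_shapes: "finite {r \<in> shapes_within N. beta_set N r \<subseteq> {..<M}}"
proof -
  let ?R = "{r \<in> shapes_within N. beta_set N r \<subseteq> {..<M}}"
  have "beta_set N ` ?R = {T. T \<subseteq> {..<M} \<and> card T = N}"
  proof -
    have "T \<in> beta_set N ` ?R" if "T \<subseteq> {..<M}" "card T = N" for T
    proof -
      have "finite T" using that finite_subset by blast
      then have "T \<in> beta_set N ` shapes_within N"
        unfolding bij_betw_imp_surj_on[OF bij_betw_beta_set] using that by simp
      then obtain r where "r \<in> shapes_within N" "beta_set N r = T" by auto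
      then show ?thesis using that by blast
    qed
    then show ?thesis by (auto simp: shapes_within_def card_beta_set)
  qed
  then have bij: "bij_betw (beta_set N) ?R {T. T \<subseteq> {..<M} \<and> card T = N}"
    by (intro bij_betw_subset[OF bij_betw_beta_set]) auto
  show "(\<Sum>T | T \<subseteq> {..<M} \<and> card T = N. F T) = (\<Sum>r\<in>?R. F (beta_set N r))"
    by (rule sum.reindex_bij_betw[OF bij, symmetric])
  have "{T. T \<subseteq> {..<M} \<and> card T = N} \<subseteq> Pow {..<M}" by auto
  then show "finite ?R" using bij_betw_finite[OF bij] finite_subset by blast
qed

lemma beta_bound:
  assumes "f \<in> shapes" "i < N" "\<And>i. g i \<le> f i"
  shows "beta N g i < Suc (f 0 + N)"
  using shapes_antimono[OF assms(1), of 0 i] assms(3)[of i] by (simp add: beta_def)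

lemma bounded_shape:
  assumes "f \<in> shapes_within N" "g \<in> shapes" "\<And>i. g i \<le> f i"
  shows "g \<in> {r \<in> shapes_within N. beta_set N r \<subseteq> {..<Suc (f 0 + N)}}"
proof -
  have "g i = 0" if "i \<ge> N" for i
    using assms(1) assms(3)[of i] that by (simp add: shapes_within_def)
  then have "g \<in> shapes_within N" using assms(2) by (simp add: shapes_within_def)
  moreover have "beta_set N g \<subseteq> {..<Suc (f 0 + N)}"
    using beta_bound[of f _ N g] assms by (auto simp: beta_set_def shapes_within_def)
  ultimately show ?thesis by simp
qed

text \<open>The Jacobi--Trudi formula at a ones. Each step of the chain is a minor of the 0/1 matrix
  by \<open>fdet_interlaces\<close>, and Cauchy--Binet composes the steps. In the base case,
  distinct shapes have a beta number not in common, which produces a zero row.\<close>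

lemma chain_count_fdet:
  assumes "f \<in> shapes_within N" and g: "g \<in> shapes_within N"
  shows "chain_count a f g = fdet N (\<lambda>i j. hsym (of_nat a) (beta N f i) (beta N g j))"
  using assms(1)
proof (induction a arbitrary: f)
  case 0
  show ?case
  proof (cases "f = g")
    case True
    have inj: "beta N g i = beta N g j \<longleftrightarrow> i = j" if "i < N" "j < N" for i j
      using inj_on_beta[of g N] g that by (auto simp: shapes_within_def inj_on_def)
    have "fdet N (\<lambda>i j. hsym 0 (beta N g i) (beta N g j)) = (\<Prod>i<N. hsym 0 (beta N g i) (beta N g i))"
      by (rule fdet_upper_triangular) (auto simp: hsym_0 inj)
    then show ?thesis using True by (simp add: hsym_0)
  next
    case False
    then have "beta_set N f \<noteq> beta_set N g"
      using bij_betw_imp_inj_on[OF bij_betw_beta_set[of N]] 0 g by (auto simp: inj_on_def)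
    then have "\<not> beta_set N f \<subseteq> beta_set N g"
      using card_subset_eq[of "beta_set N g" "beta_set N f"] 0 g by (auto simp: card_beta_set shapes_within_def)
    then obtain x where "x \<in> beta_set N f" "x \<notin> beta_set N g" by blast
    then obtain i where i: "i < N" "beta N f i \<notin> beta_set N g" by (auto simp: beta_set_def)
    then have "fdet N (\<lambda>i j. hsym 0 (beta N f i) (beta N g j)) = 0"
      by (intro fdet_zero_row[of i]) (auto simp: hsym_0 beta_set_def)
    then show ?thesis using False by simp
  qed
next
  case (Suc a)
  \<comment> \<open>M lies above every beta number of f, so stopping the sum over k at M loses
    nothing.\<close>
  define M where "M = Suc (f 0 + N)"
  let ?R = "{r \<in> shapes_within N. beta_set N r \<subseteq> {..<M}}"
  have sh: "f \<in> shapes" using Suc.prems by (simp add: shapes_within_def)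
  have "fdet N (\<lambda>i j. hsym (of_nat (Suc a)) (beta N f i) (beta N g j))
      = fdet N (\<lambda>i j. \<Sum>k<M. of_bool (k \<le> beta N f i) * hsym (of_nat a) k (beta N g j))"
    by (rule fdet_cong, subst hsym_Suc) (use beta_bound[OF sh] in \<open>auto simp: M_def add.commute\<close>)
  also have "\<dots> = (\<Sum>T | T \<subseteq> {..<M} \<and> card T = N.
      fdet N (\<lambda>i j. of_bool (desc T j \<le> beta N f i)) * fdet N (\<lambda>i j. hsym (of_nat a) (desc T i) (beta N g j)))"
    by (rule cauchy_binet)
  also have "\<dots> = (\<Sum>r\<in>?R. fdet N (\<lambda>i j. of_bool (desc (beta_set N r) j \<le> beta N f i))
      * fdet N (\<lambda>i j. hsym (of_nat a) (desc (beta_set N r) i) (beta N g j)))"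
    by (rule sum_beta_sets)
  also have "\<dots> = (\<Sum>r\<in>?R. if f \<succ> r then chain_count a r g else 0)"
  proof (rule sum.cong)
    fix r assume "r \<in> ?R"
    then have r: "r \<in> shapes_within N" "r \<in> shapes" by (auto simp: shapes_within_def)
    have "fdet N (\<lambda>i j. of_bool (desc (beta_set N r) j \<le> beta N f i)) = (of_bool (f \<succ> r) :: rat)"
      unfolding fdet_interlaces[OF Suc.prems r(1), symmetric]
      by (rule fdet_cong) (simp add: desc_beta_set r)
    moreover have "fdet N (\<lambda>i j. hsym (of_nat a) (desc (beta_set N r) i) (beta N g j)) = chain_count a r g"
      unfolding Suc.IH[OF r(1)] by (rule fdet_cong) (simp add: desc_beta_set r)
    ultimately show "fdet N (\<lambda>i j. of_bool (desc (beta_set N r) j \<le> beta N f i))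
      * fdet N (\<lambda>i j. hsym (of_nat a) (desc (beta_set N r) i) (beta N g j))
      = (if f \<succ> r then chain_count a r g else 0)" by simp
  qed simp
  also have "\<dots> = (\<Sum>r | r \<in> ?R \<and> f \<succ> r. chain_count a r g)"
    by (rule sum.inter_filter[OF finite_bounded_shapes, symmetric])
  also have "{r. r \<in> ?R \<and> f \<succ> r} = {r. f \<succ> r}"
    using bounded_shape[OF Suc.prems] interlaces_shape[OF sh] by (auto simp: M_def interlaces_def)
  finally show ?case by simp
qed

text \<open>An entry of \<open>hsym a\<close> times the transpose of \<open>hsym b\<close>. Stopping
  at i keeps all nonzero terms and makes the sum independent of any cut-off.\<close>

definition gram :: "rat \<Rightarrow> rat \<Rightarrow> nat \<Rightarrow> nat \<Rightarrow> rat" where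
  "gram a b i j = (\<Sum>k\<le>i. hsym a i k * hsym b j k)"

text \<open>Cauchy--Binet once more, now contracting the two chains over their common inner shape.
  With N >= n every shape of size n fits into N rows.\<close>

lemma pair_count_gram:
  assumes "n \<le> N"
  shows "(\<Sum>m\<le>n. pair_count a b n m)
       = (\<Sum>r\<in>shapes_of n. fdet N (\<lambda>i j. gram (of_nat a) (of_nat b) (beta N r i) (beta N r j)))"
proof -
  have "(\<Sum>m\<le>n. pair_count a b n m)
      = (\<Sum>r\<in>shapes_of n. \<Sum>m\<le>n. \<Sum>\<mu>\<in>shapes_of m. chain_count a r \<mu> * chain_count b r \<mu>)"
    unfolding pair_count_def by (rule sum.swap)
  also have "\<dots> = (\<Sum>r\<in>shapes_of n. fdet N (\<lambda>i j. gram (of_nat a) (of_nat b) (beta N r i) (beta N r j)))"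
  proof (rule sum.cong)
    fix r assume rn: "r \<in> shapes_of n"
    then have sh: "r \<in> shapes" and wt: "wt r = n" by (auto simp: shapes_of_def)
    have rN: "r \<in> shapes_within N"
      using shapes_window[OF sh] wt assms sh by (auto simp: shapes_within_def)
    define M where "M = Suc (r 0 + N)"
    let ?R = "{\<mu> \<in> shapes_within N. beta_set N \<mu> \<subseteq> {..<M}}"
    have "fdet N (\<lambda>i j. gram (of_nat a) (of_nat b) (beta N r i) (beta N r j))
        = fdet N (\<lambda>i j. \<Sum>k<M. hsym (of_nat a) (beta N r i) k * hsym (of_nat b) (beta N r j) k)"
      unfolding gram_def
      by (rule fdet_cong, rule sum.mono_neutral_left)
         (use beta_bound[OF sh] in \<open>auto simp: M_def hsym_def intro: le_less_trans\<close>)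
    also have "\<dots> = (\<Sum>T | T \<subseteq> {..<M} \<and> card T = N.
        fdet N (\<lambda>i j. hsym (of_nat a) (beta N r i) (desc T j)) * fdet N (\<lambda>i j. hsym (of_nat b) (beta N r j) (desc T i)))"
      by (rule cauchy_binet)
    also have "\<dots> = (\<Sum>\<mu>\<in>?R. fdet N (\<lambda>i j. hsym (of_nat a) (beta N r i) (desc (beta_set N \<mu>) j))
        * fdet N (\<lambda>i j. hsym (of_nat b) (beta N r j) (desc (beta_set N \<mu>) i)))"
      by (rule sum_beta_sets)
    also have "\<dots> = (\<Sum>\<mu>\<in>?R. chain_count a r \<mu> * chain_count b r \<mu>)"
    proof (rule sum.cong)
      fix \<mu> assume "\<mu> \<in> ?R"
      then have \<mu>: "\<mu> \<in> shapes_within N" "\<mu> \<in> shapes" by (auto simp: shapes_within_def)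
      have "fdet N (\<lambda>i j. hsym (of_nat c) (beta N r i) (desc (beta_set N \<mu>) j)) = chain_count c r \<mu>" for c
        unfolding chain_count_fdet[OF rN \<mu>(1)] by (rule fdet_cong) (simp add: desc_beta_set \<mu>)
      then show "fdet N (\<lambda>i j. hsym (of_nat a) (beta N r i) (desc (beta_set N \<mu>) j))
        * fdet N (\<lambda>i j. hsym (of_nat b) (beta N r j) (desc (beta_set N \<mu>) i)) = chain_count a r \<mu> * chain_count b r \<mu>"
        by (simp add: fdet_transpose[of N "\<lambda>i j. hsym (of_nat b) (beta N r i) (desc (beta_set N \<mu>) j)"])
    qed simp
    also have "\<dots> = (\<Sum>\<mu>\<in>(\<Union>m\<le>n. shapes_of m). chain_count a r \<mu> * chain_count b r \<mu>)"
    proof (rule sum.mono_neutral_cong[OF _ finite_bounded_shapes])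
      show "finite (\<Union>m\<le>n. shapes_of m)" by (simp add: finite_shapes_of)
      have nz: "\<mu> \<in> ?R \<and> \<mu> \<in> (\<Union>m\<le>n. shapes_of m)" if "chain_count a r \<mu> \<noteq> 0" for \<mu>
        using chain_count_nonzero[OF sh that] bounded_shape[OF rN, of \<mu>] chain_count_wt[OF sh that] wt
        by (auto simp: M_def shapes_of_def)
      show "chain_count a r \<mu> * chain_count b r \<mu> = 0" if "\<mu> \<in> (\<Union>m\<le>n. shapes_of m) - ?R" for \<mu>
        using nz[of \<mu>] that by fastforce
      show "chain_count a r \<mu> * chain_count b r \<mu> = 0" if "\<mu> \<in> ?R - (\<Union>m\<le>n. shapes_of m)" for \<mu>
        using nz[of \<mu>] that by fastforce
    qed simp
    also have "\<dots> = (\<Sum>m\<le>n. \<Sum>\<mu>\<in>shapes_of m. chain_count a r \<mu> * chain_count b r \<mu>)"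
      by (rule sum.UNION_disjoint) (auto simp: finite_shapes_of, auto simp: shapes_of_def)
    finally show "(\<Sum>m\<le>n. \<Sum>\<mu>\<in>shapes_of m. chain_count a r \<mu> * chain_count b r \<mu>)
        = fdet N (\<lambda>i j. gram (of_nat a) (of_nat b) (beta N r i) (beta N r j))" ..
  qed simp
  finally show ?thesis .
qed

section \<open>The Nekrasov--Okounkov formula\<close>

lemma fdet_scale:
  fixes r c :: "nat \<Rightarrow> 'a :: comm_ring_1"
  shows "fdet n (\<lambda>i j. r i * c j * f i j) = (\<Prod>i<n. r i) * (\<Prod>j<n. c j) * fdet n f"
proof -
  have "(\<Prod>i = 0..<n. r i * c (p i) * f i (p i)) = (\<Prod>i<n. r i) * (\<Prod>j<n. c j) * (\<Prod>i = 0..<n. f i (p i))"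
    if "p permutes {0..<n}" for p
  proof -
    have "(\<Prod>i\<in>{0..<n}. c (p i)) = (\<Prod>j\<in>{0..<n}. c j)"
      using prod.permute[OF that, of c] by (simp add: comp_def)
    then show ?thesis by (simp add: prod.distrib atLeast0LessThan)
  qed
  then show ?thesis
    unfolding fdet_expand sum_distrib_left by (intro sum.cong) (simp_all add: mult_ac)
qed

text \<open>The Schur complement of the last entry: the matrix is a unit upper triangular
  \<open>?U\<close> times a block lower triangular \<open>?L\<close>.\<close>

lemma fdet_Suc_pivot:
  fixes f :: "nat \<Rightarrow> nat \<Rightarrow> 'a :: field"
  assumes "f n n \<noteq> 0"
  shows "fdet (Suc n) f = f n n * fdet n (\<lambda>i j. f i j - f i n * f n j / f n n)"
proof -
  let ?g = "\<lambda>i j. f i j - f i n * f n j / f n n"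
  let ?u = "\<lambda>i j. if i = j then 1 else if j = n then f i n / f n n else 0"
  let ?l = "\<lambda>i j. if i = n then f n j else if j = n then 0 else ?g i j"
  let ?U = "mat (Suc n) (Suc n) (\<lambda>(i, j). ?u i j)"
  let ?L = "mat (Suc n) (Suc n) (\<lambda>(i, j). ?l i j)"
  have entry: "(\<Sum>k = 0..<Suc n. ?u i k * ?l k j) = f i j" if "i < Suc n" "j < Suc n" for i j
  proof (cases "i = n")
    case True
    then have "(\<Sum>k = 0..<Suc n. ?u i k * ?l k j) = (\<Sum>k = 0..<Suc n. if k = n then f n j else 0)"
      by (intro sum.cong) auto
    then show ?thesis using True by simp
  next
    case False
    have "(\<Sum>k = 0..<n. ?u i k * ?l k j) = (\<Sum>k = 0..<n. if k = i then ?l i j else 0)"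
      using False by (intro sum.cong) auto
    then have "(\<Sum>k = 0..<Suc n. ?u i k * ?l k j) = ?l i j + f i n / f n n * f n j"
      using False that by simp
    then show ?thesis using False assms by simp
  qed
  have times: "(?U * ?L) $$ (i, j) = (\<Sum>k = 0..<Suc n. ?u i k * ?l k j)" if "i < Suc n" "j < Suc n" for i j
    using that by (simp add: scalar_prod_def)
  have "mat (Suc n) (Suc n) (\<lambda>(i, j). f i j) = ?U * ?L"
  proof (rule eq_matI)
    fix i j assume "i < dim_row (?U * ?L)" "j < dim_col (?U * ?L)"
    then have ij: "i < Suc n" "j < Suc n" by simp_all
    show "mat (Suc n) (Suc n) (\<lambda>(i, j). f i j) $$ (i, j) = (?U * ?L) $$ (i, j)"
      unfolding times[OF ij] entry[OF ij] using ij by simp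
  qed simp_all
  then have "fdet (Suc n) f = fdet (Suc n) ?u * fdet (Suc n) ?l"
    using det_mult[of ?U "Suc n" ?L] by simp
  also have "fdet (Suc n) ?u = 1"
    by (subst fdet_upper_triangular) auto
  also have "fdet (Suc n) ?l = fdet n ?g * f n n"
  proof -
    let ?A = "mat n n (\<lambda>(i, j). ?g i j)" and ?B = "mat 1 n (\<lambda>(i, j). f n j)" and ?C = "mat 1 1 (\<lambda>_. f n n)"
    have "?L = four_block_mat ?A (0\<^sub>m n 1) ?B ?C"
      by (rule eq_matI) (auto simp: less_Suc_eq)
    moreover have "det (four_block_mat ?A (0\<^sub>m n 1) ?B ?C) = det ?A * det ?C"
      by (rule det_four_block_mat_upper_right_zero_col[OF mat_carrier refl mat_carrier mat_carrier])
    moreover have "det ?C = f n n" using det_single[OF mat_carrier, of "\<lambda>_. f n n"] by simp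
    ultimately show ?thesis by (simp only:)
  qed
  finally show ?thesis by simp
qed

text \<open>Pivoting on the last entry returns the smaller Cauchy matrix with rescaled rows and
  columns. The product is ordered by the larger index because the induction delivers it that
  way.\<close>

lemma cauchy_determinant:
  fixes x y :: "nat \<Rightarrow> 'a :: field"
  assumes "\<And>i j. i < n \<Longrightarrow> j < n \<Longrightarrow> x i \<noteq> y j"
  shows "fdet n (\<lambda>i j. 1 / (x i - y j))
       = (\<Prod>k<n. 1 / (x k - y k) * (\<Prod>i<k. (x i - x k) / (x i - y k) * ((y k - y i) / (x k - y i))))"
  using assms
proof (induction n)
  case 0
  then show ?case by (simp add: fdet_expand)
next
  case (Suc n)
  have ne: "x i - y j \<noteq> 0" if "i < Suc n" "j < Suc n" for i j
    using Suc.prems[OF that] by simp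
  let ?r = "\<lambda>i. (x i - x n) / (x i - y n)" and ?c = "\<lambda>j. (y n - y j) / (x n - y j)"
  have "fdet (Suc n) (\<lambda>i j. 1 / (x i - y j))
      = 1 / (x n - y n) * fdet n (\<lambda>i j. 1 / (x i - y j) - 1 / (x i - y n) * (1 / (x n - y j)) / (1 / (x n - y n)))"
    by (rule fdet_Suc_pivot) (use ne in simp)
  also have "fdet n (\<lambda>i j. 1 / (x i - y j) - 1 / (x i - y n) * (1 / (x n - y j)) / (1 / (x n - y n)))
      = fdet n (\<lambda>i j. ?r i * ?c j * (1 / (x i - y j)))"
  proof (rule fdet_cong)
    fix i j assume ij: "i < n" "j < n"
    have nz: "x i - y j \<noteq> 0" "x i - y n \<noteq> 0" "x n - y j \<noteq> 0" "x n - y n \<noteq> 0"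
      using ne ij by simp_all
    have "(x i - y n) * (x n - y j) - (x n - y n) * (x i - y j) = (x i - x n) * (y n - y j)"
      by (simp add: algebra_simps)
    moreover have "1 / (x i - y j) - 1 / (x i - y n) * (1 / (x n - y j)) / (1 / (x n - y n))
        = ((x i - y n) * (x n - y j) - (x n - y n) * (x i - y j)) / ((x i - y n) * (x n - y j) * (x i - y j))"
      using nz by (simp add: diff_divide_distrib)
    ultimately show "1 / (x i - y j) - 1 / (x i - y n) * (1 / (x n - y j)) / (1 / (x n - y n))
        = ?r i * ?c j * (1 / (x i - y j))" by simp
  qed
  also have "\<dots> = (\<Prod>i<n. ?r i) * (\<Prod>j<n. ?c j) * fdet n (\<lambda>i j. 1 / (x i - y j))"
    by (rule fdet_scale)
  also have "fdet n (\<lambda>i j. 1 / (x i - y j))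
       = (\<Prod>k<n. 1 / (x k - y k) * (\<Prod>i<k. (x i - x k) / (x i - y k) * ((y k - y i) / (x k - y i))))"
    using Suc by simp
  finally show ?case by (simp only: prod.lessThan_Suc prod.distrib mult_ac)
qed

lemma gram_0_left: "gram a b 0 j = pochhammer b j / fact j"
  by (simp add: gram_def hsym_def)

lemma gram_0_right: "gram a b i 0 = pochhammer a i / fact i"
proof -
  have "gram a b i 0 = (\<Sum>k\<le>i. if k = 0 then hsym a i 0 else 0)"
    unfolding gram_def by (rule sum.cong) (auto simp: hsym_def)
  then show ?thesis by (simp add: hsym_def)
qed

lemma hsym_Suc_Suc: "hsym a (Suc i) (Suc k) = hsym a i k"
  by (simp add: hsym_def)

lemma hsym_right_0: "hsym a i 0 = pochhammer a i / fact i"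
  by (simp add: hsym_def)

text \<open>\<open>hsym\<close> depends only on the difference of its indices, so a diagonal step
  adds just the term k = 0.\<close>

lemma gram_Suc_Suc:
  "gram a b (Suc i) (Suc j) = gram a b i j + pochhammer a (Suc i) / fact (Suc i) * (pochhammer b (Suc j) / fact (Suc j))"
  unfolding gram_def sum.atMost_Suc_shift by (simp only: hsym_Suc_Suc hsym_right_0 add.commute)

lemma pochhammer_quotient:
  fixes b :: "'a :: field"
  assumes "b + of_nat k \<noteq> 0"
  shows "pochhammer b k = pochhammer (1 + b) k * (b / (b + of_nat k))"
proof -
  have "pochhammer b k * (b + of_nat k) = b * pochhammer (1 + b) k"
    using pochhammer_rec[of b k] pochhammer_Suc[of b k] by (simp add: add.commute)
  then show ?thesis using assms by (simp add: eq_divide_eq mult.commute)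
qed

text \<open>Up to row and column factors this is a Cauchy matrix in the points i + a and j. The
  diagonal recurrence preserves the form because (i+1)(j+1) - a(a+i-j) factors as
  (1+a+i)(1-a+j).\<close>

lemma gram_neg:
  fixes a :: rat
  assumes nz: "\<And>i j. a + of_nat i - of_nat j \<noteq> 0"
  shows "gram a (- a) i j = pochhammer (1 + a) i / fact i * (pochhammer (1 - a) j / fact j) * (a / (a + of_nat i - of_nat j))"
proof (induction i arbitrary: j)
  case 0
  have "pochhammer (- a) j = pochhammer (1 - a) j * ((- a) / (- a + of_nat j))"
    using pochhammer_quotient[of "- a" j] nz[of 0 j] by (simp add: eq_neg_iff_add_eq_0)
  also have "(- a) / (- a + of_nat j) = a / (a + of_nat 0 - of_nat j)"
  proof -
    have "(- a) / (- a + of_nat j) = (- a) / (- (a - of_nat j))" by simp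
    also have "\<dots> = a / (a - of_nat j)" by (rule minus_divide_divide)
    finally show ?thesis by simp
  qed
  finally show ?case by (simp add: gram_0_left)
next
  case (Suc i)
  show ?case
  proof (cases j)
    case 0
    have "pochhammer a (Suc i) = pochhammer (1 + a) (Suc i) * (a / (a + of_nat (Suc i)))"
      by (rule pochhammer_quotient) (use nz[of "Suc i" 0] in simp)
    then show ?thesis unfolding 0 gram_0_right by simp
  next
    case (Suc j')
    define c d D where "c = pochhammer (1 + a) i / fact i" and "d = pochhammer (1 - a) j' / fact j'"
      and "D = a + of_nat i - of_nat j'"
    have D: "D \<noteq> 0" using nz by (simp add: D_def)
    have i0: "1 + of_nat i \<noteq> (0 :: rat)" "1 + of_nat j' \<noteq> (0 :: rat)"
      by (metis of_nat_Suc of_nat_neq_0)+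
    have c1: "pochhammer (1 + a) (Suc i) / fact (Suc i) = c * (1 + a + of_nat i) / (1 + of_nat i)"
      by (simp add: c_def pochhammer_Suc)
    have d1: "pochhammer (1 - a) (Suc j') / fact (Suc j') = d * (1 - a + of_nat j') / (1 + of_nat j')"
      by (simp add: d_def pochhammer_Suc)
    have c2: "pochhammer a (Suc i) / fact (Suc i) = c * a / (1 + of_nat i)"
      by (simp add: c_def pochhammer_rec add.commute mult_ac)
    have d2: "pochhammer (- a) (Suc j') / fact (Suc j') = - d * a / (1 + of_nat j')"
      by (simp add: d_def pochhammer_rec mult_ac)
    have "gram a (- a) (Suc i) (Suc j') = c * d * (a / D) + c * a / (1 + of_nat i) * (- d * a / (1 + of_nat j'))"
      unfolding gram_Suc_Suc Suc.IH c2 d2 by (simp add: c_def d_def D_def)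
    also have "\<dots> = c * d * a * ((1 + of_nat i) * (1 + of_nat j') - a * D) / (D * (1 + of_nat i) * (1 + of_nat j'))"
      using D i0 by (simp add: divide_simps) (simp add: algebra_simps)
    also have "(1 + of_nat i) * (1 + of_nat j') - a * D = (1 + a + of_nat i) * (1 - a + of_nat j')"
      by (simp add: D_def algebra_simps)
    also have "c * d * a * ((1 + a + of_nat i) * (1 - a + of_nat j')) / (D * (1 + of_nat i) * (1 + of_nat j'))
        = (c * (1 + a + of_nat i) / (1 + of_nat i)) * (d * (1 - a + of_nat j') / (1 + of_nat j')) * (a / D)"
      by (simp add: mult_ac)
    finally show ?thesis
      unfolding Suc c1 d1 by (simp add: D_def)
  qed
qed

text \<open>Reads the combined row and column factor of a beta number b as a product over all g < b,
  with 1 - a^2/k^2 = (1 + a/k)(1 - a/k).\<close>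

lemma pochhammer_square_prod:
  "pochhammer (1 + a) b / fact b * (pochhammer (1 - a) b / fact b) = (\<Prod>g<b. 1 - a\<^sup>2 / (of_nat (b - g))\<^sup>2)"
  for a :: rat
proof -
  have "(\<Prod>g<b. 1 - a\<^sup>2 / (of_nat (b - g))\<^sup>2) = (\<Prod>g<b. 1 - a\<^sup>2 / (of_nat (Suc (b - Suc g)))\<^sup>2)"
    by (intro prod.cong) (auto simp: Suc_diff_Suc)
  also have "\<dots> = (\<Prod>k<b. 1 - a\<^sup>2 / (of_nat (Suc k))\<^sup>2)"
    by (rule prod.nat_diff_reindex)
  also have "\<dots> = pochhammer (1 + a) b / fact b * (pochhammer (1 - a) b / fact b)"
  proof (induction b)
    case (Suc b)
    have "(1 + of_nat b :: rat) \<noteq> 0" by (metis of_nat_Suc of_nat_neq_0)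
    then have "1 - a\<^sup>2 / (1 + of_nat b)\<^sup>2 = (1 + a + of_nat b) / (1 + of_nat b) * ((1 - a + of_nat b) / (1 + of_nat b))"
      by (simp add: divide_simps power2_eq_square) (simp add: algebra_simps)
    then show ?case using Suc by (simp add: pochhammer_Suc mult_ac)
  qed simp
  finally show ?thesis ..
qed

lemma beta_set_below:
  assumes "r \<in> shapes" "i < N"
  shows "{..<beta N r i} \<inter> beta_set N r = beta N r ` {i<..<N}"
proof
  show "{..<beta N r i} \<inter> beta_set N r \<subseteq> beta N r ` {i<..<N}"
  proof
    fix g assume "g \<in> {..<beta N r i} \<inter> beta_set N r"
    then obtain k where k: "k < N" "g = beta N r k" "beta N r k < beta N r i" by (auto simp: beta_set_def)
    have "i < k"
      by (cases i k rule: linorder_cases) (use k assms(2) beta_less[OF assms(1), of k i N] in auto)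
    then show "g \<in> beta N r ` {i<..<N}" using k by auto
  qed
  show "beta N r ` {i<..<N} \<subseteq> {..<beta N r i} \<inter> beta_set N r"
    using beta_less[OF assms(1)] by (auto simp: beta_set_def)
qed

text \<open>
  If \<open>S\<close> is the set of beta numbers of a partition, the differences \<open>b - g\<close> are its hook lengths.
\<close>

definition hook_pairs :: "nat set \<Rightarrow> (nat \<times> nat) set" where
  "hook_pairs S = (SIGMA b:S. {..<b} - S)"

text \<open>The row and column factors contribute every g below a beta number; the Cauchy
  determinant divides out those g that are beta numbers themselves. What remains is the product over
  hooks.\<close>

lemma fdet_gram_neg:
  fixes a :: rat
  assumes nz: "\<And>i j. a + of_nat i - of_nat j \<noteq> 0" and r: "r \<in> shapes_within N"
  shows "fdet N (\<lambda>i j. gram a (- a) (beta N r i) (beta N r j))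
       = (\<Prod>(b, g)\<in>hook_pairs (beta_set N r). 1 - a\<^sup>2 / (of_nat (b - g))\<^sup>2)"
proof -
  have sh: "r \<in> shapes" using r by (simp add: shapes_within_def)
  define s where "s = beta N r"
  define W where "W b g = 1 - a\<^sup>2 / (of_nat (b - g))\<^sup>2" for b g :: nat
  have W0: "W b g \<noteq> 0" if "g < b" for b g
  proof -
    have "a + of_nat (b - g) - of_nat 0 \<noteq> 0" "a + of_nat 0 - of_nat (b - g) \<noteq> 0" using nz by blast+
    moreover have "of_nat (b - g) \<noteq> (0 :: rat)" using that by simp
    ultimately show ?thesis by (simp add: W_def power2_eq_iff)
  qed
  have less: "s j < s i" if "i < j" "j < N" for i j
    using beta_less[OF sh that] by (simp add: s_def)
  have a0: "a \<noteq> 0" using nz[of 0 0] by simp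
  let ?c = "\<lambda>i. pochhammer (1 + a) (s i) / fact (s i)" and ?d = "\<lambda>i. pochhammer (1 - a) (s i) / fact (s i)"
  have "fdet N (\<lambda>i j. gram a (- a) (s i) (s j))
      = fdet N (\<lambda>i j. (?c i * a) * ?d j * (1 / ((of_nat (s i) + a) - of_nat (s j))))"
    by (rule fdet_cong) (simp add: gram_neg[OF nz] add_ac)
  also have "\<dots> = (\<Prod>i<N. ?c i * a) * (\<Prod>j<N. ?d j) * fdet N (\<lambda>i j. 1 / ((of_nat (s i) + a) - of_nat (s j)))"
    by (rule fdet_scale)
  also have "fdet N (\<lambda>i j. 1 / ((of_nat (s i) + a) - of_nat (s j))) = (\<Prod>k<N. 1 / a * (\<Prod>i<k. 1 / W (s i) (s k)))"
  proof -
    have pair: "((of_nat (s i) + a) - (of_nat (s k) + a)) / ((of_nat (s i) + a) - of_nat (s k)) *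
        ((of_nat (s k) - of_nat (s i)) / ((of_nat (s k) + a) - of_nat (s i))) = 1 / W (s i) (s k)"
      if "i < k" "k < N" for i k
    proof -
      define \<delta> where "\<delta> = (of_nat (s i - s k) :: rat)"
      have \<delta>: "of_nat (s i) = of_nat (s k) + \<delta>" using less[OF that] by (simp add: \<delta>_def of_nat_diff)
      have "\<delta> \<noteq> 0" using less[OF that] by (simp add: \<delta>_def)
      then have "W (s i) (s k) = (\<delta> + a) * (\<delta> - a) / (\<delta> * \<delta>)"
        unfolding W_def \<delta>_def[symmetric] by (simp add: divide_simps power2_eq_square) (simp add: algebra_simps)
      moreover have "((of_nat (s i) + a) - (of_nat (s k) + a)) / ((of_nat (s i) + a) - of_nat (s k)) *
        ((of_nat (s k) - of_nat (s i)) / ((of_nat (s k) + a) - of_nat (s i))) = \<delta> / (\<delta> + a) * ((- \<delta>) / (- (\<delta> - a)))"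
        unfolding \<delta> by simp
      ultimately show ?thesis unfolding minus_divide_divide by simp
    qed
    have "fdet N (\<lambda>i j. 1 / ((of_nat (s i) + a) - of_nat (s j)))
      = (\<Prod>k<N. 1 / ((of_nat (s k) + a) - of_nat (s k)) * (\<Prod>i<k. ((of_nat (s i) + a) - (of_nat (s k) + a)) / ((of_nat (s i) + a) - of_nat (s k)) *
        ((of_nat (s k) - of_nat (s i)) / ((of_nat (s k) + a) - of_nat (s i)))))"
      by (rule cauchy_determinant) (use nz in \<open>auto simp: algebra_simps\<close>)
    also have "\<dots> = (\<Prod>k<N. 1 / a * (\<Prod>i<k. 1 / W (s i) (s k)))"
      by (intro prod.cong refl arg_cong2[where f = "(*)"] pair) auto
    finally show ?thesis .
  qed
  also have "(\<Prod>i<N. ?c i * a) * (\<Prod>j<N. ?d j) * (\<Prod>k<N. 1 / a * (\<Prod>i<k. 1 / W (s i) (s k)))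
      = (\<Prod>i<N. ?c i * ?d i) * (\<Prod>k<N. \<Prod>i<k. 1 / W (s i) (s k))"
    using a0 by (simp add: prod.distrib prod_dividef)
  \<comment> \<open>Beta numbers decrease, so the factor of a pair i < k must be charged to row i,
    the row of the larger beta number, to cancel there.\<close>
  also have "(\<Prod>k<N. \<Prod>i<k. 1 / W (s i) (s k)) = (\<Prod>i<N. \<Prod>k\<in>{i<..<N}. 1 / W (s i) (s k))"
  proof -
    have "(\<Prod>k<N. \<Prod>i<k. 1 / W (s i) (s k)) = (\<Prod>(k, i)\<in>(SIGMA k:{..<N}. {..<k}). 1 / W (s i) (s k))"
      by (rule prod.Sigma) auto
    also have "\<dots> = (\<Prod>(i, k)\<in>(SIGMA i:{..<N}. {i<..<N}). 1 / W (s i) (s k))"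
      by (rule prod.reindex_bij_witness[where i = "\<lambda>(i, k). (k, i)" and j = "\<lambda>(i, k). (k, i)"]) auto
    also have "\<dots> = (\<Prod>i<N. \<Prod>k\<in>{i<..<N}. 1 / W (s i) (s k))"
      by (rule prod.Sigma[symmetric]) auto
    finally show ?thesis .
  qed
  also have "(\<Prod>i<N. ?c i * ?d i) * (\<Prod>i<N. \<Prod>k\<in>{i<..<N}. 1 / W (s i) (s k))
      = (\<Prod>i<N. (\<Prod>g<s i. W (s i) g) * (\<Prod>k\<in>{i<..<N}. 1 / W (s i) (s k)))"
    by (simp only: pochhammer_square_prod W_def prod.distrib)
  also have "\<dots> = (\<Prod>i<N. \<Prod>g\<in>{..<s i} - beta_set N r. W (s i) g)"
  proof (rule prod.cong)
    fix i assume "i \<in> {..<N}"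
    then have i: "i < N" by simp
    have inter: "{..<s i} \<inter> beta_set N r = s ` {i<..<N}"
      unfolding s_def by (rule beta_set_below[OF sh i])
    have inj: "inj_on s {i<..<N}"
      unfolding s_def by (rule inj_on_subset[OF inj_on_beta[OF sh]]) auto
    have "(\<Prod>g<s i. W (s i) g) = (\<Prod>g\<in>{..<s i} \<inter> beta_set N r. W (s i) g) * (\<Prod>g\<in>{..<s i} - beta_set N r. W (s i) g)"
      by (rule prod.Int_Diff) simp
    also have "(\<Prod>g\<in>{..<s i} \<inter> beta_set N r. W (s i) g) = (\<Prod>k\<in>{i<..<N}. W (s i) (s k))"
      unfolding inter by (simp add: prod.reindex[OF inj])
    finally show "(\<Prod>g<s i. W (s i) g) * (\<Prod>k\<in>{i<..<N}. 1 / W (s i) (s k)) = (\<Prod>g\<in>{..<s i} - beta_set N r. W (s i) g)"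
      using W0 less by (simp add: prod_dividef)
  qed simp
  also have "\<dots> = (\<Prod>b\<in>beta_set N r. \<Prod>g\<in>{..<b} - beta_set N r. W b g)"
    unfolding beta_set_def s_def by (subst prod.reindex[OF inj_on_beta[OF sh]]) (simp add: atLeast0LessThan)
  also have "\<dots> = (\<Prod>(b, g)\<in>hook_pairs (beta_set N r). W b g)"
    unfolding hook_pairs_def by (rule prod.Sigma) auto
  finally show ?thesis by (simp add: s_def W_def)
qed

section \<open>Polynomial interpolation and the Nekrasov--Okounkov formula\<close>

definition poly_fun :: "(rat \<Rightarrow> rat) \<Rightarrow> bool" where
  "poly_fun f \<longleftrightarrow> (\<exists>p. \<forall>x. f x = poly p x)"

lemma poly_funI: "(\<And>x. f x = poly p x) \<Longrightarrow> poly_fun f"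
  by (auto simp: poly_fun_def)

lemma poly_fun_const [intro]: "poly_fun (\<lambda>_. c)"
  by (rule poly_funI[of _ "[:c:]"]) simp

lemma poly_fun_id [intro]: "poly_fun (\<lambda>x. x)"
  by (rule poly_funI[of _ "[:0, 1:]"]) simp

lemma poly_fun_add [intro]: "poly_fun f \<Longrightarrow> poly_fun g \<Longrightarrow> poly_fun (\<lambda>x. f x + g x)"
  unfolding poly_fun_def by (metis poly_add)

lemma poly_fun_mult [intro]: "poly_fun f \<Longrightarrow> poly_fun g \<Longrightarrow> poly_fun (\<lambda>x. f x * g x)"
  unfolding poly_fun_def by (metis poly_mult)

lemma poly_fun_sum [intro]: "(\<And>i. i \<in> A \<Longrightarrow> poly_fun (f i)) \<Longrightarrow> poly_fun (\<lambda>x. \<Sum>i\<in>A. f i x)"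
  by (induction A rule: infinite_finite_induct) auto

lemma poly_fun_prod [intro]: "(\<And>i. i \<in> A \<Longrightarrow> poly_fun (f i)) \<Longrightarrow> poly_fun (\<lambda>x. \<Prod>i\<in>A. f i x)"
  by (induction A rule: infinite_finite_induct) auto

lemma poly_fun_minus [intro]: "poly_fun f \<Longrightarrow> poly_fun (\<lambda>x. - f x)"
  unfolding poly_fun_def by (metis poly_minus)

lemma poly_fun_divide [intro]: "poly_fun f \<Longrightarrow> poly_fun (\<lambda>x. f x / c)"
  using poly_fun_mult[OF _ poly_fun_const, of f "1 / c"] by simp

lemma poly_fun_power [intro]: "poly_fun f \<Longrightarrow> poly_fun (\<lambda>x. f x ^ n)"
  by (induction n) auto

lemma poly_fun_eqI:
  assumes "poly_fun f" "poly_fun g" "infinite X" "\<And>x. x \<in> X \<Longrightarrow> f x = g x"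
  shows "f x = g x"
proof -
  obtain p q where pq: "\<And>x. f x = poly p x" "\<And>x. g x = poly q x"
    using assms by (auto simp: poly_fun_def)
  have "p = q"
  proof (rule ccontr)
    assume "p \<noteq> q"
    then have "finite {x. poly (p - q) x = 0}" by (intro poly_roots_finite) simp
    moreover have "X \<subseteq> {x. poly (p - q) x = 0}" using assms(4) pq by auto
    ultimately show False using assms(3) finite_subset by blast
  qed
  then show ?thesis using pq by simp
qed

lemma infinite_range_of_nat: "infinite (range (of_nat :: nat \<Rightarrow> rat))"
  by (rule range_inj_infinite) (simp add: inj_on_def)

lemma poly_fun_hsym [intro]:
  assumes "poly_fun f"
  shows "poly_fun (\<lambda>x. hsym (f x) i j)"
proof (cases "j \<le> i")
  case True
  have "poly_fun (\<lambda>x. pochhammer (f x) (i - j) / fact (i - j))"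
    unfolding pochhammer_prod by (intro poly_fun_divide poly_fun_prod poly_fun_add poly_fun_const assms)
  then show ?thesis using True by (simp add: hsym_def)
qed (simp add: hsym_def poly_fun_const)

lemma poly_fun_fdet [intro]:
  assumes "\<And>i j. poly_fun (\<lambda>x. F x i j)"
  shows "poly_fun (\<lambda>x. fdet n (F x))"
  unfolding fdet_expand by (intro poly_fun_sum poly_fun_mult poly_fun_prod poly_fun_const assms)

lemma poly_fun_exp_coeff:
  assumes "poly_fun f"
  shows "poly_fun (\<lambda>x. fps_nth (h * (fps_exp (f x) oo g)) n)"
  unfolding fps_mult_nth fps_compose_nth fps_exp_nth
  by (intro poly_fun_sum poly_fun_mult poly_fun_divide poly_fun_power poly_fun_const assms)

abbreviation sigma_fps :: "rat fps" where
  "sigma_fps \<equiv> divisor_fps (\<lambda>k. 1 / of_nat k)"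

text \<open>Interpolation in two rounds: first in b for each natural a, then in a for each rational
  b.\<close>

lemma gram_sum_exp:
  "(\<Sum>r\<in>shapes_of n. fdet n (\<lambda>i j. gram a b (beta n r i) (beta n r j)))
     = fps_nth (shape_fps * (fps_exp (a * b) oo sigma_fps)) n"
proof -
  let ?L = "\<lambda>a b. \<Sum>r\<in>shapes_of n. fdet n (\<lambda>i j. gram a b (beta n r i) (beta n r j))"
  let ?R = "\<lambda>a b. fps_nth (shape_fps * (fps_exp (a * b) oo sigma_fps)) n"
  have nats: "?L (of_nat l) (of_nat m) = ?R (of_nat l) (of_nat m)" for l m
    using pair_count_gram[of n n l m] pair_count_sum[where n = n and a = l and b = m] by simp
  have poly: "poly_fun (\<lambda>x. ?L (f x) (g x))" "poly_fun (\<lambda>x. ?R (f x) (g x))"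
    if "poly_fun f" "poly_fun g" for f g
    unfolding gram_def
    by (intro poly_fun_sum poly_fun_fdet poly_fun_mult poly_fun_hsym poly_fun_exp_coeff that)+
  have right: "?L (of_nat l) b = ?R (of_nat l) b" for l b
    by (rule poly_fun_eqI[OF poly[OF poly_fun_const poly_fun_id] infinite_range_of_nat])
       (auto simp only: nats)
  show ?thesis
    by (rule poly_fun_eqI[OF poly[OF poly_fun_id poly_fun_const] infinite_range_of_nat])
       (auto simp only: right)
qed

text \<open>
  For \<open>a\<close> a half-integer the denominators \<open>a + i - j\<close> in the closed form of \<^const>\<open>gram\<close> do not vanish.
\<close>

theorem nekrasov_okounkov:
  "(\<Sum>r\<in>shapes_of n. \<Prod>(b, g)\<in>hook_pairs (beta_set n r). 1 - z / (of_nat (b - g))\<^sup>2)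
     = fps_nth (shape_fps * (fps_exp (- z) oo sigma_fps)) n"
proof -
  let ?h = "\<lambda>m. of_nat m + 1 / 2 :: rat"
  have nz: "?h m + of_nat i - of_nat j \<noteq> 0" for m i j
  proof
    assume "?h m + of_nat i - of_nat j = 0"
    then have "2 * (of_nat (m + i) :: rat) + 1 = 2 * of_nat j" by simp
    then have "of_nat (2 * (m + i) + 1) = (of_nat (2 * j) :: rat)" by simp
    then have "2 * (m + i) + 1 = 2 * j" by (simp only: of_nat_eq_iff)
    then show False by presburger
  qed
  have half: "(\<Sum>r\<in>shapes_of n. \<Prod>(b, g)\<in>hook_pairs (beta_set n r). 1 - (?h m)\<^sup>2 / (of_nat (b - g))\<^sup>2)
     = fps_nth (shape_fps * (fps_exp (- (?h m)\<^sup>2) oo sigma_fps)) n" for m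
  proof -
    have "(\<Sum>r\<in>shapes_of n. \<Prod>(b, g)\<in>hook_pairs (beta_set n r). 1 - (?h m)\<^sup>2 / (of_nat (b - g))\<^sup>2)
        = (\<Sum>r\<in>shapes_of n. fdet n (\<lambda>i j. gram (?h m) (- ?h m) (beta n r i) (beta n r j)))"
    proof (rule sum.cong)
      fix r assume "r \<in> shapes_of n"
      then have "r \<in> shapes_within n" using shapes_window by (auto simp: shapes_of_def shapes_within_def)
      then show "(\<Prod>(b, g)\<in>hook_pairs (beta_set n r). 1 - (?h m)\<^sup>2 / (of_nat (b - g))\<^sup>2)
        = fdet n (\<lambda>i j. gram (?h m) (- ?h m) (beta n r i) (beta n r j))"
        by (rule fdet_gram_neg[OF nz, symmetric])
    qed simp
    then show ?thesis unfolding gram_sum_exp by (simp only: power2_eq_square mult_minus_right)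
  qed
  \<comment> \<open>The squares of the half-integers are infinitely many values of z, enough to
    determine a polynomial in z.\<close>
  have "inj (\<lambda>m. (?h m)\<^sup>2)"
  proof (rule injI)
    fix m m' assume "(?h m)\<^sup>2 = (?h m')\<^sup>2"
    then have "?h m = ?h m'" by (rule power2_eq_imp_eq) simp_all
    then show "m = m'" by simp
  qed
  then have inf: "infinite (range (\<lambda>m. (?h m)\<^sup>2))" by (rule range_inj_infinite)
  have factor: "poly_fun (\<lambda>z. 1 - z / c)" for c
    using poly_fun_add[OF poly_fun_const[of 1] poly_fun_minus[OF poly_fun_divide[OF poly_fun_id]], of c] by simp
  show ?thesis
  proof (rule poly_fun_eqI[OF _ _ inf, where x = z and
        f = "\<lambda>z. \<Sum>r\<in>shapes_of n. \<Prod>(b, g)\<in>hook_pairs (beta_set n r). 1 - z / (of_nat (b - g))\<^sup>2" and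
        g = "\<lambda>z. fps_nth (shape_fps * (fps_exp (- z) oo sigma_fps)) n"])
    show "poly_fun (\<lambda>z. \<Sum>r\<in>shapes_of n. \<Prod>(b, g)\<in>hook_pairs (beta_set n r). 1 - z / (of_nat (b - g))\<^sup>2)"
      unfolding case_prod_unfold by (intro poly_fun_sum poly_fun_prod factor)
    show "poly_fun (\<lambda>z. fps_nth (shape_fps * (fps_exp (- z) oo sigma_fps)) n)"
      by (intro poly_fun_exp_coeff poly_fun_minus poly_fun_id)
  qed (use half in blast)
qed

section \<open>Hooks and beta numbers\<close>

definition shape_of :: "nat list \<Rightarrow> nat \<Rightarrow> nat" where
  "shape_of \<mu> i = (if i < length \<mu> then \<mu> ! i else 0)"

lemma shape_of_nonzero:
  assumes "\<mu> \<in> partitions n"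
  shows "shape_of \<mu> i \<noteq> 0 \<longleftrightarrow> i < length \<mu>"
proof -
  have "1 \<le> \<mu> ! i" if "i < length \<mu>" using assms nth_mem[OF that] by (auto simp: partitions_def)
  then show ?thesis by (auto simp: shape_of_def)
qed

lemma shape_of_mem:
  assumes "\<mu> \<in> partitions n"
  shows "shape_of \<mu> \<in> shapes_of n"
proof -
  have "shape_of \<mu> (Suc i) \<le> shape_of \<mu> i" for i
    using assms by (auto simp: partitions_def shape_of_def sorted_wrt_iff_nth_less)
  then have "antimono (shape_of \<mu>)" by (intro decseq_Suc_iff[THEN iffD2] allI)
  moreover have "finite {i. shape_of \<mu> i \<noteq> 0}" unfolding shape_of_nonzero[OF assms] by simp
  moreover have "wt (shape_of \<mu>) = n"
  proof -
    have "wt (shape_of \<mu>) = (\<Sum>i<length \<mu>. shape_of \<mu> i)" by (rule wt_window) (simp add: shape_of_def)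
    also have "\<dots> = sum_list \<mu>" by (simp add: sum_list_sum_nth shape_of_def atLeast0LessThan)
    finally show ?thesis using assms by (simp add: partitions_def)
  qed
  ultimately show ?thesis by (simp add: shapes_of_def shapes_def)
qed

lemma bij_betw_shape_of: "bij_betw shape_of (partitions n) (shapes_of n)"
proof (rule bij_betw_imageI)
  show "inj_on shape_of (partitions n)"
  proof (rule inj_onI)
    fix \<mu> \<nu> assume *: "\<mu> \<in> partitions n" "\<nu> \<in> partitions n" "shape_of \<mu> = shape_of \<nu>"
    have "i < length \<mu> \<longleftrightarrow> i < length \<nu>" for i
      using shape_of_nonzero[OF *(1), of i] shape_of_nonzero[OF *(2), of i] *(3) by simp
    then have len: "length \<mu> = length \<nu>" by (metis linorder_neqE_nat less_irrefl)
    then show "\<mu> = \<nu>"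
    proof (rule nth_equalityI)
      fix i assume "i < length \<mu>"
      then show "\<mu> ! i = \<nu> ! i" using fun_cong[OF *(3), of i] len by (simp add: shape_of_def)
    qed
  qed
  show "shape_of ` partitions n = shapes_of n"
  proof
    show "shape_of ` partitions n \<subseteq> shapes_of n" using shape_of_mem by blast
    show "shapes_of n \<subseteq> shape_of ` partitions n"
    proof
      fix f assume f: "f \<in> shapes_of n"
      then have sh: "f \<in> shapes" and wt: "wt f = n" by (auto simp: shapes_of_def)
      define l where "l = (LEAST i. f i = 0)"
      have "f (wt f) = 0" by (rule shapes_window[OF sh]) simp
      then have l0: "f l = 0" unfolding l_def by (rule LeastI)
      have zero: "f i = 0" if "i \<ge> l" for i using shapes_antimono[OF sh that] l0 by simp
      have pos: "f i \<noteq> 0" if "i < l" for i using not_less_Least that unfolding l_def by blast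
      define \<mu> where "\<mu> = map f [0..<l]"
      have "sorted_wrt (\<ge>) \<mu>"
        using shapes_antimono[OF sh] by (simp add: \<mu>_def sorted_wrt_iff_nth_less)
      moreover have "\<forall>p\<in>set \<mu>. 1 \<le> p" using pos by (auto simp: \<mu>_def Suc_le_eq)
      moreover have "sum_list \<mu> = n"
      proof -
        have "sum_list \<mu> = (\<Sum>i<l. f i)" by (simp add: \<mu>_def sum_list_sum_nth atLeast0LessThan)
        then show ?thesis using wt_window[of l f] zero wt by simp
      qed
      moreover have "shape_of \<mu> = f" using zero by (auto simp: shape_of_def \<mu>_def)
      ultimately show "f \<in> shape_of ` partitions n" by (auto simp: partitions_def image_iff)
    qed
  qed
qed

text \<open>Rows weakly decrease, so those with at least j boxes form an initial segment, whose
  length is the conjugate part.\<close>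

lemma less_conjugate_part:
  assumes "\<mu> \<in> partitions n" "1 \<le> j"
  shows "i < conjugate_part \<mu> j \<longleftrightarrow> j \<le> shape_of \<mu> i"
proof -
  have sh: "shape_of \<mu> \<in> shapes" using shape_of_mem[OF assms(1)] by (simp add: shapes_of_def)
  define m where "m = (LEAST i. shape_of \<mu> i < j)"
  have "shape_of \<mu> (length \<mu>) < j" using assms(2) by (simp add: shape_of_def)
  then have m: "shape_of \<mu> m < j" unfolding m_def by (rule LeastI)
  have iff: "j \<le> shape_of \<mu> i \<longleftrightarrow> i < m" for i
  proof
    assume "j \<le> shape_of \<mu> i"
    then have "\<not> m \<le> i" using shapes_antimono[OF sh, of m i] m by linarith
    then show "i < m" by simp
  next
    assume "i < m"
    then show "j \<le> shape_of \<mu> i" unfolding m_def by (auto dest: not_less_Least)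
  qed
  have "{k \<in> {1..length \<mu>}. part \<mu> k \<ge> j} = Suc ` {..<m}"
  proof
    show "{k \<in> {1..length \<mu>}. part \<mu> k \<ge> j} \<subseteq> Suc ` {..<m}"
    proof
      fix k assume "k \<in> {k \<in> {1..length \<mu>}. part \<mu> k \<ge> j}"
      then have "k = Suc (k - 1)" "j \<le> shape_of \<mu> (k - 1)" by (auto simp: part_def shape_of_def)
      then show "k \<in> Suc ` {..<m}" using iff by (metis image_eqI lessThan_iff)
    qed
    show "Suc ` {..<m} \<subseteq> {k \<in> {1..length \<mu>}. part \<mu> k \<ge> j}"
    proof (rule image_subsetI)
      fix i assume "i \<in> {..<m}"
      then have i: "j \<le> shape_of \<mu> i" using iff by simp
      then have "i < length \<mu>" using assms(2) by (auto simp: shape_of_def split: if_splits)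
      then show "Suc i \<in> {k \<in> {1..length \<mu>}. part \<mu> k \<ge> j}" using i by (simp add: part_def shape_of_def)
    qed
  qed
  then have "conjugate_part \<mu> j = m" by (simp add: conjugate_part_def card_image)
  then show ?thesis using iff by simp
qed

text \<open>Row i corresponds to its beta number and column j to the missing number
  \<open>gap j\<close>; their difference is arm + leg + 1, the hook length of the box.\<close>

lemma sum_hooks:
  assumes \<mu>: "\<mu> \<in> partitions n" and len: "length \<mu> \<le> N"
  shows "(\<Sum>v\<in>boxes \<mu>. F (hook_length \<mu> v))
       = (\<Sum>(b, g)\<in>hook_pairs (beta_set N (shape_of \<mu>)). F (b - g) :: 'a :: comm_monoid_add)"
proof -
  define f where "f = shape_of \<mu>"
  define c where "c = conjugate_part \<mu>"
  \<comment> \<open>For the columns of a nonempty row, the missing numbers below its beta number in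
    increasing order; column j is empty from row c(j) on, which accounts for the shift.\<close>
  define gap where "gap j = N + j - 1 - c j" for j
  have sh: "f \<in> shapes" using shape_of_mem[OF \<mu>] by (simp add: f_def shapes_of_def)
  let ?S = "beta_set N f"
  have cf: "i < c j \<longleftrightarrow> j \<le> f i" if "1 \<le> j" for i j
    using less_conjugate_part[OF \<mu> that] by (simp add: c_def f_def)
  have cN: "c j \<le> N" if "1 \<le> j" for j
  proof (rule ccontr)
    assume "\<not> c j \<le> N"
    then have "j \<le> f N" using cf[OF that, of N] by simp
    then show False using len that by (simp add: f_def shape_of_def)
  qed
  have diff: "gap j < beta N f i \<and> beta N f i - gap j = (f i - j) + (c j - Suc i) + 1"
    if "i < N" "1 \<le> j" "j \<le> f i" for i j
  proof -
    have "i < c j" "c j \<le> N" using that cf[of j i] cN[of j] by simp_all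
    then show ?thesis unfolding gap_def beta_def using that by (intro conjI; linarith)
  qed
  have notin: "gap j \<notin> ?S" if "1 \<le> j" for j
  proof
    assume "gap j \<in> ?S"
    then obtain k where k: "k < N" "gap j = beta N f k" by (auto simp: beta_set_def)
    have "N + j - 1 - c j = f k + (N - Suc k)" using k(2) unfolding gap_def beta_def .
    then show False using k(1) cf[OF that, of k] cN[OF that] that by linarith
  qed
  have gap_less: "gap j < gap j'" if "1 \<le> j" "j < j'" for j j'
  proof -
    have "c j' \<le> c j"
    proof (rule ccontr)
      assume "\<not> c j' \<le> c j"
      then have "j' \<le> f (c j)" using cf[of j' "c j"] that by simp
      then show False using cf[of j "c j"] that by simp
    qed
    then show ?thesis using that cN[of j] by (simp add: gap_def)
  qed
  have inj: "inj_on gap {1..m}" for m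
  proof (rule inj_onI)
    fix j j' assume "j \<in> {1..m}" "j' \<in> {1..m}" "gap j = gap j'"
    then show "j = j'" using gap_less[of j j'] gap_less[of j' j] by (cases j j' rule: linorder_cases) auto
  qed
  \<comment> \<open>Surjectivity by counting: N - i - 1 of the numbers below the i-th beta number
    are beta numbers, which leaves f(i) missing ones, as many as row i has boxes.\<close>
  have row: "bij_betw gap {1..f i} ({..<beta N f i} - ?S)" if "i < N" for i
    unfolding bij_betw_def
  proof
    show "inj_on gap {1..f i}" by (rule inj)
    have "card ({..<beta N f i} - ?S) = beta N f i - card ({..<beta N f i} \<inter> ?S)"
      by (simp add: card_Diff_subset_Int)
    also have "card ({..<beta N f i} \<inter> ?S) = N - Suc i"
    proof -
      have "inj_on (beta N f) {i<..<N}" by (rule inj_on_subset[OF inj_on_beta[OF sh]]) auto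
      then show ?thesis unfolding beta_set_below[OF sh that] by (simp add: card_image)
    qed
    also have "beta N f i - (N - Suc i) = f i" by (simp add: beta_def)
    finally have "card ({..<beta N f i} - ?S) = f i" .
    moreover have "gap ` {1..f i} \<subseteq> {..<beta N f i} - ?S"
      using diff[OF that] notin by auto
    moreover have "card (gap ` {1..f i}) = f i" using card_image[OF inj, of "f i"] by simp
    ultimately show "gap ` {1..f i} = {..<beta N f i} - ?S"
      by (intro card_subset_eq) simp_all
  qed
  have "(\<Sum>v\<in>boxes \<mu>. F (hook_length \<mu> v)) = (\<Sum>i\<in>{1..length \<mu>}. \<Sum>j\<in>{1..part \<mu> i}. F (hook_length \<mu> (i, j)))"
    unfolding boxes_def by (subst sum.Sigma) (auto simp: case_prod_unfold)
  also have "\<dots> = (\<Sum>i<length \<mu>. \<Sum>j\<in>{1..f i}. F (hook_length \<mu> (Suc i, j)))"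
    by (rule sum.reindex_bij_witness[where i = Suc and j = "\<lambda>i. i - 1"])
       (auto simp: part_def f_def shape_of_def)
  also have "\<dots> = (\<Sum>i<N. \<Sum>j\<in>{1..f i}. F (hook_length \<mu> (Suc i, j)))"
    by (rule sum.mono_neutral_left) (use len in \<open>auto simp: f_def shape_of_def\<close>)
  also have "\<dots> = (\<Sum>i<N. \<Sum>g\<in>{..<beta N f i} - ?S. F (beta N f i - g))"
  proof (rule sum.cong)
    fix i assume "i \<in> {..<N}"
    then have i: "i < N" by simp
    have "(\<Sum>g\<in>{..<beta N f i} - ?S. F (beta N f i - g)) = (\<Sum>j\<in>{1..f i}. F (beta N f i - gap j))"
      by (rule sum.reindex_bij_betw[OF row[OF i], symmetric])
    also have "\<dots> = (\<Sum>j\<in>{1..f i}. F (hook_length \<mu> (Suc i, j)))"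
    proof (rule sum.cong)
      fix j assume j: "j \<in> {1..f i}"
      then have "i < length \<mu>" by (auto simp: f_def shape_of_def split: if_splits)
      then have "part \<mu> (Suc i) = f i" by (simp add: part_def f_def shape_of_def)
      then show "F (beta N f i - gap j) = F (hook_length \<mu> (Suc i, j))"
        using diff[OF i] j by (simp add: hook_length_def c_def)
    qed simp
    finally show "(\<Sum>j\<in>{1..f i}. F (hook_length \<mu> (Suc i, j))) = (\<Sum>g\<in>{..<beta N f i} - ?S. F (beta N f i - g))" ..
  qed simp
  also have "\<dots> = (\<Sum>b\<in>?S. \<Sum>g\<in>{..<b} - ?S. F (b - g))"
    unfolding beta_set_def by (subst sum.reindex[OF inj_on_beta[OF sh]]) (simp add: atLeast0LessThan)
  also have "\<dots> = (\<Sum>(b, g)\<in>hook_pairs ?S. F (b - g))"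
    unfolding hook_pairs_def by (rule sum.Sigma) auto
  finally show ?thesis by (simp add: f_def)
qed

section \<open>Counting hooks of a given length\<close>

definition hook_count :: "nat \<Rightarrow> nat set \<Rightarrow> nat" where
  "hook_count k S = card {b \<in> S. k \<le> b \<and> b - k \<notin> S}"

lemma sum_hook_pairs:
  assumes "finite S" "S \<subseteq> {..M}"
  shows "(\<Sum>(b, g)\<in>hook_pairs S. F (b - g)) = (\<Sum>k\<in>{1..M}. of_nat (hook_count k S) * F k :: 'a :: comm_semiring_1)"
proof -
  have fin: "finite (hook_pairs S)" using assms(1) by (simp add: hook_pairs_def)
  have img: "(\<lambda>(b, g). b - g) ` hook_pairs S \<subseteq> {1..M}"
  proof (rule image_subsetI)
    fix x assume "x \<in> hook_pairs S"
    then obtain b g where x: "x = (b, g)" "b \<in> S" "g < b" by (auto simp: hook_pairs_def)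
    then have "b \<le> M" using assms(2) by auto
    then have "1 \<le> b - g \<and> b - g \<le> M" using x(3) by linarith
    then show "(\<lambda>(b, g). b - g) x \<in> {1..M}" using x(1) by simp
  qed
  have "(\<Sum>(b, g)\<in>hook_pairs S. F (b - g))
      = (\<Sum>k\<in>{1..M}. \<Sum>x\<in>{x \<in> hook_pairs S. (\<lambda>(b, g). b - g) x = k}. (\<lambda>(b, g). F (b - g)) x)"
    by (rule sum.group[OF fin _ img, symmetric]) simp
  also have "\<dots> = (\<Sum>k\<in>{1..M}. of_nat (hook_count k S) * F k)"
  proof (rule sum.cong)
    fix k assume k: "k \<in> {1..M}"
    have "bij_betw fst {x \<in> hook_pairs S. (\<lambda>(b, g). b - g) x = k} {b \<in> S. k \<le> b \<and> b - k \<notin> S}"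
      by (rule bij_betw_byWitness[where f' = "\<lambda>b. (b, b - k)"]) (use k in \<open>auto simp: hook_pairs_def\<close>)
    then have "card {x \<in> hook_pairs S. (\<lambda>(b, g). b - g) x = k} = hook_count k S"
      unfolding hook_count_def by (rule bij_betw_same_card)
    moreover have "(\<Sum>x\<in>{x \<in> hook_pairs S. (\<lambda>(b, g). b - g) x = k}. (\<lambda>(b, g). F (b - g)) x)
        = (\<Sum>x\<in>{x \<in> hook_pairs S. (\<lambda>(b, g). b - g) x = k}. F k)"
      by (rule sum.cong) auto
    ultimately show "(\<Sum>x\<in>{x \<in> hook_pairs S. (\<lambda>(b, g). b - g) x = k}. (\<lambda>(b, g). F (b - g)) x)
        = of_nat (hook_count k S) * F k" by simp
  qed simp
  finally show ?thesis .
qed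

text \<open>For n <= N, the beta sets of the partitions of n. Cardinality and sum characterise them,
  so that moving one element by k visibly changes n by k.\<close>

definition beta_sets :: "nat \<Rightarrow> nat \<Rightarrow> nat set set" where
  "beta_sets N n = {S. finite S \<and> card S = N \<and> \<Sum>S = n + (\<Sum>i<N. i)}"

lemma sum_beta_set:
  assumes "f \<in> shapes_within N"
  shows "\<Sum>(beta_set N f) = wt f + (\<Sum>i<N. i)"
proof -
  have sh: "f \<in> shapes" and z: "\<And>i. i \<ge> N \<Longrightarrow> f i = 0" using assms by (auto simp: shapes_within_def)
  have "\<Sum>(beta_set N f) = (\<Sum>i<N. beta N f i)"
    unfolding beta_set_def by (subst sum.reindex[OF inj_on_beta[OF sh]]) (simp add: atLeast0LessThan)
  also have "\<dots> = (\<Sum>i<N. f i) + (\<Sum>i<N. N - Suc i)" unfolding beta_def by (rule sum.distrib)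
  also have "(\<Sum>i<N. N - Suc i) = (\<Sum>i<N. i)" by (rule sum.nat_diff_reindex)
  finally show ?thesis using wt_window[OF z] by simp
qed

lemma bij_betw_beta_sets:
  assumes "n \<le> N"
  shows "bij_betw (beta_set N) (shapes_of n) (beta_sets N n)"
proof -
  have sub: "shapes_of n \<subseteq> shapes_within N"
    using shapes_window assms by (auto simp: shapes_of_def shapes_within_def)
  have "beta_set N ` shapes_of n = beta_sets N n"
  proof
    show "beta_set N ` shapes_of n \<subseteq> beta_sets N n"
      using sub by (auto simp: beta_sets_def sum_beta_set shapes_of_def card_beta_set)
    show "beta_sets N n \<subseteq> beta_set N ` shapes_of n"
    proof
      fix S assume S: "S \<in> beta_sets N n"
      then have "S \<in> beta_set N ` shapes_within N"
        unfolding bij_betw_imp_surj_on[OF bij_betw_beta_set] by (simp add: beta_sets_def)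
      then obtain f where f: "f \<in> shapes_within N" "S = beta_set N f" by auto
      then have "wt f = n" using S sum_beta_set[OF f(1)] by (simp add: beta_sets_def)
      then have "f \<in> shapes_of n" using f(1) by (simp add: shapes_of_def shapes_within_def)
      then show "S \<in> beta_set N ` shapes_of n" using f(2) by blast
    qed
  qed
  then show ?thesis by (rule bij_betw_subset[OF bij_betw_beta_set sub])
qed

text \<open>The excess over the staircase is the weight of a shape. It rules out k-hooks in
  partitions of n < k.\<close>

lemma sum_le_sum_finite_set: "finite S \<Longrightarrow> (\<Sum>i<card S. i) \<le> \<Sum>S" for S :: "nat set"
proof -
  assume fin: "finite S"
  then have "S \<in> beta_set (card S) ` shapes_within (card S)"
    unfolding bij_betw_imp_surj_on[OF bij_betw_beta_set] by simp
  then obtain f where "f \<in> shapes_within (card S)" "S = beta_set (card S) f" by auto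
  then show ?thesis using sum_beta_set[of f "card S"] by simp
qed

text \<open>The last k of the N rows are empty and carry the beta numbers k-1, ..., 0.\<close>

lemma beta_sets_initial:
  assumes "S \<in> beta_sets N n" "n + k \<le> N"
  shows "{..<k} \<subseteq> S"
proof
  fix x assume x: "x \<in> {..<k}"
  obtain f where f: "f \<in> shapes_of n" "S = beta_set N f"
    using bij_betw_imp_surj_on[OF bij_betw_beta_sets[of n N]] assms by auto
  have "f (N - Suc x) = 0"
    by (rule shapes_window) (use f(1) assms x in \<open>auto simp: shapes_of_def\<close>)
  then have "beta N f (N - Suc x) = x" using x assms(2) by (simp add: beta_def)
  moreover have "N - Suc x \<in> {0..<N}" using x assms(2) by simp
  ultimately show "x \<in> S" unfolding f(2) beta_set_def by (metis imageI)
qed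

lemma finite_beta_sets: "n \<le> N \<Longrightarrow> finite (beta_sets N n)"
  using bij_betw_finite[OF bij_betw_beta_sets] finite_shapes_of by blast

lemma card_beta_sets: "n \<le> N \<Longrightarrow> card (beta_sets N n) = card (shapes_of n)"
  using bij_betw_same_card[OF bij_betw_beta_sets] by simp

text \<open>Elements whose upward shift by k is occupied are as many as those whose downward shift
  is. The difference comes from the k elements below k, which cannot move down at all.\<close>

lemma card_addable:
  fixes S :: "nat set"
  assumes "finite S" "{..<k} \<subseteq> S"
  shows "card {c \<in> S. c + k \<notin> S} = hook_count k S + k"
proof -
  have "card S = card {c \<in> S. c + k \<notin> S} + card {c \<in> S. c + k \<in> S}"
    using assms(1) by (subst card_Un_disjoint[symmetric]) (auto intro!: arg_cong[where f = card])
  moreover have "card S = hook_count k S + card {b \<in> S. k \<le> b \<and> b - k \<in> S} + card {..<k}"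
  proof -
    have "S = {b \<in> S. k \<le> b \<and> b - k \<notin> S} \<union> {b \<in> S. k \<le> b \<and> b - k \<in> S} \<union> {..<k}"
      using assms(2) by auto
    then have "card S = card ({b \<in> S. k \<le> b \<and> b - k \<notin> S} \<union> {b \<in> S. k \<le> b \<and> b - k \<in> S} \<union> {..<k})"
      by simp
    also have "\<dots> = card ({b \<in> S. k \<le> b \<and> b - k \<notin> S} \<union> {b \<in> S. k \<le> b \<and> b - k \<in> S}) + card {..<k}"
      by (rule card_Un_disjoint) (use assms(1) in auto)
    also have "card ({b \<in> S. k \<le> b \<and> b - k \<notin> S} \<union> {b \<in> S. k \<le> b \<and> b - k \<in> S})
        = hook_count k S + card {b \<in> S. k \<le> b \<and> b - k \<in> S}"
      unfolding hook_count_def by (rule card_Un_disjoint) (use assms(1) in auto)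
    finally show ?thesis .
  qed
  moreover have "card {b \<in> S. k \<le> b \<and> b - k \<in> S} = card {c \<in> S. c + k \<in> S}"
    by (rule bij_betw_same_card[of "\<lambda>b. b - k"], rule bij_betw_byWitness[where f' = "\<lambda>c. c + k"]) auto
  ultimately show ?thesis by simp
qed

text \<open>
  Removing a \<open>k\<close>-hook is the same as moving a beta number down by \<open>k\<close>, and every partition has
  exactly \<open>k\<close> more ways of adding a \<open>k\<close>-ribbon than of removing one.
\<close>

lemma sum_hook_count_eq:
  assumes "1 \<le> k" "n \<le> N"
  shows "(\<Sum>S\<in>beta_sets N n. hook_count k S)
       = (if n < k then 0 else (\<Sum>S\<in>beta_sets N (n - k). hook_count k S) + k * card (shapes_of (n - k)))"
proof -
  let ?rem = "SIGMA S:beta_sets N n. {b \<in> S. k \<le> b \<and> b - k \<notin> S}"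
  have fin: "finite S" if "S \<in> beta_sets N m" for S m using that by (simp add: beta_sets_def)
  have lhs: "(\<Sum>S\<in>beta_sets N n. hook_count k S) = card ?rem"
    unfolding hook_count_def using fin finite_beta_sets[OF assms(2)] by (subst card_SigmaI) auto
  \<comment> \<open>Stated with + k on the left, so that it also yields the contradiction when n <
    k.\<close>
  have move: "finite (insert (b - k) (S - {b})) \<and> card (insert (b - k) (S - {b})) = N
      \<and> \<Sum>(insert (b - k) (S - {b})) + k = n + (\<Sum>i<N. i)"
    if "S \<in> beta_sets N n" "b \<in> S" "k \<le> b" "b - k \<notin> S" for S b
  proof -
    have S: "finite S" "card S = N" "\<Sum>S = n + (\<Sum>i<N. i)" using that by (auto simp: beta_sets_def)
    have "0 < card S" using S(1) that(2) card_gt_0_iff by blast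
    then have "card (insert (b - k) (S - {b})) = N" using S that by (simp add: card_Diff_singleton)
    moreover have "\<Sum>(insert (b - k) (S - {b})) + k = \<Sum>S"
      using S(1) that sum.remove[OF S(1) that(2), of "\<lambda>x. x"] by simp
    ultimately show ?thesis using S by simp
  qed
  show ?thesis
  proof (cases "n < k")
    case True
    have "?rem = {}"
    proof (rule equals0I)
      fix x assume "x \<in> ?rem"
      then obtain S b where "S \<in> beta_sets N n" "b \<in> S" "k \<le> b" "b - k \<notin> S" by auto
      from move[OF this] sum_le_sum_finite_set[of "insert (b - k) (S - {b})"] True show False by auto
    qed
    then show ?thesis using lhs True by simp
  next
    case False
    let ?add = "SIGMA T:beta_sets N (n - k). {c \<in> T. c + k \<notin> T}"
    have "bij_betw (\<lambda>(S, b). (insert (b - k) (S - {b}), b - k)) ?rem ?add"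
    proof (rule bij_betw_byWitness[where f' = "\<lambda>(T, c). (insert (c + k) (T - {c}), c + k)"])
      show "\<forall>x\<in>?rem. (\<lambda>(T, c). (insert (c + k) (T - {c}), c + k)) ((\<lambda>(S, b). (insert (b - k) (S - {b}), b - k)) x) = x"
        using assms(1) by auto
      show "\<forall>x\<in>?add. (\<lambda>(S, b). (insert (b - k) (S - {b}), b - k)) ((\<lambda>(T, c). (insert (c + k) (T - {c}), c + k)) x) = x"
        using assms(1) by auto
      show "(\<lambda>(S, b). (insert (b - k) (S - {b}), b - k)) ` ?rem \<subseteq> ?add"
      proof (rule image_subsetI)
        fix x assume "x \<in> ?rem"
        then obtain S b where x: "x = (S, b)" and Sb: "S \<in> beta_sets N n" "b \<in> S" "k \<le> b" "b - k \<notin> S" by auto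
        note m = move[OF Sb]
        have "\<Sum>(insert (b - k) (S - {b})) = n - k + (\<Sum>i<N. i)"
          using m[THEN conjunct2, THEN conjunct2] False by linarith
        then have "insert (b - k) (S - {b}) \<in> beta_sets N (n - k)"
          using m by (simp add: beta_sets_def)
        then show "(\<lambda>(S, b). (insert (b - k) (S - {b}), b - k)) x \<in> ?add"
          using Sb assms(1) by (simp add: x)
      qed
      show "(\<lambda>(T, c). (insert (c + k) (T - {c}), c + k)) ` ?add \<subseteq> ?rem"
      proof (rule image_subsetI)
        fix x assume "x \<in> ?add"
        then obtain T c where x: "x = (T, c)" and Tc: "T \<in> beta_sets N (n - k)" "c \<in> T" "c + k \<notin> T" by auto
        have T: "finite T" "card T = N" "\<Sum>T = n - k + (\<Sum>i<N. i)" using Tc by (auto simp: beta_sets_def)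
        have "0 < card T" using T(1) Tc(2) card_gt_0_iff by blast
        then have "card (insert (c + k) (T - {c})) = N" using T Tc by (simp add: card_Diff_singleton)
        moreover have "\<Sum>(insert (c + k) (T - {c})) = \<Sum>T + k"
          using T(1) Tc sum.remove[OF T(1) Tc(2), of "\<lambda>x. x"] by simp
        ultimately have "insert (c + k) (T - {c}) \<in> beta_sets N n"
          using T False by (simp add: beta_sets_def)
        then show "(\<lambda>(T, c). (insert (c + k) (T - {c}), c + k)) x \<in> ?rem"
          using Tc assms(1) by (simp add: x)
      qed
    qed
    then have "card ?rem = card ?add" by (rule bij_betw_same_card)
    also have "\<dots> = (\<Sum>T\<in>beta_sets N (n - k). card {c \<in> T. c + k \<notin> T})"
      using fin finite_beta_sets[of "n - k" N] assms(2) by (subst card_SigmaI) auto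
    also have "\<dots> = (\<Sum>T\<in>beta_sets N (n - k). hook_count k T + k)"
    proof (rule sum.cong)
      fix T assume T: "T \<in> beta_sets N (n - k)"
      have "{..<k} \<subseteq> T" by (rule beta_sets_initial[OF T]) (use assms(2) False in simp)
      then show "card {c \<in> T. c + k \<notin> T} = hook_count k T + k" using card_addable fin[OF T] by blast
    qed simp
    also have "\<dots> = (\<Sum>S\<in>beta_sets N (n - k). hook_count k S) + k * card (shapes_of (n - k))"
      using assms(2) by (simp add: sum.distrib card_beta_sets)
    finally show ?thesis using lhs False by simp
  qed
qed

text \<open>The series x^k / (1 - x^k).\<close>

definition multiples_fps :: "nat \<Rightarrow> rat fps" where
  "multiples_fps k = Abs_fps (\<lambda>i. if 0 < i \<and> k dvd i then 1 else 0)"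

lemma multiples_fps_eq:
  assumes "1 \<le> k"
  shows "multiples_fps k = fps_X ^ k * (1 + multiples_fps k)"
proof (rule fps_ext)
  fix i
  show "fps_nth (multiples_fps k) i = fps_nth (fps_X ^ k * (1 + multiples_fps k)) i"
  proof (cases "i < k")
    case True
    then show ?thesis by (auto simp: multiples_fps_def fps_X_power_mult_nth dest: dvd_imp_le)
  next
    case False
    then obtain m where "i = k + m" using le_Suc_ex not_less by blast
    then show ?thesis using assms by (auto simp: multiples_fps_def fps_X_power_mult_nth)
  qed
qed

text \<open>Iterating the recurrence: the partitions of n have together k times p(n-k) + p(n-2k) +
  ... hooks of length k, where p counts partitions.\<close>

lemma sum_hook_count:
  assumes "1 \<le> k" "n \<le> N"
  shows "of_nat (\<Sum>S\<in>beta_sets N n. hook_count k S) = of_nat k * fps_nth (shape_fps * multiples_fps k) n"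
  using assms(2)
proof (induction n rule: less_induct)
  case (less n)
  have "shape_fps * multiples_fps k = fps_X ^ k * (shape_fps + shape_fps * multiples_fps k)"
    by (subst multiples_fps_eq[OF assms(1)]) (simp add: algebra_simps)
  then have *: "fps_nth (shape_fps * multiples_fps k) n
      = (if n < k then 0 else fps_nth shape_fps (n - k) + fps_nth (shape_fps * multiples_fps k) (n - k))"
    by (metis fps_X_power_mult_nth fps_add_nth)
  show ?case
  proof (cases "n < k")
    case True
    then show ?thesis unfolding * sum_hook_count_eq[OF assms(1) less.prems] by simp
  next
    case False
    then have "of_nat (\<Sum>S\<in>beta_sets N (n - k). hook_count k S)
        = of_nat k * fps_nth (shape_fps * multiples_fps k) (n - k)"
      using assms(1) less.prems by (intro less.IH) auto
    then show ?thesis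
      unfolding * sum_hook_count_eq[OF assms(1) less.prems] using False
      by (simp add: shape_fps_def algebra_simps)
  qed
qed

theorem sum_over_hooks:
  "(\<Sum>r\<in>shapes_of n. \<Sum>(b, g)\<in>hook_pairs (beta_set n r). F (b - g))
     = fps_nth (shape_fps * divisor_fps (\<lambda>k. of_nat k * F k)) n"
proof -
  \<comment> \<open>A crude bound on beta numbers: no element of a set exceeds its sum.\<close>
  define M where "M = n + n + (\<Sum>i<n. i)"
  have bound: "S \<subseteq> {..M}" if "S \<in> beta_sets n n" for S
  proof
    fix x assume "x \<in> S"
    then have "x \<le> \<Sum>S" using that by (intro member_le_sum[of _ _ "\<lambda>x. x"]) (auto simp: beta_sets_def)
    then show "x \<in> {..M}" using that by (simp add: beta_sets_def M_def)
  qed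
  have "(\<Sum>r\<in>shapes_of n. \<Sum>(b, g)\<in>hook_pairs (beta_set n r). F (b - g))
      = (\<Sum>S\<in>beta_sets n n. \<Sum>(b, g)\<in>hook_pairs S. F (b - g))"
    by (rule sum.reindex_bij_betw[OF bij_betw_beta_sets[OF order_refl]])
  also have "\<dots> = (\<Sum>S\<in>beta_sets n n. \<Sum>k\<in>{1..M}. of_nat (hook_count k S) * F k)"
    by (intro sum.cong refl sum_hook_pairs bound) (auto simp: beta_sets_def)
  also have "\<dots> = (\<Sum>k\<in>{1..M}. of_nat (\<Sum>S\<in>beta_sets n n. hook_count k S) * F k)"
    by (subst sum.swap) (simp add: sum_distrib_right)
  also have "\<dots> = (\<Sum>k\<in>{1..M}. of_nat k * F k * fps_nth (shape_fps * multiples_fps k) n)"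
    by (intro sum.cong refl) (subst sum_hook_count, auto simp: mult_ac)
  also have "\<dots> = (\<Sum>k\<in>{1..M}. \<Sum>i = 0..n. fps_nth shape_fps i * (of_nat k * F k * fps_nth (multiples_fps k) (n - i)))"
    by (simp add: fps_mult_nth sum_distrib_left mult_ac)
  also have "\<dots> = (\<Sum>i = 0..n. fps_nth shape_fps i * (\<Sum>k\<in>{1..M}. of_nat k * F k * fps_nth (multiples_fps k) (n - i)))"
    by (subst sum.swap) (simp add: sum_distrib_left)
  also have "\<dots> = (\<Sum>i = 0..n. fps_nth shape_fps i * fps_nth (divisor_fps (\<lambda>k. of_nat k * F k)) (n - i))"
  proof (intro sum.cong refl arg_cong2[where f = "(*)"])
    fix i
    let ?m = "n - i"
    have "(\<Sum>k\<in>{1..M}. of_nat k * F k * fps_nth (multiples_fps k) ?m)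
        = (\<Sum>k<M. of_nat (Suc k) * F (Suc k) * fps_nth (multiples_fps (Suc k)) ?m)"
      by (rule sum.reindex_bij_witness[where i = Suc and j = "\<lambda>k. k - 1"]) auto
    also have "\<dots> = (\<Sum>k<?m. of_nat (Suc k) * F (Suc k) * fps_nth (multiples_fps (Suc k)) ?m)"
      by (rule sum.mono_neutral_right) (auto simp: M_def multiples_fps_def dest: dvd_imp_le)
    also have "\<dots> = fps_nth (divisor_fps (\<lambda>k. of_nat k * F k)) ?m"
      unfolding divisor_fps_def fps_nth_Abs_fps
      by (rule sum.cong) (auto simp: multiples_fps_def)
    finally show "(\<Sum>k\<in>{1..M}. of_nat k * F k * fps_nth (multiples_fps k) ?m)
        = fps_nth (divisor_fps (\<lambda>k. of_nat k * F k)) ?m" .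
  qed
  finally show ?thesis by (simp add: fps_mult_nth)
qed

section \<open>Sums over pairs of hooks\<close>

text \<open>The coefficients are 1, -e_1 and e_2 of the values w; the last part is Newton's identity
  2 e_2 = p_1^2 - p_2.\<close>

lemma coeff_prod_linear:
  fixes w :: "'b \<Rightarrow> 'a :: field_char_0"
  assumes "finite A"
  shows "coeff (\<Prod>v\<in>A. [:1, - w v:]) 0 = 1"
    and "coeff (\<Prod>v\<in>A. [:1, - w v:]) 1 = - sum w A"
    and "2 * coeff (\<Prod>v\<in>A. [:1, - w v:]) 2 = (sum w A)\<^sup>2 - (\<Sum>v\<in>A. (w v)\<^sup>2)"
  using assms
proof (induction A rule: finite_induct)
  case (insert x A)
  let ?p = "\<Prod>v\<in>A. [:1, - w v:]"
  have p: "(\<Prod>v\<in>insert x A. [:1, - w v:]) = [:1, - w x:] * ?p"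
    using insert(1,2) by simp
  have c0: "coeff ([:1, - w x:] * q) 0 = coeff q 0" for q by simp
  have cS: "coeff ([:1, - w x:] * q) (Suc n) = coeff q (Suc n) - w x * coeff q n" for q n by simp
  {
    case 1
    then show ?case unfolding p c0 using insert.IH(1) .
  next
    case 2
    then show ?case unfolding p One_nat_def cS using insert by simp
  next
    case 3
    have "2 * coeff ([:1, - w x:] * ?p) 2 = 2 * coeff ?p 2 - 2 * w x * coeff ?p 1"
      unfolding numeral_2_eq_2 cS One_nat_def by (simp add: algebra_simps)
    also have "\<dots> = (w x + sum w A)\<^sup>2 - ((w x)\<^sup>2 + (\<Sum>v\<in>A. (w v)\<^sup>2))"
      unfolding insert.IH by (simp add: power2_eq_square algebra_simps)
    finally show ?case unfolding p using insert(1,2) by simp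
  }
qed simp_all

lemma divisor_fps_0: "fps_nth (divisor_fps c) 0 = 0"
  by (simp add: divisor_fps_def)

text \<open>As g has no constant term, its powers beyond n do not reach degree n, and an explicit
  polynomial in z remains.\<close>

lemma fps_exp_compose_nth_poly:
  assumes "fps_nth g 0 = 0"
  shows "fps_nth (h * (fps_exp (- z) oo g)) n
       = poly (\<Sum>i\<le>n. monom ((- 1) ^ i / fact i * fps_nth (h * g ^ i) n) i) (z :: 'a :: field_char_0)"
proof -
  have "fps_nth (fps_exp (- z) oo g) m = (\<Sum>i\<le>n. (- z) ^ i / fact i * fps_nth (g ^ i) m)" if "m \<le> n" for m
    unfolding fps_compose_nth using that startsby_zero_power_prefix[OF assms]
    by (intro sum.mono_neutral_cong_left) auto
  then have "fps_nth (h * (fps_exp (- z) oo g)) n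
      = (\<Sum>m = 0..n. fps_nth h m * (\<Sum>i\<le>n. (- z) ^ i / fact i * fps_nth (g ^ i) (n - m)))"
    by (simp add: fps_mult_nth)
  also have "\<dots> = (\<Sum>i\<le>n. (- z) ^ i / fact i * fps_nth (h * g ^ i) n)"
    unfolding fps_mult_nth sum_distrib_left by (subst sum.swap) (simp add: mult_ac)
  also have "\<dots> = (\<Sum>i\<le>n. (- 1) ^ i / fact i * fps_nth (h * g ^ i) n * z ^ i)"
    by (rule sum.cong) (simp_all add: power_minus[of z] mult_ac)
  finally show ?thesis by (simp add: poly_sum poly_monom)
qed

lemma finite_hook_pairs: "finite S \<Longrightarrow> finite (hook_pairs S)"
  by (simp add: hook_pairs_def)

text \<open>Twice the coefficient of z^2 in the Nekrasov--Okounkov formula; on the right the factor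
  2 cancels the 1/2! of the exponential.\<close>

lemma pairs_of_hooks_sum:
  fixes w :: "nat \<times> nat \<Rightarrow> rat"
  defines "w \<equiv> \<lambda>(b, g). 1 / (of_nat (b - g))\<^sup>2"
  shows "(\<Sum>r\<in>shapes_of n. (sum w (hook_pairs (beta_set n r)))\<^sup>2 - (\<Sum>v\<in>hook_pairs (beta_set n r). (w v)\<^sup>2))
       = fps_nth (shape_fps * sigma_fps\<^sup>2) n"
proof -
  let ?H = "\<lambda>r. hook_pairs (beta_set n r)"
  let ?p = "\<Sum>r\<in>shapes_of n. \<Prod>v\<in>?H r. [:1, - w v:]"
  let ?q = "\<Sum>i\<le>n. monom ((- 1) ^ i / fact i * fps_nth (shape_fps * sigma_fps ^ i) n) i"
  have "poly ?p z = poly ?q z" for z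
  proof -
    have "poly ?p z = (\<Sum>r\<in>shapes_of n. \<Prod>(b, g)\<in>?H r. 1 - z / (of_nat (b - g))\<^sup>2)"
      unfolding poly_sum poly_prod by (intro sum.cong prod.cong refl) (auto simp: w_def)
    also have "\<dots> = poly ?q z"
      unfolding nekrasov_okounkov by (rule fps_exp_compose_nth_poly[OF divisor_fps_0])
    finally show ?thesis .
  qed
  then have "?p = ?q" by (intro poly_eq_poly_eq_iff[THEN iffD1] ext)
  then have "2 * coeff ?p 2 = 2 * coeff ?q 2" by (rule arg_cong)
  moreover have "2 * coeff ?p 2 = (\<Sum>r\<in>shapes_of n. (sum w (?H r))\<^sup>2 - (\<Sum>v\<in>?H r. (w v)\<^sup>2))"
    unfolding coeff_sum sum_distrib_left
    by (intro sum.cong refl coeff_prod_linear finite_hook_pairs finite_beta_set)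
  moreover have "2 * coeff ?q 2 = fps_nth (shape_fps * sigma_fps\<^sup>2) n"
  proof (cases "2 \<le> n")
    case True
    then show ?thesis by (simp add: coeff_sum numeral_2_eq_2[symmetric])
  next
    \<comment> \<open>The polynomial \<open>?q\<close> stops before z^2 here, in accordance with
      \<open>sigma_fps\<^sup>2\<close> starting in degree 2.\<close>
    case False
    have "fps_nth (sigma_fps\<^sup>2) m = 0" if "m < 2" for m
      using startsby_zero_power_prefix[OF divisor_fps_0] that by blast
    then have "fps_nth (shape_fps * sigma_fps\<^sup>2) n = 0" using False by (simp add: fps_mult_nth)
    moreover have "coeff ?q 2 = 0" using False by (simp add: coeff_sum)
    ultimately show ?thesis by simp
  qed
  ultimately show ?thesis by simp
qed

text \<open>A corner box: where a row is longer than the next one, the number just below its beta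
  number is missing.\<close>

lemma exists_hook_1:
  assumes "r \<in> shapes_of n" "0 < n"
  obtains b g where "(b, g) \<in> hook_pairs (beta_set n r)" "b - g = 1"
proof -
  have sh: "r \<in> shapes" and wt: "wt r = n" using assms(1) by (auto simp: shapes_of_def)
  have rn: "r i = 0" if "i \<ge> n" for i using shapes_window[OF sh] wt that by simp
  have "\<exists>i. r (Suc i) < r i"
  proof (rule ccontr)
    assume "\<not> (\<exists>i. r (Suc i) < r i)"
    then have "incseq r" by (intro incseq_SucI) (simp add: not_less)
    then have "r i \<le> r n" if "i \<le> n" for i using that by (rule incseqD)
    then have "r i = 0" if "i < n" for i using rn[of n] that by (metis le_refl le_zero_eq less_imp_le)
    then have "wt r = 0" using wt_window[of n r] rn by simp
    then show False using wt assms(2) by simp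
  qed
  then obtain i where i: "r (Suc i) < r i" by blast
  have "i < n" using i rn[of i] by (cases "i < n") auto
  have "beta n r i - 1 \<notin> beta_set n r"
  proof
    assume "beta n r i - 1 \<in> beta_set n r"
    then obtain k where k: "k < n" "beta n r i - 1 = beta n r k" by (auto simp: beta_set_def)
    have "0 < beta n r i" using i by (simp add: beta_def)
    then have "beta n r k < beta n r i" using k(2) by simp
    then have "i < k" using beta_le[OF sh, of k i n] \<open>i < n\<close> by (cases "i < k") auto
    then have "r k \<le> r (Suc i)" using shapes_antimono[OF sh, of "Suc i" k] by simp
    moreover have "r i + (n - Suc i) - 1 = r k + (n - Suc k)" using k(2) by (simp only: beta_def)
    ultimately show False using i \<open>i < k\<close> k(1) by linarith
  qed
  moreover have "0 < beta n r i" using i by (simp add: beta_def)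
  ultimately have "(beta n r i, beta n r i - 1) \<in> hook_pairs (beta_set n r)"
    using \<open>i < n\<close> by (auto simp: hook_pairs_def beta_set_def)
  then show thesis using \<open>0 < beta n r i\<close> by (intro that) auto
qed

text \<open>Every nonempty partition has a hook of length 1, so the Nekrasov--Okounkov formula
  at \<open>z = 1\<close> is the generating function of partitions.\<close>

lemma shape_fps_eq: "shape_fps = fps_exp 1 oo sigma_fps"
proof -
  have "shape_fps * (fps_exp (- 1) oo sigma_fps) = 1"
  proof (rule fps_ext)
    fix n
    have "fps_nth (shape_fps * (fps_exp (- 1) oo sigma_fps)) n
        = (\<Sum>r\<in>shapes_of n. \<Prod>(b, g)\<in>hook_pairs (beta_set n r). 1 - 1 / (of_nat (b - g))\<^sup>2)"
      using nekrasov_okounkov[of 1 n] by simp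
    also have "\<dots> = (if n = 0 then 1 else 0)"
    proof (cases "n = 0")
      case True
      have "shapes_of 0 = {\<lambda>_. 0}"
      proof (intro equalityI subsetI)
        fix f assume "f \<in> shapes_of 0"
        then have "f i = 0" for i using shapes_window[of f i] by (simp add: shapes_of_def)
        then show "f \<in> {\<lambda>_. 0}" by (simp add: fun_eq_iff)
      qed (simp add: shapes_of_def shapes_def wt_def antimono_def)
      then show ?thesis using True by (simp add: hook_pairs_def beta_set_def)
    next
      case False
      have "(\<Prod>(b, g)\<in>hook_pairs (beta_set n r). 1 - 1 / (of_nat (b - g))\<^sup>2) = (0 :: rat)"
        if r: "r \<in> shapes_of n" for r
      proof -
        obtain b g where bg: "(b, g) \<in> hook_pairs (beta_set n r)" "b - g = 1"
          using exists_hook_1[OF r] False by blast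
        show ?thesis
          by (rule prod_zero[OF finite_hook_pairs[OF finite_beta_set]], rule bexI[OF _ bg(1)]) (simp add: bg(2))
      qed
      then show ?thesis using False by simp
    qed
    finally show "fps_nth (shape_fps * (fps_exp (- 1) oo sigma_fps)) n = fps_nth 1 n" by simp
  qed
  moreover have inv: "(fps_exp 1 oo sigma_fps) * (fps_exp (- 1) oo sigma_fps) = 1"
    by (subst fps_compose_mult_distrib[OF divisor_fps_0, symmetric])
       (simp add: fps_exp_add_mult[symmetric])
  moreover have "fps_exp (- 1) oo sigma_fps \<noteq> 0" using inv by (metis mult_zero_right zero_neq_one)
  ultimately show ?thesis
    using mult_right_cancel[of "fps_exp (- 1) oo sigma_fps" shape_fps "fps_exp 1 oo sigma_fps"] by simp
qed

section \<open>Infinite products and sums, and the final assembly\<close>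

lemma inverse_geometric: "inverse (1 - fps_X) oo fps_X ^ Suc k = (1 / (1 - fps_X ^ Suc k) :: 'a :: field fps)"
proof -
  have "inverse (1 - fps_X) oo fps_X ^ Suc k = inverse ((1 - fps_X) oo fps_X ^ Suc k :: 'a fps)"
    by (rule fps_inverse_compose) simp_all
  also have "(1 - fps_X) oo fps_X ^ Suc k = (1 - fps_X ^ Suc k :: 'a fps)"
    by (simp add: fps_compose_sub_distrib del: power_Suc)
  finally show ?thesis by (simp add: fps_divide_unit del: power_Suc)
qed

lemma euler_product: "(\<Prod>m. 1 / (1 - fps_X ^ Suc m)) = shape_fps"
proof -
  let ?f = "\<lambda>m. 1 / (1 - fps_X ^ Suc m) :: rat fps"
  have lim: "(\<lambda>n. \<Prod>i\<le>n. ?f (i + 0)) \<longlonglongrightarrow> shape_fps"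
  proof (rule tendsto_fpsI)
    fix m
    have "fps_nth (\<Prod>i\<le>n. ?f (i + 0)) m = fps_nth shape_fps m" if "m \<le> n" for n
    proof -
      have "(\<Prod>i\<le>n. ?f (i + 0)) = (\<Prod>k<Suc n. inverse (1 - fps_X) oo fps_X ^ Suc k)"
        by (simp only: inverse_geometric lessThan_Suc_atMost add_0_right)
      also have "\<dots> = fps_exp 1 oo (\<Sum>k<Suc n. neg_log oo fps_X ^ Suc k)"
        by (rule prod_geometric_exp)
      also have "fps_nth \<dots> m = fps_nth (fps_exp 1 oo sigma_fps) m"
        by (intro fps_compose_cong_upto neg_log_sum_nth) (use that in simp)
      finally show ?thesis unfolding shape_fps_eq .
    qed
    then show "eventually (\<lambda>n. fps_nth (\<Prod>i\<le>n. ?f (i + 0)) m = fps_nth shape_fps m) sequentially"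
      by (auto simp only: eventually_sequentially)
  qed
  have "fps_nth shape_fps 0 = 1" by (simp add: shape_fps_eq)
  then have "shape_fps \<noteq> 0" by auto
  with lim have "?f has_prod shape_fps" unfolding has_prod_def raw_has_prod_def by blast
  \<comment> \<open>\<open>prodinf\<close> is a definite description, so uniqueness is due.
    \<open>has_prod\<close> also allows a product with zero factors, which the constant terms 1
    exclude.\<close>
  moreover have "p = shape_fps" if "?f has_prod p" for p
  proof -
    have "fps_nth (?f i) 0 = 1" for i by (simp add: fps_divide_unit)
    then have "?f i \<noteq> 0" for i by (metis fps_zero_nth zero_neq_one)
    then have "raw_has_prod ?f 0 p" using that unfolding has_prod_def by blast
    then show ?thesis using LIMSEQ_unique[OF _ lim] unfolding raw_has_prod_def by blast
  qed
  ultimately show ?thesis unfolding prodinf_def by (rule the_equality)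
qed

lemma lambert_series:
  "(\<Sum>k. fps_X ^ Suc k * fps_const (c (Suc k)) / (1 - fps_X ^ Suc k)) = divisor_fps c"
proof -
  have nth: "fps_nth (fps_X ^ Suc k * fps_const (c (Suc k)) / (1 - fps_X ^ Suc k)) n
      = (if 0 < n \<and> Suc k dvd n then c (Suc k) else 0)" for k n
  proof -
    have "fps_X ^ Suc k * fps_const (c (Suc k)) / (1 - fps_X ^ Suc k)
        = fps_X ^ Suc k * (fps_const (c (Suc k)) * (1 / (1 - fps_X ^ Suc k)))"
      by (simp add: fps_divide_unit mult.assoc del: power_Suc)
    also have "fps_nth \<dots> n = (if n < Suc k then 0 else if Suc k dvd n - Suc k then c (Suc k) else 0)"
      unfolding fps_X_power_mult_nth inverse_geometric[symmetric] fps_mult_left_const_nth fps_nth_compose_X_power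
      by (simp add: inverse_1_minus_X_nth)
    also have "\<dots> = (if 0 < n \<and> Suc k dvd n then c (Suc k) else 0)"
      by (auto simp: dvd_minus_self dest: dvd_imp_le)
    finally show ?thesis .
  qed
  have "(\<lambda>k. fps_X ^ Suc k * fps_const (c (Suc k)) / (1 - fps_X ^ Suc k)) sums
      Abs_fps (\<lambda>n. \<Sum>k<n. fps_nth (fps_X ^ Suc k * fps_const (c (Suc k)) / (1 - fps_X ^ Suc k)) n)"
    by (rule fps_sums_finite_coeffs) (simp only: nth, auto dest: dvd_imp_le)
  moreover have "Abs_fps (\<lambda>n. \<Sum>k<n. fps_nth (fps_X ^ Suc k * fps_const (c (Suc k)) / (1 - fps_X ^ Suc k)) n)
      = divisor_fps c"
    unfolding divisor_fps_def nth by (intro arg_cong[where f = Abs_fps] ext sum.cong) auto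
  ultimately show ?thesis by (simp add: sums_iff)
qed

lemma suminf_fps_X_const:
  "fps_nth (\<Sum>n. fps_X ^ Suc n * fps_const (a (Suc n)) :: 'a :: comm_ring_1 fps) m = (if m = 0 then 0 else a m)"
proof -
  have "(\<lambda>n. fps_X ^ Suc n * fps_const (a (Suc n))) sums
      Abs_fps (\<lambda>m. \<Sum>n<m. fps_nth (fps_X ^ Suc n * fps_const (a (Suc n))) m)"
    by (rule fps_sums_finite_coeffs) (subst fps_X_power_mult_nth, simp)
  then have "fps_nth (\<Sum>n. fps_X ^ Suc n * fps_const (a (Suc n))) m
      = (\<Sum>n<m. fps_nth (fps_X ^ Suc n * fps_const (a (Suc n))) m)"
    by (simp add: sums_iff del: power_Suc)
  also have "\<dots> = (\<Sum>n<m. if n = m - 1 then a m else 0)"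
    unfolding fps_X_power_mult_nth by (rule sum.cong) auto
  finally show ?thesis by simp
qed

lemma squared_hook_sum:
  "(\<Sum>\<mu>\<in>partitions n. (\<Sum>v\<in>boxes \<mu>. 1 / (of_nat (hook_length \<mu> v))\<^sup>2)\<^sup>2)
     = fps_nth (shape_fps * (divisor_fps (\<lambda>k. 1 / of_nat k ^ 3) + sigma_fps\<^sup>2)) n"
proof -
  define w where "w = (\<lambda>(b, g). 1 / (of_nat (b - g))\<^sup>2 :: rat)"
  let ?H = "\<lambda>r. hook_pairs (beta_set n r)"
  have len: "length \<mu> \<le> n" if "\<mu> \<in> partitions n" for \<mu>
  proof (rule ccontr)
    assume "\<not> length \<mu> \<le> n"
    then have "shape_of \<mu> n \<noteq> 0" using shape_of_nonzero[OF that] by simp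
    then show False
      using shapes_window[of "shape_of \<mu>" n] shape_of_mem[OF that] by (simp add: shapes_of_def)
  qed
  have "(\<Sum>\<mu>\<in>partitions n. (\<Sum>v\<in>boxes \<mu>. 1 / (of_nat (hook_length \<mu> v))\<^sup>2)\<^sup>2)
      = (\<Sum>\<mu>\<in>partitions n. (sum w (?H (shape_of \<mu>)))\<^sup>2)"
    unfolding w_def
    by (intro sum.cong refl arg_cong[where f = "\<lambda>x. x\<^sup>2"] sum_hooks[where F = "\<lambda>h. 1 / (of_nat h)\<^sup>2"] len)
  also have "\<dots> = (\<Sum>r\<in>shapes_of n. (sum w (?H r))\<^sup>2)"
    by (rule sum.reindex_bij_betw[OF bij_betw_shape_of])
  also have "\<dots> = (\<Sum>r\<in>shapes_of n. (sum w (?H r))\<^sup>2 - (\<Sum>v\<in>?H r. (w v)\<^sup>2))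
      + (\<Sum>r\<in>shapes_of n. \<Sum>v\<in>?H r. (w v)\<^sup>2)"
    by (simp add: sum_subtractf)
  also have "(\<Sum>r\<in>shapes_of n. (sum w (?H r))\<^sup>2 - (\<Sum>v\<in>?H r. (w v)\<^sup>2)) = fps_nth (shape_fps * sigma_fps\<^sup>2) n"
    unfolding w_def by (rule pairs_of_hooks_sum)
  also have "(\<Sum>r\<in>shapes_of n. \<Sum>v\<in>?H r. (w v)\<^sup>2)
      = (\<Sum>r\<in>shapes_of n. \<Sum>(b, g)\<in>?H r. (\<lambda>h. 1 / of_nat h ^ 4) (b - g))"
    by (intro sum.cong refl) (auto simp: w_def power_divide power_mult[symmetric])
  also have "\<dots> = fps_nth (shape_fps * divisor_fps (\<lambda>k. of_nat k * (1 / of_nat k ^ 4))) n"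
    by (rule sum_over_hooks)
  \<comment> \<open>One factor k from counting hooks reduces 1/k^4 to 1/k^3; at k = 0 both sides are
    0 by the convention for division.\<close>
  also have "divisor_fps (\<lambda>k. of_nat k * (1 / of_nat k ^ 4)) = divisor_fps (\<lambda>k. 1 / of_nat k ^ 3)"
  proof -
    have "(of_nat k :: rat) * (1 / of_nat k ^ 4) = 1 / of_nat k ^ 3" for k
      by (cases "k = 0") (simp_all add: power_eq_if)
    then show ?thesis by simp
  qed
  finally show ?thesis by (simp add: distrib_left)
qed

theorem theorem6p9:
  shows "(\<Sum>n. fps_X ^ Suc n *
            fps_const (\<Sum>\<mu>\<in>partitions (Suc n).
              (\<Sum>v\<in>boxes \<mu>. 1 / (of_nat (hook_length \<mu> v))\<^sup>2)\<^sup>2))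
       = (\<Prod>m. 1 / (1 - fps_X ^ Suc m)) *
         ((\<Sum>k. fps_X ^ Suc k * fps_const (1 / of_nat (Suc k) ^ 3) / (1 - fps_X ^ Suc k)) +
          (\<Sum>k. fps_X ^ Suc k * fps_const (1 / of_nat (Suc k)) / (1 - fps_X ^ Suc k))\<^sup>2
          :: rat fps)"
proof (rule fps_ext)
  fix m
  let ?R = "shape_fps * (divisor_fps (\<lambda>k. 1 / of_nat k ^ 3) + sigma_fps\<^sup>2)"
  \<comment> \<open>The left side begins at n = 1, so the right side must have no constant
    term.\<close>
  have "fps_nth ?R 0 = 0" by (simp add: divisor_fps_0 fps_mult_nth power2_eq_square)
  then have "fps_nth (\<Sum>n. fps_X ^ Suc n *
            fps_const (\<Sum>\<mu>\<in>partitions (Suc n).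
              (\<Sum>v\<in>boxes \<mu>. 1 / (of_nat (hook_length \<mu> v))\<^sup>2)\<^sup>2)) m = fps_nth ?R m"
    unfolding suminf_fps_X_const squared_hook_sum by simp
  also have "?R = (\<Prod>m. 1 / (1 - fps_X ^ Suc m)) *
         ((\<Sum>k. fps_X ^ Suc k * fps_const (1 / of_nat (Suc k) ^ 3) / (1 - fps_X ^ Suc k)) +
          (\<Sum>k. fps_X ^ Suc k * fps_const (1 / of_nat (Suc k)) / (1 - fps_X ^ Suc k))\<^sup>2)"
    by (simp only: euler_product lambert_series[of "\<lambda>k. 1 / of_nat k ^ 3"] lambert_series[of "\<lambda>k. 1 / of_nat k"])
  finally show "fps_nth (\<Sum>n. fps_X ^ Suc n *
            fps_const (\<Sum>\<mu>\<in>partitions (Suc n).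
              (\<Sum>v\<in>boxes \<mu>. 1 / (of_nat (hook_length \<mu> v))\<^sup>2)\<^sup>2)) m
     = fps_nth ((\<Prod>m. 1 / (1 - fps_X ^ Suc m)) *
         ((\<Sum>k. fps_X ^ Suc k * fps_const (1 / of_nat (Suc k) ^ 3) / (1 - fps_X ^ Suc k)) +
          (\<Sum>k. fps_X ^ Suc k * fps_const (1 / of_nat (Suc k)) / (1 - fps_X ^ Suc k))\<^sup>2 :: rat fps)) m" .
qed

end
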